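(* Let $f=0$ and $u_0\in\mathcal H$. Then the solution $u$ of the 2D periodic hyperviscous Navier-Stokes equations $$u_t+\nu\Delta^2u+(u\cdot\nabla)u+\nabla p=f,\qquad \operatorname{div}u=0,\qquad u(0)=u_0,\qquad x\in\mathbb T^2,$$ satisfies, whenever $u(t_0)\neq 0$, $$e^{-b(t-t_0)}|u(t_0)|\le|u(t)|\le e^{-\nu\lambda_1^2(t-t_0)}|u(t_0)|\qquad\text{for } t\ge t_0>0,$$ where $$b=\nu\,\frac{|Au(t_0)|^2}{|u(t_0)|^2}\exp\left\{c\,\nu^{-3/2}\lambda_1^{-2}|u(t_0)|^2\right\},\qquad \lambda_1=(2\pi/L)^2,$$ and $c$ is a dimensionless constant.
   Context: Here $\nu>0$, $L>0$, $\mathbb T=[-\tfrac L2,\tfrac L2]$ with periodic boundary conditions, and $u_0$, $f$ and $u$ have spatial mean value zero. $|\cdot|$ is the norm of $L^2_{per}(\mathbb T^2)^2$, the space of square integrable $\mathbb R^2$-valued functions that are $L$-periodic in each variable. $\mathcal H$ is the closure in $L^2_{per}(\mathbb T^2)^2$ of the set of $\mathbb R^2$-valued ($L$-periodic) trigonometric polynomials $\varphi$ with $\operatorname{div}\varphi=0$ and $\int_{\mathbb T^2}\varphi\,dx=0$. $P$ is the orthogonal projection of $L^2_{per}(\mathbb T^2)^2$ onto $\mathcal H$, and $Au=-P\Delta u$; $\lambda_1$ is the first eigenvalue of $A$. The well-posedness of the equations for $t\in[0,\infty)$ with $u_0\in\mathcal H$ is classical.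
   Formalization: With the printed ν^{-3/2} no c independent of ν exists (rescaling time shows ν^{-2} is the consistent power). Here c may depend on ν, but not on L, u_0, t_0 or t; rescaling from ν=1 gives c=Cν^{-1/2} with C universal. *)

theory Defs
  imports "HOL-Analysis.Analysis"
begin

definition cell :: "real \<Rightarrow> (real^2) set" where
  "cell L = cbox (\<chi> i. - L / 2) (\<chi> i. L / 2)"

(* Elements of L^2_per are represented by functions on the whole plane; no quotient by
   almost-everywhere equality is taken, so equality of classes is "l2norm of the
   difference is 0". *)
definition L2per :: "real \<Rightarrow> (real^2 \<Rightarrow> 'b::euclidean_space) set" where
  "L2per L = {u. u \<in> borel_measurable lebesgue \<and>
                 (\<forall>x i. u (x + L *\<^sub>R axis i 1) = u x) \<and>
                 set_integrable lebesgue (cell L) (\<lambda>x. (norm (u x))\<^sup>2)}"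

definition l2inner :: "real \<Rightarrow> (real^2 \<Rightarrow> 'b::euclidean_space) \<Rightarrow> (real^2 \<Rightarrow> 'b) \<Rightarrow> real" where
  "l2inner L u v = set_lebesgue_integral lebesgue (cell L) (\<lambda>x. u x \<bullet> v x)"

definition l2norm :: "real \<Rightarrow> (real^2 \<Rightarrow> 'b::euclidean_space) \<Rightarrow> real" where
  "l2norm L u = sqrt (l2inner L u u)"

definition pd :: "2 \<Rightarrow> (real^2 \<Rightarrow> 'b::real_normed_vector) \<Rightarrow> real^2 \<Rightarrow> 'b" where
  "pd i \<phi> x = frechet_derivative \<phi> (at x) (axis i 1)"

definition divergence :: "(real^2 \<Rightarrow> real^2) \<Rightarrow> real^2 \<Rightarrow> real" where
  "divergence \<phi> x = (\<Sum>i\<in>UNIV. pd i (\<lambda>y. \<phi> y $ i) x)"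

definition laplacian :: "(real^2 \<Rightarrow> 'b::real_normed_vector) \<Rightarrow> real^2 \<Rightarrow> 'b" where
  "laplacian \<phi> x = (\<Sum>i\<in>UNIV. pd i (pd i \<phi>) x)"

definition advect :: "(real^2 \<Rightarrow> real^2) \<Rightarrow> (real^2 \<Rightarrow> real^2) \<Rightarrow> real^2 \<Rightarrow> real^2" where
  "advect u \<phi> x = (\<Sum>i\<in>UNIV. (u x $ i) *\<^sub>R pd i \<phi> x)"

definition trig_poly :: "real \<Rightarrow> (real^2 \<Rightarrow> real^2) set" where
  "trig_poly L = {\<phi>. \<exists>(K :: (int^2) set) (a :: int^2 \<Rightarrow> real^2) (b :: int^2 \<Rightarrow> real^2). finite K \<and>
     \<phi> = (\<lambda>x. \<Sum>k\<in>K. let \<theta> = 2 * pi / L * (\<Sum>i\<in>UNIV. of_int (k $ i) * x $ i)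
                      in cos \<theta> *\<^sub>R a k + sin \<theta> *\<^sub>R b k)}"

definition sol_trig_poly :: "real \<Rightarrow> (real^2 \<Rightarrow> real^2) set" where
  "sol_trig_poly L = {\<phi> \<in> trig_poly L. (\<forall>x. divergence \<phi> x = 0) \<and>
                        set_lebesgue_integral lebesgue (cell L) \<phi> = 0}"

definition H :: "real \<Rightarrow> (real^2 \<Rightarrow> real^2) set" where
  "H L = {u \<in> L2per L. \<forall>\<epsilon>>0. \<exists>\<phi>\<in>sol_trig_poly L. l2norm L (\<lambda>x. u x - \<phi> x) < \<epsilon>}"

definition proj :: "real \<Rightarrow> (real^2 \<Rightarrow> real^2) \<Rightarrow> real^2 \<Rightarrow> real^2" where
  "proj L v = (SOME w. w \<in> H L \<and> (\<forall>h\<in>H L. l2inner L (\<lambda>x. v x - w x) h = 0))"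

(* Laplacian in the sense of periodic distributions, when it lies in L^2_per. *)
definition has_weak_laplacian ::
  "real \<Rightarrow> (real^2 \<Rightarrow> real^2) \<Rightarrow> (real^2 \<Rightarrow> real^2) \<Rightarrow> bool" where
  "has_weak_laplacian L u g \<longleftrightarrow>
     g \<in> L2per L \<and> (\<forall>\<phi>\<in>trig_poly L. l2inner L u (laplacian \<phi>) = l2inner L g \<phi>)"

definition dom_stokes :: "real \<Rightarrow> (real^2 \<Rightarrow> real^2) set" where
  "dom_stokes L = {u \<in> H L. \<exists>g. has_weak_laplacian L u g}"

(* Both choices (here and in proj) are unique up to null sets. *)
definition stokes :: "real \<Rightarrow> (real^2 \<Rightarrow> real^2) \<Rightarrow> real^2 \<Rightarrow> real^2" where
  "stokes L u = proj L (\<lambda>x. - (SOME g. has_weak_laplacian L u g) x)"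

definition stokes_eigenvalue :: "real \<Rightarrow> real \<Rightarrow> bool" where
  "stokes_eigenvalue L \<mu> \<longleftrightarrow>
     (\<exists>v\<in>dom_stokes L. l2norm L v \<noteq> 0 \<and> l2norm L (\<lambda>x. stokes L v x - \<mu> *\<^sub>R v x) = 0)"

definition lambda1 :: "real \<Rightarrow> real" where
  "lambda1 L = (LEAST \<mu>. stokes_eigenvalue L \<mu>)"

(* Solution with velocity u, pressure p and force f, in the class
   C([0,\<infinity>); H) \<inter> L^2_loc([0,\<infinity>); D(A)) in which the problem is well posed for every u0 in H.
   The momentum equation is tested against all vector trigonometric polynomials (not only
   solenoidal ones, so the pressure stays in it) and integrated in time from 0 to t.
   Since div u = 0, the advection term (u . grad) u paired with phi is - (u, (u . grad) phi).
   The constraint div u = 0 and the zero mean of u are contained in u t \<in> H L. *)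
definition hns_solution ::
  "real \<Rightarrow> real \<Rightarrow> (real \<Rightarrow> real^2 \<Rightarrow> real^2) \<Rightarrow> (real^2 \<Rightarrow> real^2) \<Rightarrow>
   (real \<Rightarrow> real^2 \<Rightarrow> real^2) \<Rightarrow> (real \<Rightarrow> real^2 \<Rightarrow> real) \<Rightarrow> bool" where
  "hns_solution \<nu> L f u0 u p \<longleftrightarrow>
     (\<forall>t\<ge>0. f t \<in> L2per L \<and> set_lebesgue_integral lebesgue (cell L) (f t) = 0) \<and>
     (\<forall>t\<ge>0. p t \<in> L2per L) \<and>
     (\<forall>t\<ge>0. u t \<in> H L) \<and>
     (\<forall>t\<ge>0. ((\<lambda>s. l2norm L (\<lambda>x. u s x - u t x)) \<longlongrightarrow> 0) (at t within {0..})) \<and>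
     (AE s in lebesgue. 0 \<le> s \<longrightarrow> u s \<in> dom_stokes L) \<and>
     (\<forall>t\<ge>0. set_integrable lebesgue {0..t} (\<lambda>s. (l2norm L (stokes L (u s)))\<^sup>2)) \<and>
     l2norm L (\<lambda>x. u 0 x - u0 x) = 0 \<and>
     (\<forall>\<phi>\<in>trig_poly L. \<forall>t\<ge>0.
        set_integrable lebesgue {0..t} (\<lambda>s. l2inner L (p s) (divergence \<phi>)) \<and>
        set_integrable lebesgue {0..t} (\<lambda>s. l2inner L (f s) \<phi>) \<and>
        l2inner L (u t) \<phi> - l2inner L (u 0) \<phi> =
          set_lebesgue_integral lebesgue {0..t} (\<lambda>s.
            - \<nu> * l2inner L (u s) (laplacian (laplacian \<phi>))
            + l2inner L (u s) (advect (u s) \<phi>)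
            + l2inner L (p s) (divergence \<phi>)
            + l2inner L (f s) \<phi>))"

(* Pitfall: nu^(-3/2) * |u|^2 / lambda1^2 is not homogeneous in the time unit (nu^(-2) would
   be). Replacing u by u(x, t/nu)/nu shows that a constant c multiplying it can be uniform in
   L and in the solution, but not in nu: it scales like nu^(-1/2). *)

end

(* In the real orthonormal basis of H given by the fields cas(2 pi k.x / L) k^perp / |k|, with
   cas = cos + sin, a solution becomes a system of scalar equations
   g_k' = - nu lam_k^2 g_k + N_k, in which the sum of N_k g_k vanishes and, by a discrete Agmon
   inequality, the sum of N_k^2 is at most C e a, where e = |u|^2 and a = |Au|^2. Absorbing N
   into the dissipation bounds a at every positive time, and e' = - 2 nu a. Truncated to finitely
   many modes, the quotient a / e has derivative at most (C / nu) a, while the integral of 2 nu a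
   is at most e(t0); hence a / e exceeds its value at t0 by at most C e(t0) / (2 nu^2). Since
   a / e >= lambda_1^2 and 1 + x <= exp x, this additive bound yields the exponential in b, and
   the lower bound follows from e' = - 2 nu (a / e) e. The upper bound is a >= lambda_1^2 e. *)
theory Submission
  imports Defs
begin

section \<open>Integral inequalities in time\<close>

text \<open>What is truncated is the expansion of the given solution, not the equation: every N_k is
  computed from all modes. The coefficients are continuously differentiable in time, while
  \<open>u\<close> is assumed to lie in D(A) only at almost every time and \<open>a\<close> is
  merely integrable; so every identity is differentiated at a finite level and then passed to the
  limit. Three obstacles come with this. The retained modes exchange energy with the discarded ones;
  this flux tends to zero at almost every time and is removed by dominated convergence. The rate b
  needs |Au(t0)| at the prescribed time t0; a bound on the truncated sums that is uniform in the
  truncation puts u(t0) in D(A). The quotient a / e makes sense only while e > 0; that e never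
  reaches zero follows from the lower bound itself, by continuity. In the quotient the square is
  completed in (A^2 - a / e) u, so that the nonlinear term enters through its sum of squares. Its
  constant C = 75 / (2 pi^2) comes from the sup norm bound |v|_inf^2 <= C |v| |Av|, multiplied by
  the interpolation |grad v|^2 <= |v| |Av|.\<close>

lemma AE_lebesgue_Icc_obtain:
  fixes s t :: real
  assumes "AE x in lebesgue. P x" "s < t"
  obtains x where "x \<in> {s..t}" "P x"
proof -
  have "\<exists>x\<in>{s..t}. P x"
  proof (rule ccontr)
    assume "\<not> (\<exists>x\<in>{s..t}. P x)"
    then have "AE x in lebesgue. x \<notin> {s..t}"
      using assms(1) by (auto elim: AE_mp)
    then have "{s..t} \<in> null_sets lebesgue"
      by (subst AE_iff_null_sets) auto
    then show False using assms(2) by (auto simp: null_sets_def)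
  qed
  then show thesis using that by blast
qed

lemma lebesgue_FTC:
  fixes f f' :: "real \<Rightarrow> real"
  assumes st: "s \<le> t" and d: "\<And>x. x \<in> {s..t} \<Longrightarrow> (f has_real_derivative f' x) (at x)"
    and c: "continuous_on {s..t} f'"
  shows "set_integrable lebesgue {s..t} f'" "set_lebesgue_integral lebesgue {s..t} f' = f t - f s"
proof -
  show i: "set_integrable lebesgue {s..t} f'"
    using absolutely_integrable_continuous_real[OF c] .
  have "(f' has_integral f t - f s) {s..t}"
    using d by (intro fundamental_theorem_of_calculus st)
      (auto intro: has_field_derivative_at_within simp flip: has_real_derivative_iff_has_vector_derivative)
  then show "set_lebesgue_integral lebesgue {s..t} f' = f t - f s"
    using set_lebesgue_integral_eq_integral(2)[OF i] by (simp add: integral_unique)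
qed

text \<open>Truncated quantities have continuous derivatives, but these are controlled through
  \<open>a\<close>, which is only integrable and only known almost everywhere. This lemma mediates
  between the two.\<close>

lemma diff_le_lebesgue_integral:
  fixes f f' h :: "real \<Rightarrow> real"
  assumes st: "s \<le> t" and d: "\<And>x. x \<in> {s..t} \<Longrightarrow> (f has_real_derivative f' x) (at x)"
    and c: "continuous_on {s..t} f'" and h: "set_integrable lebesgue {s..t} h"
    and le: "AE x in lebesgue. x \<in> {s..t} \<longrightarrow> f' x \<le> h x"
  shows "f t - f s \<le> set_lebesgue_integral lebesgue {s..t} h"
proof -
  have "set_lebesgue_integral lebesgue {s..t} f' \<le> set_lebesgue_integral lebesgue {s..t} h"
    unfolding set_lebesgue_integral_def
    by (rule integral_mono_AE)
      (use lebesgue_FTC(1)[OF st d c] h le in \<open>auto simp: set_integrable_def indicator_def elim!: eventually_mono\<close>)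
  then show ?thesis using lebesgue_FTC(2)[OF st d c] by simp
qed

text \<open>A Gronwall inequality without derivatives: the energy equality only yields estimates
  over time steps, and their product over \<open>n\<close> equal steps tends to the exponential
  (explicit Euler scheme).\<close>

lemma exp_lower_bound_by_iteration:
  fixes f :: "real \<Rightarrow> real"
  assumes st: "s \<le> t" and K: "0 \<le> K" and pos: "\<And>x. x \<in> {s..t} \<Longrightarrow> 0 \<le> f x"
    and step: "\<And>x y. s \<le> x \<Longrightarrow> x \<le> y \<Longrightarrow> y \<le> t \<Longrightarrow> f x * (1 - K * (y - x)) \<le> f y"
  shows "exp (- K * (t - s)) * f s \<le> f t"
proof -
  \<comment> \<open>The condition on \<open>n\<close> keeps the factor 1 - K h nonnegative, so that
    the induction hypothesis may be multiplied by it.\<close>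
  have main: "(1 + (- K * (t - s)) / real n) ^ n * f s \<le> f t" if n: "real n > K * (t - s)" "n > 0" for n
  proof -
    define h where "h = (t - s) / n"
    have h: "0 \<le> h" "s + n * h = t" "K * h \<le> 1"
      using n st by (auto simp: h_def field_simps)
    have "(1 - K * h) ^ j * f s \<le> f (s + j * h)" if "j \<le> n" for j
      using that
    proof (induction j)
      case (Suc j)
      have jn: "s + real (Suc j) * h \<le> t"
        using Suc.prems h by (metis add_le_cancel_left mult_right_mono of_nat_le_iff)
      have "(1 - K * h) ^ Suc j * f s \<le> (1 - K * h) * f (s + j * h)"
        using Suc h by (auto simp: mult.assoc intro!: mult_left_mono)
      also have "\<dots> = f (s + j * h) * (1 - K * ((s + real (Suc j) * h) - (s + j * h)))"
        by (simp add: algebra_simps)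
      also have "\<dots> \<le> f (s + real (Suc j) * h)"
        using h jn by (intro step) (auto simp: algebra_simps)
      finally show ?case .
    qed simp
    from this[of n] show ?thesis using h by (simp add: h_def)
  qed
  have "((\<lambda>n. (1 + (- K * (t - s)) / real n) ^ n * f s) \<longlonglongrightarrow> exp (- K * (t - s)) * f s)"
    by (intro tendsto_mult tendsto_exp_limit_sequentially tendsto_const)
  moreover obtain n0 :: nat where "K * (t - s) < n0" using reals_Archimedean2 by blast
  then have "eventually (\<lambda>n. (1 + (- K * (t - s)) / real n) ^ n * f s \<le> f t) sequentially"
    using main by (intro eventually_sequentiallyI[of "Suc n0"]) auto
  ultimately show ?thesis by (rule tendsto_upperbound) simp
qed

text \<open>The implicit Euler counterpart. The factor stands at the later time because a decreasing
  energy is bounded from below on a step by its final value.\<close>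

lemma exp_upper_bound_by_iteration:
  fixes f :: "real \<Rightarrow> real"
  assumes st: "s \<le> t" and K: "0 \<le> K"
    and step: "\<And>x y. s \<le> x \<Longrightarrow> x \<le> y \<Longrightarrow> y \<le> t \<Longrightarrow> f y * (1 + K * (y - x)) \<le> f x"
  shows "f t \<le> exp (- K * (t - s)) * f s"
proof -
  have main: "(1 + (K * (t - s)) / real n) ^ n * f t \<le> f s" if n: "n > 0" for n
  proof -
    define h where "h = (t - s) / n"
    have h: "0 \<le> h" "s + n * h = t"
      using n st by (auto simp: h_def field_simps)
    have "(1 + K * h) ^ j * f (s + j * h) \<le> f s" if "j \<le> n" for j
      using that
    proof (induction j)
      case (Suc j)
      have jn: "s + real (Suc j) * h \<le> t"
        using Suc.prems h by (metis add_le_cancel_left mult_right_mono of_nat_le_iff)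
      have "f (s + real (Suc j) * h) * (1 + K * ((s + real (Suc j) * h) - (s + j * h))) \<le> f (s + j * h)"
        using h jn by (intro step) (auto simp: algebra_simps)
      then have "(1 + K * h) * f (s + real (Suc j) * h) \<le> f (s + j * h)"
        by (simp add: algebra_simps)
      then have "(1 + K * h) ^ j * ((1 + K * h) * f (s + real (Suc j) * h)) \<le> (1 + K * h) ^ j * f (s + j * h)"
        using K h by (intro mult_left_mono) auto
      then show ?case using Suc by (simp add: mult.assoc mult.left_commute)
    qed simp
    from this[of n] show ?thesis using h by (simp add: h_def)
  qed
  have "((\<lambda>n. (1 + (K * (t - s)) / real n) ^ n * f t) \<longlonglongrightarrow> exp (K * (t - s)) * f t)"
    by (intro tendsto_mult tendsto_exp_limit_sequentially tendsto_const)
  moreover have "eventually (\<lambda>n. (1 + (K * (t - s)) / real n) ^ n * f t \<le> f s) sequentially"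
    using main by (intro eventually_sequentiallyI[of 1]) auto
  ultimately have "exp (K * (t - s)) * f t \<le> f s" by (rule tendsto_upperbound) simp
  then have "exp (- (K * (t - s))) * (exp (K * (t - s)) * f t) \<le> exp (- (K * (t - s))) * f s"
    by (rule mult_left_mono) simp
  then show ?thesis by (simp flip: mult.assoc exp_add)
qed

text \<open>Dini's argument: points violating the bound accumulate at some \<open>l\<close>, and
  monotonicity in \<open>n\<close> carries the violation over to every \<open>f n l\<close>, hence
  to the limit \<open>g l\<close>. It will keep the denominator of the truncated quotient away from
  zero, uniformly in time.\<close>

lemma incseq_eventually_ge_half:
  fixes f :: "nat \<Rightarrow> real \<Rightarrow> real"
  assumes K: "compact K" and mono: "\<And>x m n. x \<in> K \<Longrightarrow> m \<le> n \<Longrightarrow> f m x \<le> f n x"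
    and lim: "\<And>x. x \<in> K \<Longrightarrow> (\<lambda>n. f n x) \<longlonglongrightarrow> g x"
    and cf: "\<And>n. continuous_on K (f n)" and cg: "continuous_on K g"
    and pos: "\<And>x. x \<in> K \<Longrightarrow> 0 < g x"
  obtains n0 where "\<And>n x. n \<ge> n0 \<Longrightarrow> x \<in> K \<Longrightarrow> g x / 2 \<le> f n x"
proof -
  have "\<exists>n0. \<forall>x\<in>K. g x / 2 \<le> f n0 x"
  proof (rule ccontr)
    assume "\<not> ?thesis"
    then obtain x where x: "\<And>n. x n \<in> K" "\<And>n. f n (x n) < g (x n) / 2"
      by (metis not_le)
    then obtain l r where lr: "l \<in> K" "strict_mono r" "(x \<circ> r) \<longlonglongrightarrow> l"
      using K unfolding compact_def by metis
    have "f n l \<le> g l / 2" for n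
    proof -
      have "(\<lambda>j. f n ((x \<circ> r) j)) \<longlonglongrightarrow> f n l" "(\<lambda>j. g ((x \<circ> r) j) / 2) \<longlonglongrightarrow> g l / 2"
        using continuous_on_tendsto_compose[OF cf lr(3,1)] continuous_on_tendsto_compose[OF cg lr(3,1)] x
        by (auto intro!: tendsto_intros)
      moreover have "eventually (\<lambda>j. f n ((x \<circ> r) j) \<le> g ((x \<circ> r) j) / 2) sequentially"
      proof (rule eventually_sequentiallyI[of n])
        fix j assume "n \<le> j"
        then have "n \<le> r j" using seq_suble[OF lr(2), of j] by simp
        then have "f n (x (r j)) \<le> f (r j) (x (r j))" using x mono by auto
        then show "f n ((x \<circ> r) j) \<le> g ((x \<circ> r) j) / 2" using x(2)[of "r j"] by simp
      qed
      ultimately show ?thesis using tendsto_le[OF sequentially_bot] by blast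
    qed
    then have "g l \<le> g l / 2"
      using lim[OF lr(1)] by (intro LIMSEQ_le_const2) auto
    then show False using pos[OF lr(1)] by simp
  qed
  then obtain n0 where "\<forall>x\<in>K. g x / 2 \<le> f n0 x" ..
  then show thesis using mono by (intro that[of n0]) (meson order_trans)
qed

section \<open>The Galerkin system\<close>

lemma incseq_sum_nonneg:
  fixes f :: "'k \<Rightarrow> real"
  assumes "incseq F" "\<And>n. finite (F n)" "\<And>n k. k \<in> F n \<Longrightarrow> 0 \<le> f k"
  shows "incseq (\<lambda>n. \<Sum>k\<in>F n. f k)"
proof (rule monoI)
  fix m n :: nat assume "m \<le> n"
  then have "F m \<subseteq> F n" using assms(1) by (auto dest: monoD)
  then show "(\<Sum>k\<in>F m. f k) \<le> (\<Sum>k\<in>F n. f k)"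
    using assms by (intro sum_mono2) auto
qed

text \<open>The coefficients \<open>g k\<close> of a solution, with \<open>m k\<close> the square of
  a Stokes eigenvalue, \<open>e\<close> = |u|^2 and \<open>a\<close> = |Au|^2; as the viscous term
  is the squared Laplacian, \<open>a\<close> is exactly the dissipation. Facts involving D(A) are
  assumed at almost every time only. The orthogonality of \<open>N\<close> to \<open>g\<close>
  appears as a limit, since a finite part of the sum need not vanish.\<close>

locale galerkin_system =
  fixes F :: "nat \<Rightarrow> 'k set" and m :: "'k \<Rightarrow> real" and \<nu> C m1 :: real
    and g N :: "'k \<Rightarrow> real \<Rightarrow> real" and e a :: "real \<Rightarrow> real"
  assumes fin: "finite (F n)" and inc: "incseq F"
    and \<nu>: "0 < \<nu>" and C: "0 \<le> C" and m1: "0 < m1" and m: "k \<in> F n \<Longrightarrow> m1 \<le> m k"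
    and deriv: "k \<in> F n \<Longrightarrow> 0 < t \<Longrightarrow> (g k has_real_derivative - \<nu> * m k * g k t + N k t) (at t)"
    and contN: "k \<in> F n \<Longrightarrow> continuous_on {0<..} (N k)"
    and e_lim: "0 < t \<Longrightarrow> (\<lambda>n. \<Sum>k\<in>F n. (g k t)\<^sup>2) \<longlonglongrightarrow> e t"
    and e_cont: "continuous_on {0<..} e"
    and a_int: "0 < s \<Longrightarrow> s \<le> t \<Longrightarrow> set_integrable lebesgue {s..t} a"
    and a_lim: "AE s in lebesgue. 0 < s \<longrightarrow> (\<lambda>n. \<Sum>k\<in>F n. m k * (g k s)\<^sup>2) \<longlonglongrightarrow> a s"
    and N_bound: "AE s in lebesgue. 0 < s \<longrightarrow> (\<forall>n. (\<Sum>k\<in>F n. (N k s)\<^sup>2) \<le> C * e s * a s)"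
    and N_orth: "AE s in lebesgue. 0 < s \<longrightarrow> (\<lambda>n. \<Sum>k\<in>F n. N k s * g k s) \<longlonglongrightarrow> 0"
begin

section \<open>Truncated energy and dissipation\<close>

definition En :: "nat \<Rightarrow> real \<Rightarrow> real" where "En n t = (\<Sum>k\<in>F n. (g k t)\<^sup>2)"
definition An :: "nat \<Rightarrow> real \<Rightarrow> real" where "An n t = (\<Sum>k\<in>F n. m k * (g k t)\<^sup>2)"

lemma m_pos: "k \<in> F n \<Longrightarrow> 0 < m k"
  using m m1 less_le_trans by blast

lemma inc_En: "incseq (\<lambda>n. En n t)"
  unfolding En_def using inc fin by (intro incseq_sum_nonneg) auto

lemma inc_An: "incseq (\<lambda>n. An n t)"
  unfolding An_def by (intro incseq_sum_nonneg inc fin mult_nonneg_nonneg less_imp_le[OF m_pos]) auto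

lemma En_nonneg: "0 \<le> En n t" by (simp add: En_def sum_nonneg)

lemma An_ge: "m1 * En n t \<le> An n t"
  unfolding An_def En_def sum_distrib_left by (intro sum_mono mult_right_mono m) auto

lemma An_nonneg: "0 \<le> An n t"
  using An_ge[of n t] mult_nonneg_nonneg[of m1 "En n t"] En_nonneg[of n t] m1 by linarith

lemma En_le: "0 < t \<Longrightarrow> En n t \<le> e t"
  using incseq_le[OF inc_En, of t "e t" n] e_lim by (simp add: En_def)

lemma e_nonneg: "0 < t \<Longrightarrow> 0 \<le> e t"
  using En_le[of t 0] En_nonneg[of 0 t] by linarith

lemma a_ge: "AE s in lebesgue. 0 < s \<longrightarrow> (\<forall>n. An n s \<le> a s) \<and> m1 * e s \<le> a s"
  using a_lim
proof eventually_elim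
  case (elim s)
  show ?case
  proof
    assume s: "0 < s"
    then have l: "(\<lambda>n. An n s) \<longlonglongrightarrow> a s" using elim by (simp add: An_def)
    have "(\<lambda>n. m1 * En n s) \<longlonglongrightarrow> m1 * e s"
      using e_lim[OF s] by (intro tendsto_intros) (simp add: En_def)
    then have "m1 * e s \<le> a s"
      using l An_ge by (intro LIMSEQ_le) auto
    then show "(\<forall>n. An n s \<le> a s) \<and> m1 * e s \<le> a s"
      using incseq_le[OF inc_An l] by simp
  qed
qed

lemma e_bounded:
  assumes "0 < s" "s \<le> t" obtains E where "0 \<le> E" "\<And>x. x \<in> {s..t} \<Longrightarrow> e x \<le> E"
proof -
  have "continuous_on {s..t} e" using e_cont by (rule continuous_on_subset) (use assms in auto)
  then have "\<exists>x\<in>{s..t}. \<forall>y\<in>{s..t}. e y \<le> e x"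
    using assms by (intro continuous_attains_sup) auto
  then obtain x where "x \<in> {s..t}" "\<And>y. y \<in> {s..t} \<Longrightarrow> e y \<le> e x" by blast
  then show thesis using that[of "e x"] e_nonneg[of x] assms by auto
qed

lemma cont_g: "k \<in> F n \<Longrightarrow> continuous_on {0<..} (g k)"
  by (rule DERIV_continuous_on) (use deriv in \<open>auto intro: has_field_derivative_at_within\<close>)

lemma En_deriv:
  assumes "0 < t"
  shows "(En n has_real_derivative - 2 * \<nu> * An n t + 2 * (\<Sum>k\<in>F n. N k t * g k t)) (at t)"
proof -
  have "(En n has_real_derivative (\<Sum>k\<in>F n. 2 * (- \<nu> * m k * g k t + N k t) * g k t)) (at t)"
    unfolding En_def[abs_def] using assms
    by (auto intro!: derivative_eq_intros deriv sum.cong simp: algebra_simps)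
  also have "(\<Sum>k\<in>F n. 2 * (- \<nu> * m k * g k t + N k t) * g k t) =
      - 2 * \<nu> * An n t + 2 * (\<Sum>k\<in>F n. N k t * g k t)"
    by (simp add: An_def sum_distrib_left power2_eq_square flip: sum.distrib)
      (auto intro!: sum.cong simp: algebra_simps)
  finally show ?thesis .
qed

lemma An_deriv:
  assumes "0 < t"
  shows "(An n has_real_derivative (\<Sum>k\<in>F n. 2 * m k * g k t * (- \<nu> * m k * g k t + N k t))) (at t)"
  unfolding An_def[abs_def]
proof (rule DERIV_sum)
  fix k assume "k \<in> F n"
  then have "((\<lambda>t. m k * (g k t)\<^sup>2) has_real_derivative
      m k * (of_nat 2 * ((- \<nu> * m k * g k t + N k t) * g k t ^ (2 - Suc 0)))) (at t)"
    using assms by (intro DERIV_cmult DERIV_power deriv)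
  then show "((\<lambda>t. m k * (g k t)\<^sup>2) has_real_derivative
      2 * m k * g k t * (- \<nu> * m k * g k t + N k t)) (at t)"
    by (simp add: mult_ac)
qed

lemma cont_An: "continuous_on {0<..} (An n)"
  using An_deriv by (intro DERIV_continuous_on) (auto intro: has_field_derivative_at_within)

lemma cont_En: "continuous_on {0<..} (En n)"
  using En_deriv by (intro DERIV_continuous_on) (auto intro: has_field_derivative_at_within)

text \<open>The right-hand side is the maximum over \<open>y\<close>, attained at y = z / (2 \<nu>):
  the whole dissipation is spent on absorbing the nonlinear term.\<close>

lemma complete_square: "- 2 * \<nu> * y\<^sup>2 + 2 * y * z \<le> z\<^sup>2 / (2 * \<nu>)" for y z :: real
proof -
  have "0 \<le> (2 * \<nu> * y - z)\<^sup>2 / (2 * \<nu>)" using \<nu> by simp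
  also have "\<dots> = 2 * \<nu> * y\<^sup>2 - 2 * y * z + z\<^sup>2 / (2 * \<nu>)"
    using \<nu> by (simp add: power2_eq_square field_simps)
  finally show ?thesis by linarith
qed

text \<open>The dissipation absorbs the nonlinear term, so \<open>An\<close> grows at most by the integrable
  quantity \<open>C e a / (2 \<nu>)\<close>; starting at a time where \<open>a\<close> is finite gives the bound.\<close>
lemma An_bounded:
  assumes t: "0 < t" shows "\<exists>B. \<forall>n. An n t \<le> B"
proof -
  have "AE s in lebesgue. 0 < s \<longrightarrow> (\<forall>n. An n s \<le> a s)"
    using a_ge by eventually_elim auto
  then obtain s where s: "s \<in> {t / 2..t}" "0 < s \<longrightarrow> (\<forall>n. An n s \<le> a s)"
    by (rule AE_lebesgue_Icc_obtain[of _ "t / 2" t]) (use t in auto)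
  have s0: "0 < s" "s \<le> t" using s t by auto
  obtain E where E: "0 \<le> E" "\<And>x. x \<in> {s..t} \<Longrightarrow> e x \<le> E" using e_bounded[OF s0] by blast
  define h where "h x = (C * E / (2 * \<nu>)) * a x" for x
  have "An n t - An n s \<le> set_lebesgue_integral lebesgue {s..t} h" for n
  proof (rule diff_le_lebesgue_integral[OF s0(2) An_deriv])
    show "continuous_on {s..t} (\<lambda>t. \<Sum>k\<in>F n. 2 * m k * g k t * (- \<nu> * m k * g k t + N k t))"
      using s0 by (intro continuous_intros continuous_on_subset[OF cont_g] continuous_on_subset[OF contN]) auto
    show "set_integrable lebesgue {s..t} h"
      unfolding h_def using a_int[OF s0] by (rule set_integrable_mult_right)
    show "AE x in lebesgue. x \<in> {s..t} \<longrightarrow> (\<Sum>k\<in>F n. 2 * m k * g k x * (- \<nu> * m k * g k x + N k x)) \<le> h x"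
      using N_bound a_ge
    proof eventually_elim
      case (elim x)
      show ?case
      proof
        assume x: "x \<in> {s..t}"
        then have x0: "0 < x" using s0 by auto
        have "(\<Sum>k\<in>F n. 2 * m k * g k x * (- \<nu> * m k * g k x + N k x)) \<le> (\<Sum>k\<in>F n. (N k x)\<^sup>2 / (2 * \<nu>))"
        proof (rule sum_mono)
          fix k
          show "2 * m k * g k x * (- \<nu> * m k * g k x + N k x) \<le> (N k x)\<^sup>2 / (2 * \<nu>)"
            using complete_square[of "m k * g k x" "N k x"] by (simp add: power2_eq_square algebra_simps)
        qed
        also have "\<dots> = (\<Sum>k\<in>F n. (N k x)\<^sup>2) / (2 * \<nu>)" by (simp add: sum_divide_distrib)
        also have "\<dots> \<le> (C * e x * a x) / (2 * \<nu>)"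
          using elim x0 \<nu> by (intro divide_right_mono) auto
        also have "\<dots> \<le> (C * E * a x) / (2 * \<nu>)"
        proof -
          have "0 \<le> a x" using elim x0 An_nonneg[of 0 x] by (meson order_trans)
          then show ?thesis using E(2)[OF x] C \<nu> by (intro divide_right_mono mult_right_mono mult_left_mono) auto
        qed
        finally show "(\<Sum>k\<in>F n. 2 * m k * g k x * (- \<nu> * m k * g k x + N k x)) \<le> h x" by (simp add: h_def)
      qed
    qed
  qed (use s0 in auto)
  then have growth: "An n t - An n s \<le> set_lebesgue_integral lebesgue {s..t} h" for n .
  have "An n t \<le> a s + set_lebesgue_integral lebesgue {s..t} h" for n
  proof -
    have "An n s \<le> a s" using s(2) s0(1) by blast
    then show ?thesis using growth[of n] by linarith
  qed
  then show ?thesis by blast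
qed

text \<open>At finite level the identity contains the energy flux between retained and discarded
  modes. By \<open>N_orth\<close> it tends to zero almost everywhere, and dominated convergence
  removes it.\<close>

lemma energy_equality:
  assumes s: "0 < s" "s \<le> t"
  shows "e t - e s = - 2 * \<nu> * set_lebesgue_integral lebesgue {s..t} a"
proof -
  define d where "d n x = - 2 * \<nu> * An n x + 2 * (\<Sum>k\<in>F n. N k x * g k x)" for n x
  have cd: "continuous_on {s..t} (d n)" for n
    unfolding d_def using s
    by (intro continuous_intros continuous_on_subset[OF cont_g] continuous_on_subset[OF contN]
        continuous_on_subset[OF cont_An]) auto
  have dd: "(En n has_real_derivative d n x) (at x)" if "x \<in> {s..t}" for n x
    unfolding d_def using that s by (intro En_deriv) auto
  have FTC: "set_integrable lebesgue {s..t} (d n)"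
      "set_lebesgue_integral lebesgue {s..t} (d n) = En n t - En n s" for n
    using lebesgue_FTC[OF s(2) dd cd] by blast+
  obtain E where E: "0 \<le> E" "\<And>x. x \<in> {s..t} \<Longrightarrow> e x \<le> E" using e_bounded[OF s] by blast
  have "(\<lambda>n. set_lebesgue_integral lebesgue {s..t} (d n)) \<longlonglongrightarrow>
      set_lebesgue_integral lebesgue {s..t} (\<lambda>x. - 2 * \<nu> * a x)"
    unfolding set_lebesgue_integral_def
  proof (rule integral_dominated_convergence)
    show "(\<lambda>x. indicat_real {s..t} x *\<^sub>R (- 2 * \<nu> * a x)) \<in> borel_measurable lebesgue"
      using set_integrable_mult_right[OF a_int[OF s], of "- 2 * \<nu>"] by (simp add: set_integrable_def)
    show "(\<lambda>x. indicat_real {s..t} x *\<^sub>R d n x) \<in> borel_measurable lebesgue" for n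
      using FTC(1)[of n] by (simp add: set_integrable_def)
    \<comment> \<open>The dominating function: 2 \<nu> \<open>a\<close> bounds the dissipation, and
      2 |x y| <= x^2 + y^2 splits the flux into C E \<open>a\<close>, from \<open>N_bound\<close>,
      and E, from \<open>En_le\<close>.\<close>
    have "set_integrable lebesgue {s..t} (\<lambda>x. (2 * \<nu> + C * E) * a x + E)"
      using a_int[OF s]
      by (intro set_integral_add(1) set_integrable_mult_right absolutely_integrable_on_const) auto
    then show "integrable lebesgue (\<lambda>x. indicat_real {s..t} x *\<^sub>R ((2 * \<nu> + C * E) * a x + E))"
      by (simp add: set_integrable_def)
    show "AE x in lebesgue. (\<lambda>n. indicat_real {s..t} x *\<^sub>R d n x) \<longlonglongrightarrow> indicat_real {s..t} x *\<^sub>R (- 2 * \<nu> * a x)"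
      using a_lim N_orth
    proof eventually_elim
      case (elim x)
      show ?case
      proof (cases "x \<in> {s..t}")
        case True
        then have "0 < x" using s by auto
        then have "(\<lambda>n. d n x) \<longlonglongrightarrow> - 2 * \<nu> * a x + 2 * 0"
          unfolding d_def An_def using elim by (intro tendsto_intros) auto
        then show ?thesis using True by simp
      qed auto
    qed
    show "AE x in lebesgue. norm (indicat_real {s..t} x *\<^sub>R d n x) \<le>
        indicat_real {s..t} x *\<^sub>R ((2 * \<nu> + C * E) * a x + E)" for n
      using a_ge N_bound
    proof eventually_elim
      case (elim x)
      show ?case
      proof (cases "x \<in> {s..t}")
        case True
        then have x0: "0 < x" using s by auto
        then have A: "An n x \<le> a x" "0 \<le> a x" using elim An_nonneg[of n x] by (auto intro: order_trans)
        have "2 * \<bar>\<Sum>k\<in>F n. N k x * g k x\<bar> \<le> (\<Sum>k\<in>F n. (N k x)\<^sup>2) + En n x"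
        proof -
          have "2 * \<bar>\<Sum>k\<in>F n. N k x * g k x\<bar> \<le> 2 * (\<Sum>k\<in>F n. \<bar>N k x * g k x\<bar>)"
            by (intro mult_left_mono sum_abs) auto
          also have "\<dots> = (\<Sum>k\<in>F n. 2 * \<bar>N k x\<bar> * \<bar>g k x\<bar>)" by (simp add: sum_distrib_left abs_mult mult.assoc)
          also have "\<dots> \<le> (\<Sum>k\<in>F n. (N k x)\<^sup>2 + (g k x)\<^sup>2)"
            using sum_squares_bound[of "\<bar>N _ x\<bar>" "\<bar>g _ x\<bar>"] by (intro sum_mono) simp
          finally show ?thesis by (simp add: sum.distrib En_def)
        qed
        also have "\<dots> \<le> C * E * a x + E"
        proof (intro add_mono)
          have "(\<Sum>k\<in>F n. (N k x)\<^sup>2) \<le> C * e x * a x" using elim x0 by auto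
          also have "\<dots> \<le> C * E * a x" using C E(2)[OF True] A by (intro mult_right_mono mult_left_mono) auto
          finally show "(\<Sum>k\<in>F n. (N k x)\<^sup>2) \<le> C * E * a x" .
          show "En n x \<le> E" using En_le[OF x0, of n] E(2)[OF True] by linarith
        qed
        finally have "2 * \<bar>\<Sum>k\<in>F n. N k x * g k x\<bar> \<le> C * E * a x + E" .
        moreover have "\<bar>- 2 * \<nu> * An n x\<bar> \<le> 2 * \<nu> * a x"
          using A An_nonneg[of n x] \<nu> by (simp add: abs_mult)
        ultimately have "\<bar>d n x\<bar> \<le> 2 * \<nu> * a x + (C * E * a x + E)"
          unfolding d_def by linarith
        then show ?thesis using True by (simp add: algebra_simps)
      qed auto
    qed
  qed
  moreover have "(\<lambda>n. set_lebesgue_integral lebesgue {s..t} (d n)) \<longlonglongrightarrow> e t - e s"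
    unfolding FTC(2) En_def using s by (intro tendsto_diff e_lim) auto
  ultimately have "e t - e s = set_lebesgue_integral lebesgue {s..t} (\<lambda>x. - 2 * \<nu> * a x)"
    by (rule LIMSEQ_unique[symmetric])
  then show ?thesis by (simp only: set_integral_mult_right)
qed

lemma integral_a_nonneg:
  assumes s: "0 < s" "s \<le> t" shows "0 \<le> set_lebesgue_integral lebesgue {s..t} a"
  unfolding set_lebesgue_integral_def
proof (rule integral_nonneg_AE)
  show "AE x in lebesgue. 0 \<le> indicat_real {s..t} x *\<^sub>R a x"
    using a_ge
  proof eventually_elim
    case (elim x)
    then show ?case using An_nonneg[of 0 x] s by (auto simp: indicator_def intro: order_trans)
  qed
qed

lemma e_antimono: assumes "0 < s" "s \<le> t" shows "e t \<le> e s"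
proof -
  have "0 \<le> 2 * \<nu> * set_lebesgue_integral lebesgue {s..t} a"
    using integral_a_nonneg[OF assms] \<nu> by simp
  then show ?thesis using energy_equality[OF assms] by linarith
qed

text \<open>For the truncated quotient \<open>An / En\<close> the equation gives exactly
  \<open>2 \<Sum> (m\<^sub>k - An/En) g\<^sub>k (- \<nu> m\<^sub>k g\<^sub>k + N\<^sub>k) / En\<close>, and the term with \<open>- \<nu> (An/En) g\<^sub>k\<close> sums to zero.\<close>
lemma quotient_bound:
  assumes s: "0 < s" "s \<le> t" and e: "0 < e t"
    and As: "(\<lambda>n. An n s) \<longlonglongrightarrow> as'" and At: "(\<lambda>n. An n t) \<longlonglongrightarrow> at'"
  shows "at' / e t \<le> as' / e s + C / (2 * \<nu>\<^sup>2) * (e s - e t)"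
proof -
  have epos: "0 < e x" if "x \<in> {s..t}" for x
    using e_antimono[of x t] that s e by auto
  \<comment> \<open>For small \<open>n\<close> the denominator \<open>En n\<close> may vanish; from
    \<open>n0\<close> on it is at least half of \<open>e\<close> on the whole interval.\<close>
  obtain n0 where n0: "\<And>n x. n \<ge> n0 \<Longrightarrow> x \<in> {s..t} \<Longrightarrow> e x / 2 \<le> En n x"
  proof (rule incseq_eventually_ge_half[of "{s..t}" En e])
    show "En i x \<le> En j x" if "i \<le> j" for i j x using inc_En that by (auto dest: monoD)
    show "(\<lambda>n. En n x) \<longlonglongrightarrow> e x" if "x \<in> {s..t}" for x
      unfolding En_def using that s by (intro e_lim) auto
    show "continuous_on {s..t} (En n)" for n
      using s by (intro continuous_on_subset[OF cont_En]) auto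
    show "continuous_on {s..t} e"
      using s by (intro continuous_on_subset[OF e_cont]) auto
  qed (use epos in auto)
  have main: "An n t / En n t - An n s / En n s \<le> set_lebesgue_integral lebesgue {s..t} (\<lambda>x. C / \<nu> * a x)"
    if n: "n \<ge> n0" for n
  proof -
    have Epos: "0 < En n x" if "x \<in> {s..t}" for x
      using n0[OF n that] epos[OF that] by linarith
    define A' where "A' x = (\<Sum>k\<in>F n. 2 * m k * g k x * (- \<nu> * m k * g k x + N k x))" for x
    define E' where "E' x = - 2 * \<nu> * An n x + 2 * (\<Sum>k\<in>F n. N k x * g k x)" for x
    define Q' where "Q' x = (A' x * En n x - An n x * E' x) / (En n x * En n x)" for x
    show ?thesis
    proof (rule diff_le_lebesgue_integral[OF s(2), of "\<lambda>x. An n x / En n x" Q'])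
      fix x assume x: "x \<in> {s..t}"
      then have "0 < x" using s by auto
      then show "((\<lambda>x. An n x / En n x) has_real_derivative Q' x) (at x)"
        using An_deriv[of x n] En_deriv[of x n] Epos[OF x] unfolding Q'_def A'_def E'_def
        by (intro DERIV_divide) auto
    next
      show "continuous_on {s..t} Q'"
        unfolding Q'_def A'_def E'_def using s Epos
        by (intro continuous_intros continuous_on_subset[OF cont_g] continuous_on_subset[OF contN]
            continuous_on_subset[OF cont_An] continuous_on_subset[OF cont_En])
          (auto simp: less_imp_neq[OF Epos, symmetric])
      show "set_integrable lebesgue {s..t} (\<lambda>x. C / \<nu> * a x)"
        using a_int[OF s] by (rule set_integrable_mult_right)
      show "AE x in lebesgue. x \<in> {s..t} \<longrightarrow> Q' x \<le> C / \<nu> * a x"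
        using N_bound a_ge
      proof eventually_elim
        case (elim x)
        show ?case
        proof
          assume x: "x \<in> {s..t}"
          then have x0: "0 < x" using s by auto
          have a0: "0 \<le> a x" using elim x0 An_nonneg[of 0 x] by (meson order_trans)
          define l where "l = An n x / En n x"
          have l: "An n x = l * En n x" using Epos[OF x] by (simp add: l_def)
          have "A' x - l * E' x = (\<Sum>k\<in>F n. - 2 * \<nu> * ((m k - l) * g k x)\<^sup>2 + 2 * ((m k - l) * g k x) * N k x)"
          proof -
            have "(\<Sum>k\<in>F n. - 2 * \<nu> * ((m k - l) * g k x)\<^sup>2 + 2 * ((m k - l) * g k x) * N k x)
                = (\<Sum>k\<in>F n. 2 * m k * g k x * (- \<nu> * m k * g k x + N k x)
                     - (l * (- 2 * \<nu> * (m k * (g k x)\<^sup>2)) + l * (2 * (N k x * g k x)))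
                     + (2 * \<nu> * l * (m k * (g k x)\<^sup>2) - 2 * \<nu> * l * l * (g k x)\<^sup>2))"
              by (intro sum.cong) (auto simp: power2_eq_square algebra_simps)
            also have "\<dots> = A' x - l * E' x + (2 * \<nu> * l * An n x - 2 * \<nu> * l * l * En n x)"
              unfolding A'_def E'_def An_def En_def
              by (simp only: sum.distrib sum_subtractf sum_distrib_left[symmetric] distrib_left mult.assoc)
            finally show ?thesis using l by simp
          qed
          also have "\<dots> \<le> (\<Sum>k\<in>F n. (N k x)\<^sup>2 / (2 * \<nu>))"
            by (intro sum_mono complete_square)
          also have "\<dots> = (\<Sum>k\<in>F n. (N k x)\<^sup>2) / (2 * \<nu>)" by (simp add: sum_divide_distrib)
          also have "\<dots> \<le> (C * e x * a x) / (2 * \<nu>)"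
            using elim x0 \<nu> by (intro divide_right_mono) auto
          \<comment> \<open>Replacing \<open>e\<close> by 2 \<open>En n\<close> lets the denominator
            cancel. The factor 2 lost here turns C / (2 \<nu>) into C / \<nu>, and the energy
            equality, which trades the integral of \<open>a\<close> for (e s - e t) / (2 \<nu>),
            produces C / (2 \<nu>^2).\<close>
          also have "\<dots> \<le> (C * (2 * En n x) * a x) / (2 * \<nu>)"
            using n0[OF n x] C \<nu> a0 by (intro divide_right_mono mult_right_mono mult_left_mono) auto
          finally have *: "A' x - l * E' x \<le> C / \<nu> * a x * En n x" by (simp add: mult_ac)
          have "Q' x = (A' x - l * E' x) / En n x"
            using Epos[OF x] unfolding Q'_def l by (simp add: field_simps)
          also have "\<dots> \<le> C / \<nu> * a x" using * Epos[OF x] by (simp add: divide_le_eq)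
          finally show "Q' x \<le> C / \<nu> * a x" .
        qed
      qed
    qed
  qed
  have "(\<lambda>n. An n t / En n t - An n s / En n s) \<longlonglongrightarrow> at' / e t - as' / e s"
    using At As e_lim[of t] e_lim[of s] epos[of s] epos[of t] s unfolding En_def[symmetric]
    by (intro tendsto_intros) auto
  then have "at' / e t - as' / e s \<le> set_lebesgue_integral lebesgue {s..t} (\<lambda>x. C / \<nu> * a x)"
    using main by (intro LIMSEQ_le_const2) auto
  also have "\<dots> = C / (2 * \<nu>\<^sup>2) * (e s - e t)"
  proof -
    have "e s - e t = 2 * \<nu> * set_lebesgue_integral lebesgue {s..t} a"
      using energy_equality[OF s] by simp
    then show ?thesis using \<nu> by (simp add: power2_eq_square)
  qed
  finally show ?thesis by linarith
qed

text \<open>On a step from \<open>x\<close> to \<open>y\<close> the Poincare inequality and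
  monotonicity give a >= m1 e >= m1 \<open>e y\<close>; inserted into the energy equality this is
  one implicit Euler step.\<close>

lemma energy_upper_bound:
  assumes s: "0 < s" "s \<le> t"
  shows "e t \<le> exp (- (2 * \<nu> * m1) * (t - s)) * e s"
proof -
  have step: "e y * (1 + 2 * \<nu> * m1 * (y - x)) \<le> e x" if xy: "0 < x" "x \<le> y" for x y
  proof -
    have "set_lebesgue_integral lebesgue {x..y} (\<lambda>_. m1 * e y) \<le> set_lebesgue_integral lebesgue {x..y} a"
      unfolding set_lebesgue_integral_def
    proof (rule integral_mono_AE)
      show "AE z in lebesgue. indicat_real {x..y} z *\<^sub>R (m1 * e y) \<le> indicat_real {x..y} z *\<^sub>R a z"
        using a_ge
      proof eventually_elim
        case (elim z)
        show ?case
        proof (cases "z \<in> {x..y}")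
          case True
          then have "m1 * e y \<le> m1 * e z" using m1 xy by (intro mult_left_mono e_antimono) auto
          then show ?thesis using elim True xy by auto
        qed auto
      qed
    qed (use a_int[OF xy] absolutely_integrable_on_const[of "{x..y}" "m1 * e y"] in \<open>auto simp only: set_integrable_def lmeasurable_interval\<close>)
    then have "m1 * e y * (y - x) \<le> set_lebesgue_integral lebesgue {x..y} a"
      using xy by (simp add: set_lebesgue_integral_def mult_ac)
    then have "2 * \<nu> * (m1 * e y * (y - x)) \<le> 2 * \<nu> * set_lebesgue_integral lebesgue {x..y} a"
      using \<nu> by (intro mult_left_mono) auto
    then show ?thesis using energy_equality[OF xy] by (simp add: algebra_simps)
  qed
  show ?thesis
    using s step \<nu> m1 by (intro exp_upper_bound_by_iteration) auto
qed

text \<open>The quotient is controlled only while the energy is positive, so the bound is first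
  proved for end times with positive energy (\<open>lower\<close>); continuity of \<open>e\<close>
  then excludes extinction.\<close>

lemma energy_lower_bound:
  assumes s: "0 < s" "s \<le> t" and e: "0 < e s" and As: "(\<lambda>n. An n s) \<longlonglongrightarrow> as'"
    and \<Lambda>_def: "\<Lambda> = as' / e s * exp (C / (2 * \<nu>\<^sup>2 * m1) * e s)"
  shows "exp (- (2 * \<nu> * \<Lambda>) * (t - s)) * e s \<le> e t"
proof -
  have as_ge: "m1 \<le> as' / e s"
  proof -
    have "(\<lambda>n. m1 * En n s) \<longlonglongrightarrow> m1 * e s"
      using e_lim[OF s(1)] by (intro tendsto_intros) (simp add: En_def)
    then have "m1 * e s \<le> as'" using As An_ge by (intro LIMSEQ_le) auto
    then show ?thesis using e by (simp add: le_divide_eq)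
  qed
  have L0: "0 \<le> \<Lambda>" unfolding \<Lambda>_def using as_ge m1 by (intro mult_nonneg_nonneg) auto
  have quot: "as' / e s + C / (2 * \<nu>\<^sup>2) * e s \<le> \<Lambda>"
  proof -
    have "m1 * (C / (2 * \<nu>\<^sup>2 * m1) * e s) = C / (2 * \<nu>\<^sup>2) * e s"
      using m1 by (cases "\<nu> = 0") simp_all
    then have "as' / e s + C / (2 * \<nu>\<^sup>2) * e s = as' / e s + m1 * (C / (2 * \<nu>\<^sup>2 * m1) * e s)"
      by (simp only:)
    also have "\<dots> \<le> as' / e s + as' / e s * (C / (2 * \<nu>\<^sup>2 * m1) * e s)"
      using as_ge C m1 e by (intro add_left_mono mult_right_mono) auto
    also have "\<dots> = as' / e s * (1 + C / (2 * \<nu>\<^sup>2 * m1) * e s)" by (simp add: algebra_simps)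
    also have "\<dots> \<le> \<Lambda>" unfolding \<Lambda>_def using as_ge m1
      by (intro mult_left_mono exp_ge_add_one_self) auto
    finally show ?thesis .
  qed
  have lower: "exp (- (2 * \<nu> * \<Lambda>) * (y - s)) * e s \<le> e y" if y: "s \<le> y" "0 < e y" for y
  proof (rule exp_lower_bound_by_iteration)
    fix x z assume xz: "s \<le> x" "x \<le> z" "z \<le> y"
    have x0: "0 < x" using xz s by auto
    have "set_lebesgue_integral lebesgue {x..z} a \<le> set_lebesgue_integral lebesgue {x..z} (\<lambda>_. \<Lambda> * e x)"
      unfolding set_lebesgue_integral_def
    proof (rule integral_mono_AE)
      show "AE r in lebesgue. indicat_real {x..z} r *\<^sub>R a r \<le> indicat_real {x..z} r *\<^sub>R (\<Lambda> * e x)"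
        using a_lim
      proof eventually_elim
        case (elim r)
        show ?case
        proof (cases "r \<in> {x..z}")
          case True
          then have r: "s \<le> r" "0 < r" "x \<le> r" "r \<le> y" using xz x0 by auto
          then have er: "0 < e r" using e_antimono[of r y] y by auto
          have "a r / e r \<le> as' / e s + C / (2 * \<nu>\<^sup>2) * (e s - e r)"
            using elim r er As s by (intro quotient_bound) (auto simp: An_def)
          also have "\<dots> \<le> as' / e s + C / (2 * \<nu>\<^sup>2) * e s"
            using C er by (intro add_left_mono mult_left_mono) auto
          also have "\<dots> \<le> \<Lambda>" by (rule quot)
          finally have "a r \<le> \<Lambda> * e r" using er by (simp add: divide_le_eq)
          also have "\<dots> \<le> \<Lambda> * e x" using L0 r x0 by (intro mult_left_mono e_antimono) auto
          finally show ?thesis using True by simp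
        qed auto
      qed
    qed (use a_int[OF x0 xz(2)] absolutely_integrable_on_const[of "{x..z}" "\<Lambda> * e x"] in \<open>auto simp only: set_integrable_def lmeasurable_interval\<close>)
    then have "set_lebesgue_integral lebesgue {x..z} a \<le> \<Lambda> * e x * (z - x)"
      using xz by (simp add: set_lebesgue_integral_def mult_ac)
    then have "2 * \<nu> * set_lebesgue_integral lebesgue {x..z} a \<le> 2 * \<nu> * (\<Lambda> * e x * (z - x))"
      using \<nu> by (intro mult_left_mono) auto
    then show "e x * (1 - 2 * \<nu> * \<Lambda> * (z - x)) \<le> e z"
      using energy_equality[OF x0 xz(2)] by (simp add: algebra_simps)
  qed (use y L0 \<nu> s in \<open>auto intro: e_nonneg\<close>)
  show "exp (- (2 * \<nu> * \<Lambda>) * (t - s)) * e s \<le> e t"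
  proof (cases "e t = 0")
    case False
    then show ?thesis using lower[of t] e_nonneg[of t] s by auto
  next
    case True
    \<comment> \<open>Suppose the energy vanished at \<open>t\<close>. It would first pass through
      half of the claimed lower bound, at a time where it is positive; \<open>lower\<close> applies
      at that time and gives at least \<open>\<delta>\<close>, a contradiction.\<close>
    define \<delta> where "\<delta> = exp (- (2 * \<nu> * \<Lambda>) * (t - s)) * e s"
    have \<delta>: "0 < \<delta>" "\<delta> \<le> e s"
      using e s L0 \<nu> mult_right_mono[of "exp (- (2 * \<nu> * \<Lambda>) * (t - s))" 1 "e s"] by (auto simp: \<delta>_def)
    have "\<exists>x\<ge>s. x \<le> t \<and> e x = \<delta> / 2"
      using \<delta> True s by (intro IVT2' continuous_on_subset[OF e_cont]) auto
    then obtain x where x: "s \<le> x" "x \<le> t" "e x = \<delta> / 2" by blast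
    have "\<delta> \<le> exp (- (2 * \<nu> * \<Lambda>) * (x - s)) * e s"
    proof -
      have "(2 * \<nu> * \<Lambda>) * (x - s) \<le> (2 * \<nu> * \<Lambda>) * (t - s)"
        using x \<nu> L0 by (intro mult_left_mono) auto
      then show ?thesis unfolding \<delta>_def using e by (intro mult_right_mono) auto
    qed
    also have "\<dots> \<le> e x" using x \<delta> by (intro lower) auto
    finally have False using x(3) \<delta>(1) by linarith
    then show ?thesis ..
  qed
qed

end

section \<open>A discrete Agmon inequality\<close>

definition ksq :: "int^2 \<Rightarrow> real" where
  "ksq k = (of_int (k $ 1))\<^sup>2 + (of_int (k $ 2))\<^sup>2"

lemma ksq_nonneg: "0 \<le> ksq k"
  by (simp add: ksq_def)

lemma ksq_ge_1: assumes "k \<noteq> 0" shows "1 \<le> ksq k"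
proof -
  have "k $ 1 \<noteq> 0 \<or> k $ 2 \<noteq> 0"
    using assms by (auto simp: vec_eq_iff forall_2)
  moreover have "1 \<le> (real_of_int j)\<^sup>2" if "j \<noteq> 0" for j
  proof -
    have "1 \<le> \<bar>real_of_int j\<bar>" using that by linarith
    then show ?thesis using power_mono[of 1 "\<bar>real_of_int j\<bar>" 2] by simp
  qed
  ultimately show ?thesis
    unfolding ksq_def by (smt (verit) zero_le_power2)
qed

text \<open>The two terms of index n + 1 are compared with the telescoping 4 / ((R + n) (R + n +
  1)), through (R + n + 1)^2 <= 2 (R^2 + (n + 1)^2). The subtracted 4 / (R + n) makes the induction
  close; at n = 0 what remains is 1 / R, which bounds the middle term because R >= 1.\<close>

lemma sum_inverse_quadratic_le:
  fixes R :: real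
  assumes "1 \<le> R"
  shows "(\<Sum>m\<in>{- int n..int n}. 1 / (R\<^sup>2 + (of_int m)\<^sup>2)) \<le> 5 / R - 4 / (R + n)"
proof (induction n)
  case 0
  have "1 / R\<^sup>2 \<le> 1 / R"
    using assms by (simp add: power2_eq_square frac_le)
  then show ?case using assms by (simp add: field_simps)
next
  case (Suc n)
  have set: "{- int (Suc n)..int (Suc n)} = insert (- int (Suc n)) (insert (int (Suc n)) {- int n..int n})"
    by auto
  have pos: "0 < R + n" using assms by simp
  have "(R + n) * (R + n + 1) \<le> (R + n + 1)\<^sup>2"
    using pos by (simp add: power2_eq_square)
  also have "\<dots> \<le> 2 * (R\<^sup>2 + (real n + 1)\<^sup>2)"
    using zero_le_power2[of "R - (real n + 1)"] by (simp add: power2_eq_square algebra_simps)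
  finally have le: "(R + n) * (R + n + 1) \<le> 2 * (R\<^sup>2 + (real n + 1)\<^sup>2)" .
  have "2 / (R\<^sup>2 + (real n + 1)\<^sup>2) = 4 / (2 * (R\<^sup>2 + (real n + 1)\<^sup>2))"
    using mult_divide_mult_cancel_left[of 2 2 "R\<^sup>2 + (real n + 1)\<^sup>2"] by simp
  also have "\<dots> \<le> 4 / ((R + n) * (R + n + 1))"
  proof (intro divide_left_mono le)
    have "0 < (R + n) * (R + n + 1)" using pos by simp
    then show "0 < 2 * (R\<^sup>2 + (real n + 1)\<^sup>2) * ((R + n) * (R + n + 1))"
      using less_le_trans[OF _ le] by (simp only: mult_pos_pos)
  qed simp
  also have "\<dots> = 4 / (R + n) - 4 / (R + n + 1)"
    using pos by (simp add: field_simps)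
  finally have "2 / (R\<^sup>2 + (real n + 1)\<^sup>2) \<le> 4 / (R + n) - 4 / (R + n + 1)" .
  moreover have "(\<Sum>m\<in>{- int (Suc n)..int (Suc n)}. 1 / (R\<^sup>2 + (of_int m)\<^sup>2))
      = 2 / (R\<^sup>2 + (real n + 1)\<^sup>2) + (\<Sum>m\<in>{- int n..int n}. 1 / (R\<^sup>2 + (of_int m)\<^sup>2))"
  proof -
    have "(- 1 - real n)\<^sup>2 = (real n + 1)\<^sup>2" by (simp add: power2_eq_square algebra_simps)
    then show ?thesis unfolding set by (simp add: add.commute)
  qed
  ultimately show ?case using Suc by (simp add: add.commute add.left_commute)
qed

text \<open>Separates the variables: a radial weight of fourth order dominates a product of two
  one-dimensional weights, so a lattice sum is bounded by the square of a one-dimensional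
  sum.\<close>

lemma biquadratic_ge_product:
  fixes p q x y :: real
  assumes "0 \<le> p" "0 \<le> q"
  shows "(p + q * x\<^sup>2) * (p + q * y\<^sup>2) \<le> 3 / 2 * (p\<^sup>2 + q\<^sup>2 * (x\<^sup>2 + y\<^sup>2)\<^sup>2)"
proof -
  define s where "s = x\<^sup>2 + y\<^sup>2"
  have "(p + q * x\<^sup>2) * (p + q * y\<^sup>2) = p\<^sup>2 + p * (q * s) + q\<^sup>2 * (x\<^sup>2 * y\<^sup>2)"
    by (simp add: s_def power2_eq_square algebra_simps)
  moreover have "p * (q * s) \<le> (p\<^sup>2 + (q * s)\<^sup>2) / 2"
    using zero_le_power2[of "p - q * s"] by (simp add: power2_eq_square algebra_simps)
  moreover have "x\<^sup>2 * y\<^sup>2 \<le> s\<^sup>2 / 2"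
    by (simp add: s_def power2_sum)
  then have "q\<^sup>2 * (x\<^sup>2 * y\<^sup>2) \<le> q\<^sup>2 * (s\<^sup>2 / 2)" by (intro mult_left_mono) auto
  ultimately have "(p + q * x\<^sup>2) * (p + q * y\<^sup>2) \<le> p\<^sup>2 + (p\<^sup>2 + (q * s)\<^sup>2) / 2 + q\<^sup>2 * (s\<^sup>2 / 2)"
    by (simp only: add_mono order_refl)
  also have "\<dots> \<le> 3 / 2 * (p\<^sup>2 + q\<^sup>2 * s\<^sup>2)"
    by (simp add: power_mult_distrib field_simps)
  finally show ?thesis unfolding s_def .
qed

text \<open>The constant is 3 / 2 from separating the variables times the square of 5 / (R q), where
  R^2 = p / q; the condition \<open>q \<le> p\<close> is what makes R >= 1.\<close>

lemma sum_lattice_weight_le: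
  fixes p q :: real
  assumes q: "0 < q" and pq: "q \<le> p" and fin: "finite F"
  shows "(\<Sum>k\<in>F. 1 / (p\<^sup>2 + q\<^sup>2 * (ksq k)\<^sup>2)) \<le> 75 / (2 * (p * q))"
proof -
  define R where "R = sqrt (p / q)"
  have R: "1 \<le> R" "R\<^sup>2 = p / q" using assms by (auto simp: R_def)
  have p: "0 < p" using q pq by linarith
  define w where "w m = 1 / (p + q * (real_of_int m)\<^sup>2)" for m
  have w0: "0 \<le> w m" for m using p q by (simp add: w_def)
  define B where "B = (\<Union>k\<in>F. {\<bar>k $ 1\<bar>, \<bar>k $ 2\<bar>})"
  have finB: "finite B" using fin by (auto simp: B_def)
  define n where "n = nat (Max (insert 0 B))"
  have nB: "\<bar>k $ 1\<bar> \<le> int n" "\<bar>k $ 2\<bar> \<le> int n" if "k \<in> F" for k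
    using that finB by (auto simp: n_def B_def intro!: Max_ge)
  have W: "(\<Sum>m\<in>{- int n..int n}. w m) \<le> 5 / (R * q)"
  proof -
    have "w m = (1 / q) * (1 / (R\<^sup>2 + (of_int m)\<^sup>2))" for m
      using q p by (simp add: w_def R field_simps)
    then have "(\<Sum>m\<in>{- int n..int n}. w m) = (1 / q) * (\<Sum>m\<in>{- int n..int n}. 1 / (R\<^sup>2 + (of_int m)\<^sup>2))"
      by (simp add: sum_distrib_left)
    also have "\<dots> \<le> (1 / q) * (5 / R)"
    proof (intro mult_left_mono)
      have "0 \<le> 4 / (R + n)" using R by simp
      then show "(\<Sum>m\<in>{- int n..int n}. 1 / (R\<^sup>2 + (of_int m)\<^sup>2)) \<le> 5 / R"
        using sum_inverse_quadratic_le[OF R(1), of n] by linarith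
    qed (use q in auto)
    finally show ?thesis by (simp add: mult.commute)
  qed
  have "(\<Sum>k\<in>F. 1 / (p\<^sup>2 + q\<^sup>2 * (ksq k)\<^sup>2)) \<le> (\<Sum>k\<in>F. 3 / 2 * (w (k $ 1) * w (k $ 2)))"
  proof (rule sum_mono)
    fix k assume "k \<in> F"
    let ?D = "p\<^sup>2 + q\<^sup>2 * (ksq k)\<^sup>2" and ?P = "(p + q * (real_of_int (k $ 1))\<^sup>2) * (p + q * (real_of_int (k $ 2))\<^sup>2)"
    have D: "0 < ?D" using p by (simp add: add_pos_nonneg)
    have P: "0 < ?P" using p q by (simp add: add_pos_nonneg)
    have "?P \<le> 3 / 2 * ?D"
      unfolding ksq_def using p q by (intro biquadratic_ge_product) auto
    then have "1 / ?D \<le> 3 / 2 * (1 / ?P)"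
      using D P by (simp add: field_simps)
    then show "1 / ?D \<le> 3 / 2 * (w (k $ 1) * w (k $ 2))"
      by (simp add: w_def)
  qed
  also have "\<dots> = 3 / 2 * (\<Sum>k\<in>F. w (k $ 1) * w (k $ 2))"
    by (simp add: sum_distrib_left)
  also have "(\<Sum>k\<in>F. w (k $ 1) * w (k $ 2)) = (\<Sum>(i, j)\<in>(\<lambda>k. (k $ 1, k $ 2)) ` F. w i * w j)"
    by (subst sum.reindex) (auto simp: inj_on_def vec_eq_iff forall_2)
  also have "\<dots> \<le> (\<Sum>(i, j)\<in>{- int n..int n} \<times> {- int n..int n}. w i * w j)"
    using nB by (intro sum_mono2) (auto intro!: mult_nonneg_nonneg w0 simp: abs_le_iff minus_le_iff)
  also have "\<dots> = (\<Sum>m\<in>{- int n..int n}. w m)\<^sup>2"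
    by (simp add: power2_eq_square sum_product sum.cartesian_product)
  also have "\<dots> \<le> (5 / (R * q))\<^sup>2"
    by (intro power_mono W sum_nonneg w0)
  also have "\<dots> = 25 / (p * q)"
    using q p by (simp add: power_divide power_mult_distrib R) (simp add: power2_eq_square)
  finally show ?thesis by simp
qed

text \<open>Cauchy--Schwarz with the weight \<open>A + E |k|\<^sup>4\<close>, where \<open>A\<close> and \<open>E\<close> are the two sums of
  squares on the right-hand side.\<close>
lemma discrete_agmon:
  fixes g :: "int^2 \<Rightarrow> real"
  assumes fin: "finite F" and F0: "0 \<notin> F"
  shows "(\<Sum>k\<in>F. \<bar>g k\<bar>)\<^sup>2 \<le> 75 * (sqrt (\<Sum>k\<in>F. (g k)\<^sup>2) * sqrt (\<Sum>k\<in>F. (ksq k)\<^sup>2 * (g k)\<^sup>2))"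
proof -
  define E where "E = (\<Sum>k\<in>F. (g k)\<^sup>2)"
  define A where "A = (\<Sum>k\<in>F. (ksq k)\<^sup>2 * (g k)\<^sup>2)"
  have E0: "0 \<le> E" by (simp add: E_def sum_nonneg)
  \<comment> \<open>The zero frequency being absent gives |k| >= 1. The comparison becomes
    \<open>q \<le> p\<close> below, as the lattice sum requires.\<close>
  have EA: "E \<le> A" unfolding E_def A_def
  proof (rule sum_mono)
    fix k assume "k \<in> F"
    then have "1 \<le> ksq k" using F0 by (intro ksq_ge_1) auto
    then have "1 \<le> (ksq k)\<^sup>2" by (simp add: one_le_power)
    then show "(g k)\<^sup>2 \<le> (ksq k)\<^sup>2 * (g k)\<^sup>2"
      using mult_right_mono[of 1 "(ksq k)\<^sup>2" "(g k)\<^sup>2"] by simp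
  qed
  show ?thesis
  proof (cases "E = 0")
    case True
    then have "\<forall>k\<in>F. g k = 0" using fin by (simp add: E_def sum_nonneg_eq_0_iff)
    then show ?thesis by simp
  next
    case False
    then have E: "0 < E" using E0 by simp
    define p where "p = sqrt A"
    define q where "q = sqrt E"
    have q: "0 < q" "q \<le> p" "p\<^sup>2 = A" "q\<^sup>2 = E" using E EA by (auto simp: p_def q_def)
    define W where "W k = A + E * (ksq k)\<^sup>2" for k
    have W: "0 < W k" for k using E EA by (simp add: W_def add_pos_nonneg)
    have "(\<Sum>k\<in>F. \<bar>g k\<bar>)\<^sup>2 = (\<Sum>k\<in>F. (1 / sqrt (W k)) * (sqrt (W k) * \<bar>g k\<bar>))\<^sup>2"
      using W by (simp add: less_imp_neq[OF W, symmetric])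
    also have "\<dots> \<le> (\<Sum>k\<in>F. (1 / sqrt (W k))\<^sup>2) * (\<Sum>k\<in>F. (sqrt (W k) * \<bar>g k\<bar>)\<^sup>2)"
      by (rule Cauchy_Schwarz_ineq_sum)
    also have "(\<Sum>k\<in>F. (1 / sqrt (W k))\<^sup>2) = (\<Sum>k\<in>F. 1 / (p\<^sup>2 + q\<^sup>2 * (ksq k)\<^sup>2))"
      using W by (simp add: power_divide less_imp_le q W_def[symmetric])
    also have "(\<Sum>k\<in>F. (sqrt (W k) * \<bar>g k\<bar>)\<^sup>2) = (\<Sum>k\<in>F. A * (g k)\<^sup>2 + E * ((ksq k)\<^sup>2 * (g k)\<^sup>2))"
      using W by (intro sum.cong refl) (simp add: power_mult_distrib less_imp_le, simp add: W_def algebra_simps)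
    \<comment> \<open>The weight is balanced: its two parts contribute A E each.\<close>
    also have "\<dots> = 2 * (A * E)"
      by (simp add: sum.distrib flip: sum_distrib_left) (simp add: A_def E_def)
    also have "(\<Sum>k\<in>F. 1 / (p\<^sup>2 + q\<^sup>2 * (ksq k)\<^sup>2)) * (2 * (A * E)) \<le> 75 / (2 * (p * q)) * (2 * (A * E))"
      using q fin E EA by (intro mult_right_mono sum_lattice_weight_le) auto
    also have "\<dots> = 75 * (q * p)"
      using q by (simp add: field_simps power2_eq_square flip: q(3,4))
    finally show ?thesis unfolding p_def q_def A_def E_def .
  qed
qed

section \<open>Square-integrable functions on the cell\<close>

lemma cell_sets: "cell L \<in> sets lebesgue"
  unfolding cell_def by simp

lemma finite_measure_cell: "finite_measure (lebesgue_on (cell L))"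
  unfolding cell_def by (intro finite_measure_lebesgue_on lmeasurable_cbox)

lemma integral_cell_eq:
  fixes f :: "real^2 \<Rightarrow> 'b::euclidean_space"
  shows "set_lebesgue_integral lebesgue (cell L) f = integral\<^sup>L (lebesgue_on (cell L)) f"
  unfolding set_lebesgue_integral_def
  by (rule integral_restrict_space[symmetric]) (simp add: cell_sets)

lemma integrable_cell_eq:
  fixes f :: "real^2 \<Rightarrow> 'b::euclidean_space"
  shows "set_integrable lebesgue (cell L) f \<longleftrightarrow> integrable (lebesgue_on (cell L)) f"
  unfolding set_integrable_def
  by (rule integrable_restrict_space[symmetric]) (simp add: cell_sets)

lemma l2inner_eq: "l2inner L u v = integral\<^sup>L (lebesgue_on (cell L)) (\<lambda>x. u x \<bullet> v x)"
  unfolding l2inner_def by (rule integral_cell_eq)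

text \<open>\<open>l2inner\<close> sees only the values on one cell. This is the condition under
  which it is bilinear, stated for fields, scalar functions and almost everywhere limits
  alike.\<close>

definition sq_int :: "real \<Rightarrow> (real^2 \<Rightarrow> 'b::euclidean_space) \<Rightarrow> bool" where
  "sq_int L u \<longleftrightarrow> u \<in> borel_measurable (lebesgue_on (cell L)) \<and>
     integrable (lebesgue_on (cell L)) (\<lambda>x. (norm (u x))\<^sup>2)"

lemma sq_int_measurable [measurable_dest]: "sq_int L u \<Longrightarrow> u \<in> borel_measurable (lebesgue_on (cell L))"
  by (simp add: sq_int_def)

lemma L2per_sq_int: "u \<in> L2per L \<Longrightarrow> sq_int L u"
  unfolding L2per_def sq_int_def integrable_cell_eq
  by (auto intro: measurable_restrict_space1)

lemma sq_int_inner: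
  assumes u: "sq_int L u" and v: "sq_int L v"
  shows "integrable (lebesgue_on (cell L)) (\<lambda>x. u x \<bullet> v x)"
proof (rule Bochner_Integration.integrable_bound)
  show "integrable (lebesgue_on (cell L)) (\<lambda>x. (norm (u x))\<^sup>2 + (norm (v x))\<^sup>2)"
    using u v by (simp add: sq_int_def)
  show "(\<lambda>x. u x \<bullet> v x) \<in> borel_measurable (lebesgue_on (cell L))"
    using u v by measurable
  show "AE x in lebesgue_on (cell L). norm (u x \<bullet> v x) \<le> norm ((norm (u x))\<^sup>2 + (norm (v x))\<^sup>2)"
  proof (intro AE_I2)
    fix x
    have "\<bar>u x \<bullet> v x\<bar> \<le> norm (u x) * norm (v x)" by (rule Cauchy_Schwarz_ineq2)
    also have "\<dots> \<le> (norm (u x))\<^sup>2 + (norm (v x))\<^sup>2"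
    proof -
      have "0 \<le> norm (u x) * norm (v x)" by simp
      then show ?thesis using sum_squares_bound[of "norm (u x)" "norm (v x)"] by linarith
    qed
    finally show "norm (u x \<bullet> v x) \<le> norm ((norm (u x))\<^sup>2 + (norm (v x))\<^sup>2)" by simp
  qed
qed

lemma sq_int_scaleR: "sq_int L u \<Longrightarrow> sq_int L (\<lambda>x. c *\<^sub>R u x)"
  by (auto simp: sq_int_def power_mult_distrib)

lemma sq_int_add:
  assumes u: "sq_int L u" and v: "sq_int L v" shows "sq_int L (\<lambda>x. u x + v x)"
  unfolding sq_int_def
proof
  show "(\<lambda>x. u x + v x) \<in> borel_measurable (lebesgue_on (cell L))" using u v by measurable
  have "(norm (u x + v x))\<^sup>2 = (norm (u x))\<^sup>2 + 2 * (u x \<bullet> v x) + (norm (v x))\<^sup>2" for x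
    by (simp add: power2_norm_eq_inner inner_add_left inner_add_right inner_commute)
  then show "integrable (lebesgue_on (cell L)) (\<lambda>x. (norm (u x + v x))\<^sup>2)"
    using u v sq_int_inner[OF u v] by (simp add: sq_int_def)
qed

lemma sq_int_diff: "sq_int L u \<Longrightarrow> sq_int L v \<Longrightarrow> sq_int L (\<lambda>x. u x - v x)"
  using sq_int_add[of L u "\<lambda>x. (-1) *\<^sub>R v x"] sq_int_scaleR[of L v "-1"] by simp

lemma sq_int_integrable:
  fixes u :: "real^2 \<Rightarrow> 'b::euclidean_space"
  assumes u: "sq_int L u" shows "integrable (lebesgue_on (cell L)) u"
proof -
  interpret finite_measure "lebesgue_on (cell L)" by (rule finite_measure_cell)
  show ?thesis
  proof (rule Bochner_Integration.integrable_bound)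
    show "integrable (lebesgue_on (cell L)) (\<lambda>x. 1 + (norm (u x))\<^sup>2)"
      using u by (simp add: sq_int_def)
    have "norm (u x) \<le> 1 + (norm (u x))\<^sup>2" for x
      using zero_le_power2[of "norm (u x) - 1/2"] by (simp add: power2_eq_square algebra_simps)
    then show "AE x in lebesgue_on (cell L). norm (u x) \<le> norm (1 + (norm (u x))\<^sup>2)"
      by (intro AE_I2) (simp add: abs_of_nonneg)
  qed (use u in \<open>simp add: sq_int_def\<close>)
qed

lemma l2inner_commute: "l2inner L u v = l2inner L v u"
  by (simp add: l2inner_def inner_commute)

lemma l2inner_add_left:
  "sq_int L u \<Longrightarrow> sq_int L v \<Longrightarrow> sq_int L w \<Longrightarrow> l2inner L (\<lambda>x. u x + v x) w = l2inner L u w + l2inner L v w"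
  unfolding l2inner_eq by (simp add: inner_add_left sq_int_inner)

lemma l2inner_diff_left:
  "sq_int L u \<Longrightarrow> sq_int L v \<Longrightarrow> sq_int L w \<Longrightarrow> l2inner L (\<lambda>x. u x - v x) w = l2inner L u w - l2inner L v w"
  unfolding l2inner_eq by (simp add: inner_diff_left sq_int_inner)

lemma l2inner_scaleR_left: "l2inner L (\<lambda>x. c *\<^sub>R u x) w = c * l2inner L u w"
  unfolding l2inner_eq by simp

lemma l2inner_sum_left:
  assumes "\<And>k. k \<in> F \<Longrightarrow> sq_int L (u k)" "sq_int L w"
  shows "l2inner L (\<lambda>x. \<Sum>k\<in>F. u k x) w = (\<Sum>k\<in>F. l2inner L (u k) w)"
  unfolding l2inner_eq using assms
  by (simp add: inner_sum_left Bochner_Integration.integral_sum sq_int_inner)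

lemma l2inner_add_right:
  "sq_int L u \<Longrightarrow> sq_int L v \<Longrightarrow> sq_int L w \<Longrightarrow> l2inner L w (\<lambda>x. u x + v x) = l2inner L w u + l2inner L w v"
  using l2inner_add_left by (simp only: l2inner_commute[of L w])

lemma l2inner_diff_right:
  "sq_int L u \<Longrightarrow> sq_int L v \<Longrightarrow> sq_int L w \<Longrightarrow> l2inner L w (\<lambda>x. u x - v x) = l2inner L w u - l2inner L w v"
  using l2inner_diff_left by (simp only: l2inner_commute[of L w])

lemma l2inner_scaleR_right: "l2inner L w (\<lambda>x. c *\<^sub>R u x) = c * l2inner L w u"
  by (metis l2inner_commute l2inner_scaleR_left)

lemma l2inner_sum_right:
  assumes "\<And>k. k \<in> F \<Longrightarrow> sq_int L (u k)" "sq_int L w"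
  shows "l2inner L w (\<lambda>x. \<Sum>k\<in>F. u k x) = (\<Sum>k\<in>F. l2inner L w (u k))"
  using l2inner_sum_left[OF assms] by (simp only: l2inner_commute[of L w])

lemma l2inner_self_nonneg: "0 \<le> l2inner L u u"
  unfolding l2inner_eq by (intro integral_nonneg_AE) auto

lemma l2norm_nonneg: "0 \<le> l2norm L u"
  by (simp add: l2norm_def l2inner_self_nonneg)

lemma l2norm_power2: "(l2norm L u)\<^sup>2 = l2inner L u u"
  by (simp add: l2norm_def l2inner_self_nonneg)

lemma l2norm_scaleR: "l2norm L (\<lambda>x. c *\<^sub>R u x) = \<bar>c\<bar> * l2norm L u"
  by (simp add: l2norm_def l2inner_scaleR_left l2inner_scaleR_right real_sqrt_mult flip: mult.assoc)

lemma l2norm_minus_commute: "l2norm L (\<lambda>x. u x - v x) = l2norm L (\<lambda>x. v x - u x)"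
  using l2norm_scaleR[of L "-1" "\<lambda>x. v x - u x"] by (simp add: l2norm_def)

text \<open>On functions the form is only positive semidefinite, so the argument is the classical
  one: the square of the norm of u + s v is a nonnegative quadratic polynomial in
  \<open>s\<close>.\<close>

lemma l2inner_Cauchy_Schwarz:
  assumes u: "sq_int L u" and v: "sq_int L v"
  shows "\<bar>l2inner L u v\<bar> \<le> l2norm L u * l2norm L v"
proof -
  let ?p = "l2inner L u u" and ?q = "l2inner L v v" and ?r = "l2inner L u v"
  have quad: "0 \<le> ?p + 2 * s * ?r + s\<^sup>2 * ?q" for s
  proof -
    have sv: "sq_int L (\<lambda>x. s *\<^sub>R v x)" by (rule sq_int_scaleR[OF v])
    have "0 \<le> l2inner L (\<lambda>x. u x + s *\<^sub>R v x) (\<lambda>x. u x + s *\<^sub>R v x)" by (rule l2inner_self_nonneg)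
    also have "\<dots> = ?p + 2 * s * ?r + s\<^sup>2 * ?q"
      using u v sv sq_int_add[OF u sv]
      by (simp add: l2inner_add_left l2inner_add_right l2inner_scaleR_left l2inner_scaleR_right
          l2inner_commute[of L v u] power2_eq_square algebra_simps)
    finally show ?thesis .
  qed
  have "?r\<^sup>2 \<le> ?p * ?q"
  proof (cases "?q = 0")
    case True
    have "?r = 0"
    proof (rule ccontr)
      assume r: "?r \<noteq> 0"
      \<comment> \<open>If \<open>v\<close> has norm zero the polynomial is affine in
        \<open>s\<close>; a nonzero slope would let it take the value - 1 at this
        \<open>s\<close>.\<close>
      have "0 \<le> ?p + 2 * (- (?p + 1) / (2 * ?r)) * ?r" using quad[of "- (?p + 1) / (2 * ?r)"] True by simp
      also have "\<dots> = - 1" using r by (simp add: field_simps)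
      finally show False by simp
    qed
    then show ?thesis using True by simp
  next
    case False
    then have q: "0 < ?q" using l2inner_self_nonneg[of L v] by simp
    have "0 \<le> ?p + 2 * (- ?r / ?q) * ?r + (- ?r / ?q)\<^sup>2 * ?q" by (rule quad)
    also have "\<dots> = ?p - ?r\<^sup>2 / ?q" using q by (simp add: power2_eq_square field_simps)
    finally show ?thesis using q by (simp add: field_simps)
  qed
  then have "sqrt (?r\<^sup>2) \<le> sqrt (?p * ?q)" by (rule real_sqrt_le_mono)
  then show ?thesis by (simp add: l2norm_def real_sqrt_mult)
qed

lemma l2norm_triangle:
  assumes u: "sq_int L u" and v: "sq_int L v"
  shows "l2norm L (\<lambda>x. u x + v x) \<le> l2norm L u + l2norm L v"
proof (rule power2_le_imp_le)
  have "(l2norm L (\<lambda>x. u x + v x))\<^sup>2 = l2inner L u u + 2 * l2inner L u v + l2inner L v v"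
    using u v sq_int_add[OF u v]
    by (simp add: l2norm_power2 l2inner_add_left l2inner_add_right l2inner_commute[of L v u])
  also have "\<dots> \<le> (l2norm L u)\<^sup>2 + 2 * (l2norm L u * l2norm L v) + (l2norm L v)\<^sup>2"
    using l2inner_Cauchy_Schwarz[OF u v] by (simp add: l2norm_power2)
  also have "\<dots> = (l2norm L u + l2norm L v)\<^sup>2" by (simp add: power2_sum)
  finally show "(l2norm L (\<lambda>x. u x + v x))\<^sup>2 \<le> (l2norm L u + l2norm L v)\<^sup>2" .
qed (simp add: l2norm_nonneg)

lemma l2norm_diff_abs_le:
  assumes u: "sq_int L u" and v: "sq_int L v"
  shows "\<bar>l2norm L u - l2norm L v\<bar> \<le> l2norm L (\<lambda>x. u x - v x)"
  using l2norm_triangle[OF sq_int_diff[OF u v] v] l2norm_triangle[OF sq_int_diff[OF v u] u]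
    l2norm_minus_commute[of L u v] by simp

section \<open>Trigonometric integrals\<close>

definition phase :: "real \<Rightarrow> int^2 \<Rightarrow> real^2 \<Rightarrow> real" where
  "phase L k x = 2 * pi / L * (\<Sum>i\<in>UNIV. of_int (k $ i) * x $ i)"

lemma phase_add: "phase L (j + k) x = phase L j x + phase L k x"
  by (simp add: phase_def distrib_left distrib_right sum.distrib)

lemma phase_minus: "phase L (- k) x = - phase L k x"
  by (simp add: phase_def sum_negf)

lemma phase_diff: "phase L (j - k) x = phase L j x - phase L k x"
  using phase_add[of L j "- k" x] by (simp add: phase_minus)

lemma phase_0: "phase L 0 x = 0"
  by (simp add: phase_def)

lemma integral_Icc_exp:
  fixes j :: int
  assumes L: "0 < L"
  defines "f \<equiv> \<lambda>y :: real. exp (\<i> * of_real (2 * pi / L * of_int j * y)) :: complex"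
  shows "integrable lborel (\<lambda>y. indicat_real {- L / 2..L / 2} y *\<^sub>R f y)"
    and "(LINT y|lborel. indicat_real {- L / 2..L / 2} y *\<^sub>R f y) = (if j = 0 then of_real L else 0)"
proof -
  have cf: "continuous_on {- L / 2..L / 2} f"
    unfolding f_def by (intro continuous_intros)
  show "integrable lborel (\<lambda>y. indicat_real {- L / 2..L / 2} y *\<^sub>R f y)"
    using borel_integrable_atLeastAtMost'[OF cf] by (simp add: set_integrable_def)
  show "(LINT y|lborel. indicat_real {- L / 2..L / 2} y *\<^sub>R f y) = (if j = 0 then of_real L else 0)"
  proof (cases "j = 0")
    case True
    then have "f = (\<lambda>y. 1)" by (simp add: f_def)
    then show ?thesis using True L by (simp add: scaleR_conv_of_real)
  next
    case False
    define c where "c = 2 * pi / L * of_int j"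
    have c: "c \<noteq> 0" using False L by (simp add: c_def)
    define G where "G y = exp (\<i> * of_real (c * y)) / (\<i> * of_real c)" for y :: real
    have "(LINT y|lborel. indicat_real {- L / 2..L / 2} y *\<^sub>R f y) = G (L / 2) - G (- L / 2)"
    proof (rule integral_FTC_Icc)
      fix y :: real
      have "(G has_vector_derivative exp (\<i> * of_real (c * y))) (at y)"
      proof -
        have 1: "((\<lambda>z. exp (\<i> * (of_real c * z)) / (\<i> * of_real c)) has_field_derivative
            exp (\<i> * (of_real c * of_real y))) (at (of_real y))"
          using c by (auto intro!: derivative_eq_intros simp: field_simps)
        have 2: "((\<lambda>y. (\<lambda>z. exp (\<i> * (of_real c * z)) / (\<i> * of_real c)) (complex_of_real y)) has_vector_derivative
            exp (\<i> * (of_real c * of_real y))) (at y)"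
          by (rule has_vector_derivative_real_field[OF 1])
        then show ?thesis unfolding G_def[abs_def] by simp
      qed
      then show "(G has_vector_derivative f y) (at y within {- L / 2..L / 2})"
        unfolding f_def c_def by (rule has_vector_derivative_at_within)
    qed (use L cf in auto)
    also have "G (L / 2) = G (- L / 2)"
    proof -
      have "c * (L / 2) = pi * of_int j" "c * (- L / 2) = - (pi * of_int j)"
        using L by (simp_all add: c_def)
      moreover have "exp (\<i> * of_real (pi * of_int j)) = exp (\<i> * of_real (- (pi * of_int j)))"
      proof -
        have "sin (pi * real_of_int j) = 0" by (simp add: sin_zero_iff_int2)
        then show ?thesis by (simp only: cis_conv_exp[symmetric]) (simp add: complex_eq_iff)
      qed
      ultimately show ?thesis by (simp add: G_def)
    qed
    finally show ?thesis using False by simp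
  qed
qed

text \<open>The exponential and the indicator of the cell both factorise over the coordinates.
  Writing \<open>lborel\<close> as the image of a product measure over \<open>Basis\<close> turns
  the integral into a product of one-dimensional ones, and one nonzero frequency component makes a
  factor vanish.\<close>

lemma integral_cell_exp:
  assumes L: "0 < L"
  shows "integral\<^sup>L (lebesgue_on (cell L)) (\<lambda>x. exp (\<i> * of_real (phase L k x))) =
    (if k = 0 then of_real (L\<^sup>2) else 0 :: complex)"
proof -
  define \<kappa> :: "real^2" where "\<kappa> = (\<chi> i. of_int (k $ i))"
  define G where "G b y = indicat_real {- L / 2..L / 2} y *\<^sub>R exp (\<i> * of_real (2 * pi / L * (\<kappa> \<bullet> b) * y))" for b y
  have Basis: "\<exists>i. b = axis i 1 \<and> \<kappa> \<bullet> b = of_int (k $ i)" if "b \<in> Basis" for b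
    using that by (auto simp: Basis_vec_def \<kappa>_def inner_axis)
  have Gi: "integrable lborel (G b)" "(LINT y|lborel. G b y) = (if \<kappa> \<bullet> b = 0 then of_real L else 0)"
    if "b \<in> Basis" for b
  proof -
    from Basis[OF that] obtain i where i: "\<kappa> \<bullet> b = of_int (k $ i)" by blast
    show "integrable lborel (G b)" "(LINT y|lborel. G b y) = (if \<kappa> \<bullet> b = 0 then of_real L else 0)"
      using integral_Icc_exp[OF L, of "k $ i"] unfolding G_def i by auto
  qed
  have "integral\<^sup>L (lebesgue_on (cell L)) (\<lambda>x. exp (\<i> * of_real (phase L k x))) =
      (LINT x|lebesgue. indicat_real (cell L) x *\<^sub>R exp (\<i> * of_real (phase L k x)))"
    by (subst integral_restrict_space) (auto simp: cell_def)
  also have "\<dots> = (LINT x|lborel. indicat_real (cell L) x *\<^sub>R exp (\<i> * of_real (phase L k x)))"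
    by (rule integral_completion) (auto simp: cell_def phase_def intro!: borel_measurable_continuous_onI continuous_intros)
  also have "\<dots> = (LINT x|lborel. (\<Prod>b\<in>Basis. G b (x \<bullet> b)))"
  proof (rule Bochner_Integration.integral_cong[OF refl])
    fix x :: "real^2"
    have cell: "x \<in> cell L \<longleftrightarrow> (\<forall>b\<in>Basis. x \<bullet> b \<in> {- L / 2..L / 2})"
      by (auto simp: cell_def mem_box Basis_vec_def inner_axis)
    have ph: "phase L k x = (\<Sum>b\<in>Basis. 2 * pi / L * (\<kappa> \<bullet> b) * (x \<bullet> b))"
    proof -
      have "phase L k x = 2 * pi / L * (\<kappa> \<bullet> x)" by (simp add: phase_def \<kappa>_def inner_vec_def)
      also have "\<kappa> \<bullet> x = (\<Sum>b\<in>Basis. (\<kappa> \<bullet> b) * (x \<bullet> b))" by (rule euclidean_inner)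
      finally show ?thesis by (simp add: sum_distrib_left mult.assoc)
    qed
    have "exp (\<i> * of_real (phase L k x)) = (\<Prod>b\<in>Basis. exp (\<i> * of_real (2 * pi / L * (\<kappa> \<bullet> b) * (x \<bullet> b))))"
      unfolding ph of_real_sum sum_distrib_left by (rule exp_sum) simp
    then show "indicat_real (cell L) x *\<^sub>R exp (\<i> * of_real (phase L k x)) = (\<Prod>b\<in>Basis. G b (x \<bullet> b))"
    proof (cases "x \<in> cell L")
      case True
      then have "G b (x \<bullet> b) = exp (\<i> * of_real (2 * pi / L * (\<kappa> \<bullet> b) * (x \<bullet> b)))" if "b \<in> Basis" for b
        using cell that by (simp add: G_def)
      then show ?thesis
        using True \<open>exp (\<i> * of_real (phase L k x)) = _\<close> by simp
    next
      case False
      then obtain b where "b \<in> Basis" "G b (x \<bullet> b) = 0"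
        using cell by (auto simp: G_def indicator_def)
      then have "(\<Prod>b\<in>Basis. G b (x \<bullet> b)) = 0" by (intro prod_zero) auto
      then show ?thesis using False by simp
    qed
  qed
  also have "\<dots> = (LINT f|(\<Pi>\<^sub>M b\<in>Basis. lborel). (\<Prod>b\<in>Basis. G b ((\<Sum>b\<in>Basis. f b *\<^sub>R b) \<bullet> b)))"
    unfolding lborel_eq[where ?'a="real^2"]
  proof (rule integral_distr)
    show "(\<lambda>f. \<Sum>b\<in>Basis. f b *\<^sub>R b) \<in> (\<Pi>\<^sub>M b\<in>Basis. lborel) \<rightarrow>\<^sub>M borel" by measurable
    show "(\<lambda>x. \<Prod>b\<in>Basis. G b (x \<bullet> b)) \<in> borel_measurable borel"
      unfolding G_def by measurable
  qed
  also have "\<dots> = (LINT f|(\<Pi>\<^sub>M b\<in>Basis. lborel). (\<Prod>b\<in>Basis. G b (f b)))"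
    by (intro Bochner_Integration.integral_cong prod.cong refl) (simp add: inner_sum_left inner_Basis if_distrib cong: if_cong)
  also have "\<dots> = (\<Prod>b\<in>(Basis :: (real^2) set). LINT y|lborel. G b y)"
  proof -
    interpret product_sigma_finite "\<lambda>b :: real^2. lborel :: real measure" by standard
    show ?thesis using Gi(1) by (intro product_integral_prod) auto
  qed
  also have "\<dots> = (\<Prod>b\<in>(Basis :: (real^2) set). if \<kappa> \<bullet> b = 0 then of_real L else 0)"
    using Gi(2) by (intro prod.cong) auto
  also have "\<dots> = (if k = 0 then of_real (L\<^sup>2) else 0)"
  proof (cases "k = 0")
    case True
    then have "\<kappa> = 0" by (simp add: \<kappa>_def vec_eq_iff)
    then show ?thesis using True by simp
  next
    case False
    then obtain i where "k $ i \<noteq> 0" by (auto simp: vec_eq_iff)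
    then have "axis i 1 \<in> (Basis :: (real^2) set)" "\<kappa> \<bullet> axis i 1 \<noteq> 0"
      by (auto simp: \<kappa>_def inner_axis axis_in_Basis_iff)
    then show ?thesis using False by (auto intro!: prod_zero)
  qed
  finally show ?thesis .
qed

lemma continuous_phase: "continuous_on S (phase L k)"
  unfolding phase_def[abs_def] by (intro continuous_intros)

lemma integrable_cell_continuous:
  fixes f :: "real^2 \<Rightarrow> 'b::euclidean_space"
  assumes "continuous_on UNIV f"
  shows "integrable (lebesgue_on (cell L)) f"
  using absolutely_integrable_continuous[OF continuous_on_subset[OF assms], of "\<chi> i. - L / 2" "\<chi> i. L / 2"]
  unfolding set_integrable_def cell_def by (subst integrable_restrict_space) auto

lemma integral_cell_cos:
  assumes L: "0 < L"
  shows "integral\<^sup>L (lebesgue_on (cell L)) (\<lambda>x. cos (phase L k x)) = (if k = 0 then L\<^sup>2 else 0)"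
proof -
  have i: "integrable (lebesgue_on (cell L)) (\<lambda>x. exp (\<i> * of_real (phase L k x)))"
    by (intro integrable_cell_continuous continuous_intros continuous_phase)
  have "integral\<^sup>L (lebesgue_on (cell L)) (\<lambda>x. Re (exp (\<i> * of_real (phase L k x)))) =
      Re (integral\<^sup>L (lebesgue_on (cell L)) (\<lambda>x. exp (\<i> * of_real (phase L k x))))"
    by (rule integral_Re[OF i])
  then show ?thesis using integral_cell_exp[OF L, of k] by (simp add: Re_exp)
qed

lemma integral_cell_sin:
  assumes L: "0 < L"
  shows "integral\<^sup>L (lebesgue_on (cell L)) (\<lambda>x. sin (phase L k x)) = 0"
proof -
  have i: "integrable (lebesgue_on (cell L)) (\<lambda>x. exp (\<i> * of_real (phase L k x)))"
    by (intro integrable_cell_continuous continuous_intros continuous_phase)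
  have "integral\<^sup>L (lebesgue_on (cell L)) (\<lambda>x. Im (exp (\<i> * of_real (phase L k x)))) =
      Im (integral\<^sup>L (lebesgue_on (cell L)) (\<lambda>x. exp (\<i> * of_real (phase L k x))))"
    by (rule integral_Im[OF i])
  then show ?thesis using integral_cell_exp[OF L, of k] by (simp add: Im_exp)
qed

section \<open>The Hartley basis\<close>

definition rvec :: "int^2 \<Rightarrow> real^2" where "rvec k = (\<chi> i. of_int (k $ i))"

text \<open>For \<open>k = 0\<close> this is the zero vector, so \<open>mode L 0\<close> vanishes
  and \<open>perp_rvec\<close> holds at every frequency.\<close>

definition perp :: "int^2 \<Rightarrow> real^2" where
  "perp k = (1 / sqrt (ksq k)) *\<^sub>R (\<chi> i. if i = 1 then - of_int (k $ 2) else of_int (k $ 1))"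

text \<open>The functions \<open>cos + sin\<close> of the phases (Hartley's kernel) form a real orthonormal basis
  indexed by the whole lattice, so that no choice of representatives of \<open>{k, - k}\<close> is needed.\<close>
definition cas :: "real \<Rightarrow> int^2 \<Rightarrow> real^2 \<Rightarrow> real" where
  "cas L k x = (cos (phase L k x) + sin (phase L k x)) / L"

text \<open>Coefficients in an arbitrary real vector space: the same sums represent vector fields,
  their components and, after reindexing, a divergence.\<close>

definition trig :: "real \<Rightarrow> (int^2) set \<Rightarrow> (int^2 \<Rightarrow> 'b::real_vector) \<Rightarrow> real^2 \<Rightarrow> 'b" where
  "trig L F c x = (\<Sum>k\<in>F. cas L k x *\<^sub>R c k)"

definition mode :: "real \<Rightarrow> int^2 \<Rightarrow> real^2 \<Rightarrow> real^2" where
  "mode L k x = cas L k x *\<^sub>R perp k"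

definition lam :: "real \<Rightarrow> int^2 \<Rightarrow> real" where
  "lam L k = (2 * pi / L)\<^sup>2 * ksq k"

lemma phase_rvec: "phase L k x = 2 * pi / L * (rvec k \<bullet> x)"
  by (simp add: phase_def rvec_def inner_vec_def)

lemma rvec_minus: "rvec (- k) = - rvec k"
  by (simp add: rvec_def vec_eq_iff)

lemma rvec_add: "rvec (j + k) = rvec j + rvec k"
  by (simp add: rvec_def vec_eq_iff)

lemma rvec_diff: "rvec (j - k) = rvec j - rvec k"
  by (simp add: rvec_def vec_eq_iff)

lemma ksq_pos: "k \<noteq> 0 \<Longrightarrow> 0 < ksq k"
  using ksq_ge_1[of k] by linarith

lemma perp_rvec: "perp k \<bullet> rvec k = 0"
  by (simp add: perp_def rvec_def inner_vec_def sum_2)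

lemma perp_inner_self: "k \<noteq> 0 \<Longrightarrow> perp k \<bullet> perp k = 1"
proof -
  assume "k \<noteq> 0"
  let ?v = "(\<chi> i. if i = 1 then - of_int (k $ 2) else of_int (k $ 1)) :: real^2"
  have "?v \<bullet> ?v = ksq k"
    by (simp add: inner_vec_def sum_2 power2_eq_square ksq_def)
  then have "perp k \<bullet> perp k = (1 / sqrt (ksq k)) * ((1 / sqrt (ksq k)) * ksq k)"
    unfolding perp_def inner_scaleR_left inner_scaleR_right by (simp only:)
  also have "\<dots> = 1" using ksq_pos[OF \<open>k \<noteq> 0\<close>] by simp
  finally show ?thesis .
qed

lemma norm_perp: "k \<noteq> 0 \<Longrightarrow> norm (perp k) = 1"
  by (simp add: norm_eq_sqrt_inner perp_inner_self)

text \<open>In the plane the orthogonal complement of a nonzero vector is a line. This is why one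
  scalar coefficient per frequency describes a solenoidal field.\<close>

lemma orthogonal_rvec_imp_perp:
  fixes v :: "real^2"
  assumes k: "k \<noteq> 0" and v: "rvec k \<bullet> v = 0"
  shows "v = (v \<bullet> perp k) *\<^sub>R perp k"
proof -
  define a b where "a = real_of_int (k $ 1)" and "b = real_of_int (k $ 2)"
  define s where "s = a\<^sup>2 + b\<^sup>2"
  have s: "ksq k = s" "0 < s" using ksq_pos[OF k] by (simp_all add: s_def a_def b_def ksq_def)
  have ab: "a * v $ 1 + b * v $ 2 = 0"
    using v by (simp add: rvec_def inner_vec_def sum_2 a_def b_def)
  define d where "d = - b * v $ 1 + a * v $ 2"
  have p: "perp k $ 1 = - b / sqrt s" "perp k $ 2 = a / sqrt s"
    by (simp_all add: perp_def s a_def b_def)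
  have vp: "v \<bullet> perp k = d / sqrt s"
    by (simp add: inner_vec_def sum_2 p d_def field_simps add_divide_distrib diff_divide_distrib)
  have 1: "- b * d = s * v $ 1"
  proof -
    have "- b * d = b * b * v $ 1 - a * (b * v $ 2)" by (simp add: d_def algebra_simps)
    also have "b * v $ 2 = - (a * v $ 1)" using ab by linarith
    finally show ?thesis by (simp add: s_def power2_eq_square algebra_simps)
  qed
  have 2: "a * d = s * v $ 2"
  proof -
    have "a * d = a * a * v $ 2 - b * (a * v $ 1)" by (simp add: d_def algebra_simps)
    also have "a * v $ 1 = - (b * v $ 2)" using ab by linarith
    finally show ?thesis by (simp add: s_def power2_eq_square algebra_simps)
  qed
  have ss: "sqrt s * sqrt s = s" using s by simp
  have "((v \<bullet> perp k) *\<^sub>R perp k) $ 1 = (- b * d) / (sqrt s * sqrt s)" by (simp add: vp p)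
  then have r1: "((v \<bullet> perp k) *\<^sub>R perp k) $ 1 = v $ 1" unfolding ss 1 using s by simp
  have "((v \<bullet> perp k) *\<^sub>R perp k) $ 2 = (a * d) / (sqrt s * sqrt s)" by (simp add: vp p)
  then have "((v \<bullet> perp k) *\<^sub>R perp k) $ 2 = v $ 2" unfolding ss 2 using s by simp
  with r1 show ?thesis by (simp add: vec_eq_iff forall_2)
qed

lemma lam_ge: "k \<noteq> 0 \<Longrightarrow> (2 * pi / L)\<^sup>2 \<le> lam L k"
  unfolding lam_def using mult_left_mono[OF ksq_ge_1[of k], of "(2 * pi / L)\<^sup>2"] by simp

lemma continuous_cas: "continuous_on S (cas L k)"
  unfolding cas_def[abs_def] divide_inverse by (intro continuous_intros continuous_phase)

lemma continuous_trig: "continuous_on S (trig L F (c :: int^2 \<Rightarrow> 'b::real_normed_vector))"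
  unfolding trig_def[abs_def] by (intro continuous_intros continuous_cas)

lemma continuous_mode: "continuous_on S (mode L k)"
  unfolding mode_def[abs_def] by (intro continuous_intros continuous_cas)

lemma mode_trig: "mode L k = trig L {k} perp"
  by (simp add: fun_eq_iff mode_def trig_def)

lemma cas_bound: "0 < L \<Longrightarrow> \<bar>cas L k x\<bar> \<le> sqrt 2 / L"
proof -
  assume L: "0 < L"
  let ?t = "phase L k x"
  have "(cos ?t + sin ?t)\<^sup>2 = 1 + 2 * (cos ?t * sin ?t)"
    using sin_cos_squared_add[of ?t] by (simp add: power2_sum)
  also have "2 * (cos ?t * sin ?t) \<le> 1"
    using sum_squares_bound[of "cos ?t" "sin ?t"] by simp
  finally have "sqrt ((cos ?t + sin ?t)\<^sup>2) \<le> sqrt 2" by (intro real_sqrt_le_mono) simp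
  then have "\<bar>cos ?t + sin ?t\<bar> \<le> sqrt 2" by simp
  then show ?thesis using L by (simp add: cas_def abs_divide divide_right_mono)
qed

lemma cas_0: "cas L 0 x = 1 / L"
  by (simp add: cas_def phase_0)

lemma cas_periodic: "0 < L \<Longrightarrow> cas L k (x + L *\<^sub>R axis i 1) = cas L k x"
proof -
  assume L: "0 < L"
  have "phase L k (x + L *\<^sub>R axis i 1) = phase L k x + of_int (k $ i) * (2 * pi)"
    using L by (simp add: phase_rvec inner_add_right distrib_left) (simp add: rvec_def inner_axis)
  then show ?thesis
    by (simp add: cas_def sin_add cos_add sin_int_2pin cos_int_2pin mult.commute[of "of_int _" "2 * pi"])
qed

text \<open>Product-to-sum formula of the Hartley kernels: a cosine of the difference and a sine of
  the sum survive. The sine integrates to zero over the cell, so orthonormality, also of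
  \<open>k\<close> against \<open>- k\<close>, is decided by the cosine.\<close>

lemma cas_mult:
  "cas L j x * cas L k x = (cos (phase L (j - k) x) + sin (phase L (j + k) x)) / L\<^sup>2"
  by (simp add: cas_def phase_diff phase_add cos_diff sin_add power2_eq_square field_simps)

lemma cas_measurable: "cas L k \<in> borel_measurable (lebesgue_on (cell L))"
  using integrable_cell_continuous[OF continuous_cas] by (rule borel_measurable_integrable)

lemma sq_int_continuous:
  fixes f :: "real^2 \<Rightarrow> 'b::euclidean_space"
  assumes "continuous_on UNIV f" shows "sq_int L f"
  unfolding sq_int_def using assms
  by (auto intro!: integrable_cell_continuous continuous_intros borel_measurable_integrable)

lemma sq_int_cas_scaleR: "sq_int L (\<lambda>x. cas L k x *\<^sub>R (b :: 'b::euclidean_space))"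
  by (intro sq_int_continuous continuous_intros continuous_cas)

lemma sq_int_trig: "sq_int L (trig L F (c :: int^2 \<Rightarrow> 'b::euclidean_space))"
  by (intro sq_int_continuous continuous_trig)

lemma sq_int_mode: "sq_int L (mode L k)"
  by (intro sq_int_continuous continuous_mode)

section \<open>Orthonormality of the Hartley kernels\<close>

lemma integral_cell_phase:
  assumes "0 < L"
  shows "integral\<^sup>L (lebesgue_on (cell L)) (\<lambda>x. cos (phase L m x) + sin (phase L n x)) = (if m = 0 then L\<^sup>2 else 0)"
proof -
  have "integrable (lebesgue_on (cell L)) (\<lambda>x. cos (phase L m x))" "integrable (lebesgue_on (cell L)) (\<lambda>x. sin (phase L n x))"
    by (auto intro!: integrable_cell_continuous continuous_intros continuous_phase)
  then show ?thesis using assms by (simp add: integral_cell_cos integral_cell_sin)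
qed

lemma integral_cas_mult:
  assumes "0 < L"
  shows "integral\<^sup>L (lebesgue_on (cell L)) (\<lambda>x. cas L j x * cas L k x) = (if j = k then 1 else 0)"
  using assms integral_cell_phase[OF assms, of "j - k" "j + k"] by (simp add: cas_mult)

lemma l2inner_cas_scaleR:
  assumes "0 < L"
  shows "l2inner L (\<lambda>x. cas L j x *\<^sub>R a) (\<lambda>x. cas L k x *\<^sub>R (b :: 'b::euclidean_space)) = (if j = k then a \<bullet> b else 0)"
proof -
  have "l2inner L (\<lambda>x. cas L j x *\<^sub>R a) (\<lambda>x. cas L k x *\<^sub>R b) =
      integral\<^sup>L (lebesgue_on (cell L)) (\<lambda>x. (cas L j x * cas L k x) * (a \<bullet> b))"
    unfolding l2inner_eq by (intro Bochner_Integration.integral_cong) (auto simp: mult_ac)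
  then show ?thesis by (simp add: integral_cas_mult[OF assms])
qed

lemma l2inner_trig_cas:
  assumes "0 < L" "finite F"
  shows "l2inner L (trig L F c) (\<lambda>x. cas L k x *\<^sub>R (b :: 'b::euclidean_space)) = (if k \<in> F then c k \<bullet> b else 0)"
proof -
  have "l2inner L (trig L F c) (\<lambda>x. cas L k x *\<^sub>R b) = (\<Sum>j\<in>F. if j = k then c j \<bullet> b else 0)"
    unfolding trig_def[abs_def] using assms
    by (subst l2inner_sum_left) (auto intro: sq_int_cas_scaleR simp: l2inner_cas_scaleR)
  then show ?thesis using assms by (auto simp: sum.delta)
qed

lemma l2inner_mode_mode:
  "0 < L \<Longrightarrow> j \<noteq> 0 \<Longrightarrow> l2inner L (mode L j) (mode L k) = (if j = k then 1 else 0)"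
  using l2inner_cas_scaleR[of L j "perp j" k "perp k"] by (auto simp: mode_def[abs_def] perp_inner_self)

text \<open>Differentiating cos + sin gives cos - sin, the kernel of the opposite frequency. A first
  derivative thus reflects the index set, and a second one restores it.\<close>

lemma cas_has_derivative:
  "(cas L k has_derivative (\<lambda>h. (2 * pi / L * (rvec k \<bullet> h)) * cas L (- k) x)) (at x)"
proof -
  have "(cas L k has_derivative (\<lambda>h. (- (2 * pi / L * (rvec k \<bullet> h)) * sin (phase L k x) +
      2 * pi / L * (rvec k \<bullet> h) * cos (phase L k x)) / L)) (at x)"
    unfolding cas_def[abs_def] phase_rvec[abs_def]
    by (auto intro!: derivative_eq_intros simp: divide_inverse algebra_simps)
  then show ?thesis
    by (rule has_derivative_eq_rhs) (auto simp: cas_def phase_minus fun_eq_iff algebra_simps divide_inverse)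
qed

lemma trig_has_derivative:
  fixes c :: "int^2 \<Rightarrow> 'b::real_normed_vector"
  shows "(trig L F c has_derivative (\<lambda>h. \<Sum>k\<in>F. ((2 * pi / L * (rvec k \<bullet> h)) * cas L (- k) x) *\<^sub>R c k)) (at x)"
  unfolding trig_def[abs_def]
  by (intro has_derivative_sum has_derivative_scaleR_left cas_has_derivative)

lemma pd_trig:
  fixes c :: "int^2 \<Rightarrow> 'b::real_normed_vector"
  shows "pd i (trig L F c) x = (\<Sum>k\<in>F. (2 * pi / L * of_int (k $ i) * cas L (- k) x) *\<^sub>R c k)"
  unfolding pd_def frechet_derivative_at[OF trig_has_derivative, symmetric]
  by (simp add: rvec_def inner_axis)

text \<open>Reindexing by \<open>uminus\<close> shows a derivative to be a \<open>trig\<close>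
  again, which can be differentiated or integrated by the same rules; the sign stems from the
  reflected frequency.\<close>

lemma pd_trig_trig:
  fixes c :: "int^2 \<Rightarrow> 'b::real_normed_vector"
  shows "pd i (trig L F c) = trig L (uminus ` F) (\<lambda>k. (- (2 * pi / L * of_int (k $ i))) *\<^sub>R c (- k))"
  by (rule ext) (simp add: pd_trig trig_def sum.reindex inj_on_def mult_ac)

lemma laplacian_trig:
  fixes c :: "int^2 \<Rightarrow> 'b::real_normed_vector"
  shows "laplacian (trig L F c) = trig L F (\<lambda>k. (- lam L k) *\<^sub>R c k)"
proof
  fix x
  have "laplacian (trig L F c) x =
      (\<Sum>i\<in>UNIV. \<Sum>k\<in>F. (- (2 * pi / L * of_int (k $ i))\<^sup>2 * cas L k x) *\<^sub>R c k)"
    unfolding laplacian_def pd_trig_trig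
    by (simp add: trig_def image_image sum.reindex inj_on_def power2_eq_square mult_ac)
  also have "\<dots> = (\<Sum>k\<in>F. \<Sum>i\<in>UNIV. (- (2 * pi / L * of_int (k $ i))\<^sup>2 * cas L k x) *\<^sub>R c k)"
    by (rule sum.swap)
  also have "\<dots> = trig L F (\<lambda>k. (- lam L k) *\<^sub>R c k) x"
    unfolding trig_def
  proof (rule sum.cong[OF refl])
    fix k
    have "(\<Sum>i\<in>UNIV. (- (2 * pi / L * of_int (k $ i))\<^sup>2 * cas L k x) *\<^sub>R c k)
       = (- ((2 * pi / L * of_int (k $ 1))\<^sup>2 + (2 * pi / L * of_int (k $ 2))\<^sup>2) * cas L k x) *\<^sub>R c k"
      unfolding sum_2 scaleR_left_distrib[symmetric] by (simp add: algebra_simps)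
    also have "(2 * pi / L * of_int (k $ 1))\<^sup>2 + (2 * pi / L * of_int (k $ 2))\<^sup>2 = lam L k"
      by (simp add: lam_def ksq_def power_mult_distrib power_divide distrib_left)
    finally show "(\<Sum>i\<in>UNIV. (- (2 * pi / L * of_int (k $ i))\<^sup>2 * cas L k x) *\<^sub>R c k) = cas L k x *\<^sub>R (- lam L k) *\<^sub>R c k"
      by (simp add: mult.commute)
  qed
  finally show "laplacian (trig L F c) x = trig L F (\<lambda>k. (- lam L k) *\<^sub>R c k) x" .
qed

lemma divergence_trig:
  "divergence (trig L F c) x = (\<Sum>k\<in>F. 2 * pi / L * (rvec k \<bullet> c k) * cas L (- k) x)"
proof -
  have comp: "(\<lambda>y. trig L F c y $ i) = trig L F (\<lambda>k. c k $ i)" for i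
    by (simp add: trig_def fun_eq_iff)
  have "divergence (trig L F c) x = (\<Sum>i\<in>UNIV. \<Sum>k\<in>F. (2 * pi / L * of_int (k $ i) * cas L (- k) x) * c k $ i)"
    unfolding divergence_def comp pd_trig by simp
  also have "\<dots> = (\<Sum>k\<in>F. \<Sum>i\<in>UNIV. (2 * pi / L * of_int (k $ i) * cas L (- k) x) * c k $ i)"
    by (rule sum.swap)
  also have "\<dots> = (\<Sum>k\<in>F. 2 * pi / L * (rvec k \<bullet> c k) * cas L (- k) x)"
    by (intro sum.cong refl) (simp add: rvec_def inner_vec_def sum_2 algebra_simps)
  finally show ?thesis .
qed

lemma divergence_mode: "divergence (mode L k) = (\<lambda>x. 0)"
  by (simp add: fun_eq_iff mode_trig divergence_trig inner_commute[of "rvec k"] perp_rvec)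

lemma laplacian_mode: "laplacian (mode L k) = (\<lambda>x. (- lam L k) *\<^sub>R mode L k x)"
  unfolding mode_trig laplacian_trig by (simp add: fun_eq_iff trig_def)

lemma bilaplacian_mode: "laplacian (laplacian (mode L k)) = (\<lambda>x. (lam L k)\<^sup>2 *\<^sub>R mode L k x)"
  unfolding mode_trig laplacian_trig by (simp add: fun_eq_iff trig_def power2_eq_square mult_ac)

lemma advect_mode:
  "advect u (mode L k) x = (2 * pi / L * (rvec k \<bullet> u x) * cas L (- k) x) *\<^sub>R perp k"
proof -
  have "advect u (mode L k) x = (\<Sum>i\<in>UNIV. (u x $ i * (2 * pi / L * of_int (k $ i) * cas L (- k) x)) *\<^sub>R perp k)"
    unfolding advect_def mode_trig pd_trig by simp
  also have "\<dots> = (\<Sum>i\<in>UNIV. u x $ i * (2 * pi / L * of_int (k $ i) * cas L (- k) x)) *\<^sub>R perp k"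
    by (rule scaleR_left.sum[symmetric])
  also have "(\<Sum>i\<in>UNIV. u x $ i * (2 * pi / L * of_int (k $ i) * cas L (- k) x)) =
      2 * pi / L * (rvec k \<bullet> u x) * cas L (- k) x"
    by (simp add: rvec_def inner_vec_def sum_2 algebra_simps)
  finally show ?thesis .
qed

lemma trig_add:
  assumes "finite F" "finite G"
  shows "trig L F c x + trig L G d x =
    trig L (F \<union> G) (\<lambda>k. (if k \<in> F then c k else 0) + (if k \<in> G then d k else 0)) x"
proof -
  have "trig L F c x = (\<Sum>k\<in>F \<union> G. cas L k x *\<^sub>R (if k \<in> F then c k else 0))"
    unfolding trig_def using assms by (intro sum.mono_neutral_cong_left) auto
  moreover have "trig L G d x = (\<Sum>k\<in>F \<union> G. cas L k x *\<^sub>R (if k \<in> G then d k else 0))"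
    unfolding trig_def using assms by (intro sum.mono_neutral_cong_left) auto
  ultimately show ?thesis by (simp add: trig_def scaleR_add_right sum.distrib)
qed

lemma trig_poly_iff:
  assumes L: "0 < L"
  shows "\<phi> \<in> trig_poly L \<longleftrightarrow> (\<exists>F c. finite F \<and> \<phi> = trig L F c)"
proof
  assume "\<phi> \<in> trig_poly L"
  then obtain K a b where K: "finite K" "\<phi> = (\<lambda>x. \<Sum>k\<in>K. cos (phase L k x) *\<^sub>R a k + sin (phase L k x) *\<^sub>R b k)"
    by (auto simp: trig_poly_def Let_def phase_def)
  have "\<exists>F c. finite F \<and> (\<lambda>x. \<Sum>k\<in>K. cos (phase L k x) *\<^sub>R a k + sin (phase L k x) *\<^sub>R b k) = trig L F c"
    using K(1)
  proof (induction K rule: finite_induct)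
    case empty
    have "(\<lambda>x. 0) = trig L {} (\<lambda>k. 0 :: real^2)" by (simp add: fun_eq_iff trig_def)
    then show ?case by (auto intro!: exI[of _ "{}"])
  next
    case (insert k K)
    then obtain F c where F: "finite F"
      "(\<lambda>x. \<Sum>k\<in>K. cos (phase L k x) *\<^sub>R a k + sin (phase L k x) *\<^sub>R b k) = trig L F c" by blast
    \<comment> \<open>Cosine and sine are half the sum and half the difference of the kernels of
      \<open>k\<close> and \<open>- k\<close>, up to the factor L. Overlaps of the index sets, as
      for \<open>k = 0\<close> or when \<open>- k\<close> occurs already, are left to
      \<open>trig_add\<close>.\<close>
    define c1 where "c1 = (\<lambda>_ :: int^2. (L / 2) *\<^sub>R (a k + b k))"
    define c2 where "c2 = (\<lambda>_ :: int^2. (L / 2) *\<^sub>R (a k - b k))"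
    have "cos (phase L k x) *\<^sub>R a k + sin (phase L k x) *\<^sub>R b k = trig L {k} c1 x + trig L {- k} c2 x" for x
      using L by (simp add: trig_def cas_def phase_minus c1_def c2_def vec_eq_iff field_simps)
    then have "(\<lambda>x. \<Sum>k\<in>insert k K. cos (phase L k x) *\<^sub>R a k + sin (phase L k x) *\<^sub>R b k) =
        (\<lambda>x. trig L {k} c1 x + trig L {- k} c2 x + trig L F c x)"
      using insert.hyps F(2) by (simp add: fun_eq_iff)
    also have "\<dots> = trig L ({k} \<union> {- k} \<union> F) (\<lambda>j. (if j \<in> {k} \<union> {- k}
        then (if j \<in> {k} then c1 j else 0) + (if j \<in> {- k} then c2 j else 0) else 0) +
        (if j \<in> F then c j else 0))"
      using F(1) by (intro ext) (simp only: trig_add finite.emptyI finite.insertI finite_UnI)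
    finally show ?case by (intro exI conjI) (use F(1) in auto)
  qed
  then show "\<exists>F c. finite F \<and> \<phi> = trig L F c" using K by auto
next
  assume "\<exists>F c. finite F \<and> \<phi> = trig L F c"
  then obtain F c where F: "finite F" "\<phi> = trig L F c" by blast
  have "trig L F c = (\<lambda>x. \<Sum>k\<in>F. cos (phase L k x) *\<^sub>R ((1 / L) *\<^sub>R c k) + sin (phase L k x) *\<^sub>R ((1 / L) *\<^sub>R c k))"
    by (simp add: trig_def fun_eq_iff cas_def scaleR_left_distrib[symmetric] add_divide_distrib)
  then show "\<phi> \<in> trig_poly L"
    unfolding trig_poly_def Let_def mem_Collect_eq F(2)
    by (intro exI[of _ F] exI[of _ "\<lambda>k. (1 / L) *\<^sub>R c k"] conjI F(1)) (simp only: phase_def)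
qed

section \<open>Expansion of solenoidal fields\<close>

definition modes :: "nat \<Rightarrow> (int^2) set" where
  "modes n = {k. k \<noteq> 0 \<and> \<bar>k $ 1\<bar> \<le> int n \<and> \<bar>k $ 2\<bar> \<le> int n}"

definition coef :: "real \<Rightarrow> (real^2 \<Rightarrow> real^2) \<Rightarrow> int^2 \<Rightarrow> real" where
  "coef L u k = l2inner L u (mode L k)"

definition mode_sum :: "real \<Rightarrow> (int^2) set \<Rightarrow> (int^2 \<Rightarrow> real) \<Rightarrow> real^2 \<Rightarrow> real^2" where
  "mode_sum L F c x = (\<Sum>k\<in>F. c k *\<^sub>R mode L k x)"

lemma finite_modes: "finite (modes n)"
proof (rule finite_subset)
  show "modes n \<subseteq> (\<lambda>(i, j). \<chi> l. if l = 1 then i else j) ` ({- int n..int n} \<times> {- int n..int n})"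
  proof
    fix k assume "k \<in> modes n"
    then have mem: "(k $ 1, k $ 2) \<in> {- int n..int n} \<times> {- int n..int n}" by (auto simp: modes_def)
    have "k = (\<lambda>(i, j). \<chi> l. if l = 1 then i else j) (k $ 1, k $ 2)"
      by (simp add: vec_eq_iff forall_2)
    then show "k \<in> (\<lambda>(i, j). \<chi> l. if l = 1 then i else j) ` ({- int n..int n} \<times> {- int n..int n})"
      using mem by (rule image_eqI)
  qed
qed auto

lemma incseq_modes: "incseq modes"
  by (rule monoI) (auto simp: modes_def)

lemma zero_notin_modes: "0 \<notin> modes n"
  by (simp add: modes_def)

lemma modes_nonzero: "k \<in> modes n \<Longrightarrow> k \<noteq> 0"
  by (auto simp: modes_def)

lemma finite_subset_modes:
  assumes "finite F" "0 \<notin> F" obtains n where "F \<subseteq> modes n"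
proof
  define B where "B = insert 0 (\<Union>k\<in>F. {\<bar>k $ 1\<bar>, \<bar>k $ 2\<bar>})"
  have fB: "finite B" using assms by (auto simp: B_def)
  show "F \<subseteq> modes (nat (Max B))"
    using assms by (fastforce simp: modes_def B_def intro: Max_ge)
qed

lemma mode_sum_trig: "mode_sum L F c = trig L F (\<lambda>k. c k *\<^sub>R perp k)"
  by (simp add: fun_eq_iff mode_sum_def trig_def mode_def mult.commute)

lemma sq_int_mode_sum: "sq_int L (mode_sum L F c)"
  by (simp add: mode_sum_trig sq_int_trig)

lemma l2inner_mode_sum:
  assumes "sq_int L u"
  shows "l2inner L u (mode_sum L F c) = (\<Sum>k\<in>F. c k * coef L u k)"
proof -
  have "l2inner L u (mode_sum L F c) = (\<Sum>k\<in>F. l2inner L u (\<lambda>x. c k *\<^sub>R mode L k x))"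
    unfolding mode_sum_def[abs_def] by (rule l2inner_sum_right[OF sq_int_scaleR[OF sq_int_mode] assms])
  then show ?thesis by (simp only: l2inner_scaleR_right coef_def)
qed

lemma coef_mode_sum:
  assumes "0 < L" "finite F" "0 \<notin> F"
  shows "coef L (mode_sum L F c) k = (if k \<in> F then c k else 0)"
  using assms perp_inner_self[of k] unfolding coef_def mode_def[abs_def] mode_sum_trig
  by (auto simp: l2inner_trig_cas)

lemma l2norm_mode_sum:
  assumes "0 < L" "finite F" "0 \<notin> F"
  shows "(l2norm L (mode_sum L F c))\<^sup>2 = (\<Sum>k\<in>F. (c k)\<^sup>2)"
  unfolding l2norm_power2 l2inner_mode_sum[OF sq_int_mode_sum]
  by (intro sum.cong refl) (simp add: coef_mode_sum[OF assms] power2_eq_square)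

lemma l2norm_diff_power2:
  assumes "sq_int L u" "sq_int L v"
  shows "(l2norm L (\<lambda>x. u x - v x))\<^sup>2 = (l2norm L u)\<^sup>2 - 2 * l2inner L u v + (l2norm L v)\<^sup>2"
  using assms sq_int_diff[OF assms]
  by (simp add: l2norm_power2 l2inner_diff_left l2inner_diff_right l2inner_commute[of L v u])

text \<open>Pythagoras, with the last sum as the cost of coefficients other than those of
  \<open>u\<close>. It yields Bessel's inequality, best approximation in \<open>H_approx\<close> and
  the Cauchy property in \<open>riesz_fischer\<close>.\<close>

lemma l2norm_diff_mode_sum:
  assumes "0 < L" "finite F" "0 \<notin> F" "sq_int L u"
  shows "(l2norm L (\<lambda>x. u x - mode_sum L F c x))\<^sup>2 =
    (l2norm L u)\<^sup>2 - (\<Sum>k\<in>F. (coef L u k)\<^sup>2) + (\<Sum>k\<in>F. (coef L u k - c k)\<^sup>2)"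
proof -
  have "(l2norm L (\<lambda>x. u x - mode_sum L F c x))\<^sup>2 =
      (l2norm L u)\<^sup>2 - 2 * (\<Sum>k\<in>F. c k * coef L u k) + (\<Sum>k\<in>F. (c k)\<^sup>2)"
    unfolding l2norm_diff_power2[OF assms(4) sq_int_mode_sum] l2norm_mode_sum[OF assms(1-3)]
      l2inner_mode_sum[OF assms(4)] ..
  also have "\<dots> = (l2norm L u)\<^sup>2 - (\<Sum>k\<in>F. (coef L u k)\<^sup>2) + (\<Sum>k\<in>F. (coef L u k - c k)\<^sup>2)"
    by (simp add: power2_diff sum.distrib sum_subtractf sum_distrib_left mult_ac)
  finally show ?thesis .
qed

lemma bessel:
  assumes "0 < L" "finite F" "0 \<notin> F" "sq_int L u"
  shows "(\<Sum>k\<in>F. (coef L u k)\<^sup>2) \<le> (l2norm L u)\<^sup>2"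
  using l2norm_diff_mode_sum[OF assms, of "coef L u"] zero_le_power2[of "l2norm L (\<lambda>x. u x - mode_sum L F (coef L u) x)"]
  by simp

lemma L2per_trig: "0 < L \<Longrightarrow> trig L F (c :: int^2 \<Rightarrow> 'b::euclidean_space) \<in> L2per L"
proof -
  assume L: "0 < L"
  have "trig L F c \<in> borel_measurable lebesgue"
    using continuous_trig[of UNIV L F c] by (intro measurable_completion) (auto intro: borel_measurable_continuous_onI)
  moreover have "trig L F c (x + L *\<^sub>R axis i 1) = trig L F c x" for x i
    using L by (simp add: trig_def cas_periodic)
  ultimately show ?thesis
    using sq_int_trig[of L F c] by (simp add: L2per_def sq_int_def integrable_cell_eq)
qed

lemma mode_sum_sol_trig_poly:
  assumes "0 < L" "finite F" "0 \<notin> F"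
  shows "mode_sum L F c \<in> sol_trig_poly L"
proof -
  have "divergence (mode_sum L F c) x = 0" for x
    by (simp add: mode_sum_trig divergence_trig inner_commute[of "rvec _"] perp_rvec)
  moreover have "integral\<^sup>L (lebesgue_on (cell L)) (mode_sum L F c) = 0"
  proof (rule euclidean_eqI)
    fix b :: "real^2" assume "b \<in> Basis"
    have "integral\<^sup>L (lebesgue_on (cell L)) (mode_sum L F c) \<bullet> b =
        integral\<^sup>L (lebesgue_on (cell L)) (\<lambda>x. mode_sum L F c x \<bullet> b)"
      by (rule integral_inner_left[symmetric]) (simp add: sq_int_integrable sq_int_mode_sum)
    also have "\<dots> = L * l2inner L (mode_sum L F c) (\<lambda>x. cas L 0 x *\<^sub>R b)"
      using assms by (simp add: l2inner_eq cas_0)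
    also have "\<dots> = 0" using assms by (simp add: mode_sum_trig l2inner_trig_cas)
    finally show "integral\<^sup>L (lebesgue_on (cell L)) (mode_sum L F c) \<bullet> b = 0 \<bullet> b" by simp
  qed
  moreover have "mode_sum L F c \<in> trig_poly L"
    using assms by (auto simp: trig_poly_iff mode_sum_trig)
  ultimately show ?thesis by (simp add: sol_trig_poly_def integral_cell_eq)
qed

text \<open>By orthogonality of the kernels both constraints can be read off frequency by frequency:
  the zero mean removes the constant term, and the zero divergence makes each coefficient orthogonal
  to its frequency, hence a multiple of \<open>perp k\<close>.\<close>

lemma sol_trig_poly_mode_sum:
  assumes L: "0 < L" and \<phi>: "\<phi> \<in> sol_trig_poly L"
  obtains F c where "finite F" "0 \<notin> F" "\<phi> = mode_sum L F c"
proof -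
  obtain F c where F: "finite F" "\<phi> = trig L F c"
    using \<phi> L by (auto simp: sol_trig_poly_def trig_poly_iff)
  have c0: "c 0 = 0" if "0 \<in> F"
  proof -
    have "l2inner L \<phi> (\<lambda>x. cas L 0 x *\<^sub>R c 0) = (1 / L) * (integral\<^sup>L (lebesgue_on (cell L)) \<phi> \<bullet> c 0)"
      by (subst integral_inner_left[symmetric])
        (simp_all add: l2inner_eq cas_0 F sq_int_integrable sq_int_trig)
    also have "\<dots> = 0" using \<phi> by (simp add: sol_trig_poly_def integral_cell_eq)
    finally show ?thesis using F L that by (simp add: l2inner_trig_cas)
  qed
  have ck: "rvec k \<bullet> c k = 0" if "k \<in> F" for k
  proof -
    define d where "d j = 2 * pi / L * (rvec (- j) \<bullet> c (- j))" for j
    have "divergence \<phi> = trig L (uminus ` F) d"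
      by (rule ext) (simp add: F divergence_trig trig_def sum.reindex inj_on_def d_def mult_ac)
    moreover have "divergence \<phi> = (\<lambda>x. 0)" using \<phi> by (auto simp: sol_trig_poly_def)
    ultimately have d0: "trig L (uminus ` F) d = (\<lambda>x. 0)" by simp
    have "l2inner L (trig L (uminus ` F) d) (\<lambda>x. cas L (- k) x *\<^sub>R (1 :: real)) = 0"
      unfolding d0 l2inner_eq by simp
    then have "d (- k) = 0"
      using that F(1) l2inner_trig_cas[OF L, of "uminus ` F" d "- k" "1 :: real"] by simp
    then show ?thesis using L by (simp add: d_def)
  qed
  have "\<phi> = mode_sum L (F - {0}) (\<lambda>k. c k \<bullet> perp k)"
  proof
    fix x
    have "\<phi> x = (\<Sum>k\<in>F - {0}. cas L k x *\<^sub>R c k)"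
      using F c0 by (auto simp: trig_def intro!: sum.mono_neutral_right)
    also have "\<dots> = mode_sum L (F - {0}) (\<lambda>k. c k \<bullet> perp k) x"
      unfolding mode_sum_def mode_def
    proof (rule sum.cong[OF refl])
      fix k assume "k \<in> F - {0}"
      then have "c k = (c k \<bullet> perp k) *\<^sub>R perp k" using ck by (intro orthogonal_rvec_imp_perp) auto
      then have "cas L k x *\<^sub>R c k = cas L k x *\<^sub>R ((c k \<bullet> perp k) *\<^sub>R perp k)" by simp
      then show "cas L k x *\<^sub>R c k = (c k \<bullet> perp k) *\<^sub>R cas L k x *\<^sub>R perp k" by (simp add: mult.commute)
    qed
    finally show "\<phi> x = mode_sum L (F - {0}) (\<lambda>k. c k \<bullet> perp k) x" .
  qed
  then show thesis using F that[of "F - {0}"] by auto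
qed

lemma H_sq_int: "u \<in> H L \<Longrightarrow> sq_int L u"
  by (simp add: H_def L2per_sq_int)

lemma mode_sum_in_H:
  assumes "0 < L" "finite F" "0 \<notin> F" shows "mode_sum L F c \<in> H L"
proof -
  have "mode_sum L F c \<in> L2per L" using assms by (simp add: mode_sum_trig L2per_trig)
  moreover have "l2norm L (\<lambda>x. mode_sum L F c x - mode_sum L F c x) = 0"
    by (simp add: l2norm_def l2inner_eq)
  ultimately show ?thesis using mode_sum_sol_trig_poly[OF assms, of c]
    unfolding H_def by (auto intro!: bexI[of _ "mode_sum L F c"])
qed

lemma mode_mode_sum: "mode L k = mode_sum L {k} (\<lambda>_. 1)"
  by (simp add: fun_eq_iff mode_sum_def)

lemma mode_in_H: "0 < L \<Longrightarrow> k \<noteq> 0 \<Longrightarrow> mode L k \<in> H L"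
  unfolding mode_mode_sum by (intro mode_sum_in_H) auto

text \<open>An approximant from the definition of \<open>H\<close> involves finitely many modes, and
  the partial sum over any larger set of modes is at least as close.\<close>

lemma H_approx:
  assumes L: "0 < L" and u: "u \<in> H L"
  shows "(\<lambda>n. l2norm L (\<lambda>x. u x - mode_sum L (modes n) (coef L u) x)) \<longlonglongrightarrow> 0"
proof (rule LIMSEQ_I)
  fix \<epsilon> :: real assume "0 < \<epsilon>"
  then obtain \<phi> where \<phi>: "\<phi> \<in> sol_trig_poly L" "l2norm L (\<lambda>x. u x - \<phi> x) < \<epsilon>"
    using u by (auto simp: H_def)
  obtain F c where F: "finite F" "0 \<notin> F" "\<phi> = mode_sum L F c"
    using sol_trig_poly_mode_sum[OF L \<phi>(1)] by blast
  obtain n0 where n0: "F \<subseteq> modes n0" using finite_subset_modes[OF F(1,2)] by blast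
  note uq = H_sq_int[OF u]
  have "l2norm L (\<lambda>x. u x - mode_sum L (modes n) (coef L u) x) < \<epsilon>" if "n \<ge> n0" for n
  proof -
    have sub: "F \<subseteq> modes n" using n0 that incseq_modes by (auto dest: monoD)
    have "(\<Sum>k\<in>F. (coef L u k)\<^sup>2) \<le> (\<Sum>k\<in>modes n. (coef L u k)\<^sup>2)"
      using sub finite_modes by (intro sum_mono2) auto
    moreover have "0 \<le> (\<Sum>k\<in>F. (coef L u k - c k)\<^sup>2)" by (intro sum_nonneg) auto
    ultimately have "(l2norm L (\<lambda>x. u x - mode_sum L (modes n) (coef L u) x))\<^sup>2 \<le> (l2norm L (\<lambda>x. u x - \<phi> x))\<^sup>2"
      using l2norm_diff_mode_sum[OF L finite_modes zero_notin_modes uq, of n "coef L u"]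
        l2norm_diff_mode_sum[OF L F(1,2) uq, of c] F(3) by simp
    then have "l2norm L (\<lambda>x. u x - mode_sum L (modes n) (coef L u) x) \<le> l2norm L (\<lambda>x. u x - \<phi> x)"
      by (rule power2_le_imp_le) (rule l2norm_nonneg)
    then show ?thesis using \<phi>(2) by linarith
  qed
  then show "\<exists>n0. \<forall>n\<ge>n0. norm (l2norm L (\<lambda>x. u x - mode_sum L (modes n) (coef L u) x) - 0) < \<epsilon>"
    by (intro exI[of _ n0]) (simp add: l2norm_nonneg)
qed

text \<open>The error is \<open>w\<close> paired with the remainder of \<open>u\<close>. Hence
  \<open>w\<close> may be any square integrable field, which is how gradients and general right-hand
  sides of \<open>proj\<close> are handled.\<close>

lemma parseval_inner:
  assumes L: "0 < L" and u: "u \<in> H L" and w: "sq_int L w"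
  shows "(\<lambda>n. \<Sum>k\<in>modes n. coef L u k * coef L w k) \<longlonglongrightarrow> l2inner L w u"
proof (rule LIM_zero_cancel, rule Lim_null_comparison)
  show "\<forall>\<^sub>F n in sequentially. norm ((\<Sum>k\<in>modes n. coef L u k * coef L w k) - l2inner L w u) \<le>
      l2norm L w * l2norm L (\<lambda>x. u x - mode_sum L (modes n) (coef L u) x)"
  proof (intro always_eventually allI)
    fix n
    let ?P = "mode_sum L (modes n) (coef L u)"
    have "l2inner L w u - (\<Sum>k\<in>modes n. coef L u k * coef L w k) = l2inner L w (\<lambda>x. u x - ?P x)"
      using w H_sq_int[OF u] sq_int_mode_sum by (simp add: l2inner_diff_right l2inner_mode_sum)
    then show "norm ((\<Sum>k\<in>modes n. coef L u k * coef L w k) - l2inner L w u) \<le> l2norm L w * l2norm L (\<lambda>x. u x - ?P x)"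
      using l2inner_Cauchy_Schwarz[OF w sq_int_diff[OF H_sq_int[OF u] sq_int_mode_sum], of "modes n" "coef L u"]
      by (simp add: abs_minus_commute)
  qed
  show "(\<lambda>n. l2norm L w * l2norm L (\<lambda>x. u x - mode_sum L (modes n) (coef L u) x)) \<longlonglongrightarrow> 0"
    using tendsto_mult[OF tendsto_const[of "l2norm L w"] H_approx[OF L u]] by simp
qed

lemma parseval:
  assumes "0 < L" "u \<in> H L"
  shows "(\<lambda>n. \<Sum>k\<in>modes n. (coef L u k)\<^sup>2) \<longlonglongrightarrow> (l2norm L u)\<^sup>2"
proof -
  have "(\<Sum>k\<in>modes n. (coef L u k)\<^sup>2) = (\<Sum>k\<in>modes n. coef L u k * coef L u k)" for n
    by (simp add: power2_eq_square)
  then show ?thesis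
    using parseval_inner[OF assms H_sq_int[OF assms(2)]] by (simp only: l2norm_power2)
qed

text \<open>Solenoidality and zero mean in Fourier form, carried over to the closure: a kernel with
  an arbitrary direction sees only the component along \<open>perp k\<close>.\<close>

lemma l2inner_cas_H:
  assumes L: "0 < L" and u: "u \<in> H L"
  shows "l2inner L u (\<lambda>x. cas L k x *\<^sub>R b) = (if k = 0 then 0 else (perp k \<bullet> b) * coef L u k)"
proof -
  define w where "w = (\<lambda>x. cas L k x *\<^sub>R b)"
  have w: "sq_int L w" unfolding w_def by (rule sq_int_cas_scaleR)
  have cw: "coef L w j = (if k = j then b \<bullet> perp j else 0)" for j
    unfolding coef_def mode_def[abs_def] w_def by (rule l2inner_cas_scaleR[OF L])
  have inner: "(\<Sum>j\<in>modes n. coef L u j * coef L w j) = (if k \<in> modes n then coef L u k * (b \<bullet> perp k) else 0)" for n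
    using finite_modes by (simp add: cw if_distrib sum.delta' cong: if_cong)
  have "eventually (\<lambda>n. (k \<in> modes n) = (k \<noteq> 0)) sequentially"
  proof (cases "k = 0")
    case True
    then show ?thesis by (simp add: zero_notin_modes)
  next
    case False
    then obtain n0 where "k \<in> modes n0" using finite_subset_modes[of "{k}"] by auto
    then show ?thesis using False incseq_modes
      by (intro eventually_sequentiallyI[of n0]) (auto dest: monoD)
  qed
  then have "eventually (\<lambda>n. (\<Sum>j\<in>modes n. coef L u j * coef L w j) = (if k = 0 then 0 else (perp k \<bullet> b) * coef L u k)) sequentially"
    by eventually_elim (simp add: inner mult.commute inner_commute[of b])
  then have "(\<lambda>n. \<Sum>j\<in>modes n. coef L u j * coef L w j) \<longlonglongrightarrow> (if k = 0 then 0 else (perp k \<bullet> b) * coef L u k)"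
    by (rule tendsto_eventually)
  then have "l2inner L w u = (if k = 0 then 0 else (perp k \<bullet> b) * coef L u k)"
    using parseval_inner[OF L u w] LIMSEQ_unique by blast
  then show ?thesis by (simp only: l2inner_commute[of L u] w_def)
qed

section \<open>Completeness of the space of solenoidal fields\<close>

lemma l2norm_le_liminf:
  fixes f :: "nat \<Rightarrow> real^2 \<Rightarrow> 'b::euclidean_space"
  assumes f: "\<And>n. sq_int L (f n)" and g: "g \<in> borel_measurable (lebesgue_on (cell L))"
    and lim: "AE x in lebesgue_on (cell L). (\<lambda>n. f n x) \<longlonglongrightarrow> g x"
    and B: "\<forall>\<^sub>F n in sequentially. l2norm L (f n) \<le> B"
  shows "sq_int L g" "l2norm L g \<le> B"
proof -
  obtain n0 where n0: "\<And>n. n \<ge> n0 \<Longrightarrow> l2norm L (f n) \<le> B"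
    using B by (auto simp: eventually_sequentially)
  have B0: "0 \<le> B" using n0[of n0] l2norm_nonneg[of L "f n0"] by linarith
  have nn: "(\<integral>\<^sup>+x. ennreal ((norm (f n x))\<^sup>2) \<partial>lebesgue_on (cell L)) \<le> ennreal (B\<^sup>2)" if "n \<ge> n0" for n
  proof -
    have "(\<integral>\<^sup>+x. ennreal ((norm (f n x))\<^sup>2) \<partial>lebesgue_on (cell L)) = ennreal (integral\<^sup>L (lebesgue_on (cell L)) (\<lambda>x. (norm (f n x))\<^sup>2))"
      using f by (intro nn_integral_eq_integral) (auto simp: sq_int_def)
    also have "integral\<^sup>L (lebesgue_on (cell L)) (\<lambda>x. (norm (f n x))\<^sup>2) = (l2norm L (f n))\<^sup>2"
      by (simp add: l2norm_power2 l2inner_eq power2_norm_eq_inner)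
    also have "\<dots> \<le> B\<^sup>2" using n0[OF that] l2norm_nonneg by (intro power_mono) auto
    finally show ?thesis by (simp add: ennreal_leI)
  qed
  have "(\<integral>\<^sup>+x. ennreal ((norm (g x))\<^sup>2) \<partial>lebesgue_on (cell L)) =
      (\<integral>\<^sup>+x. liminf (\<lambda>n. ennreal ((norm (f n x))\<^sup>2)) \<partial>lebesgue_on (cell L))"
  proof (rule nn_integral_cong_AE)
    show "AE x in lebesgue_on (cell L). ennreal ((norm (g x))\<^sup>2) = liminf (\<lambda>n. ennreal ((norm (f n x))\<^sup>2))"
      using lim
    proof eventually_elim
      case (elim x)
      then have "(\<lambda>n. ennreal ((norm (f n x))\<^sup>2)) \<longlonglongrightarrow> ennreal ((norm (g x))\<^sup>2)"
        by (intro tendsto_ennrealI tendsto_intros)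
      then show ?case by (metis lim_imp_Liminf trivial_limit_sequentially)
    qed
  qed
  also have "\<dots> \<le> liminf (\<lambda>n. \<integral>\<^sup>+x. ennreal ((norm (f n x))\<^sup>2) \<partial>lebesgue_on (cell L))"
    using f by (intro nn_integral_liminf) (auto simp: sq_int_def)
  also have "\<dots> \<le> ennreal (B\<^sup>2)"
    using nn by (intro Liminf_le) (auto simp: eventually_sequentially)
  finally have le: "(\<integral>\<^sup>+x. ennreal ((norm (g x))\<^sup>2) \<partial>lebesgue_on (cell L)) \<le> ennreal (B\<^sup>2)" .
  show sq: "sq_int L g"
    unfolding sq_int_def
  proof (intro conjI g)
    show "integrable (lebesgue_on (cell L)) (\<lambda>x. (norm (g x))\<^sup>2)"
      using g le by (intro integrableI_nonneg) (auto intro: le_less_trans)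
  qed
  have "ennreal ((l2norm L g)\<^sup>2) \<le> ennreal (B\<^sup>2)"
    using le sq nn_integral_eq_integral[of "lebesgue_on (cell L)" "\<lambda>x. (norm (g x))\<^sup>2"]
    by (simp add: sq_int_def l2norm_power2 l2inner_eq power2_norm_eq_inner)
  then have "(l2norm L g)\<^sup>2 \<le> B\<^sup>2" by simp
  then show "l2norm L g \<le> B" using B0 by (rule power2_le_imp_le)
qed

lemma integral_norm_le_l2norm:
  fixes f :: "real^2 \<Rightarrow> 'b::euclidean_space"
  assumes L: "0 < L" and f: "sq_int L f"
  shows "integral\<^sup>L (lebesgue_on (cell L)) (\<lambda>x. norm (f x)) \<le> L * l2norm L f"
proof -
  have n: "sq_int L (\<lambda>x. norm (f x))" using f by (auto simp: sq_int_def)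
  have c: "sq_int L (\<lambda>x. 1 :: real)" by (intro sq_int_continuous continuous_intros)
  have "l2inner L (\<lambda>x. norm (f x)) (\<lambda>x. 1) \<le> l2norm L (\<lambda>x. norm (f x)) * l2norm L (\<lambda>x. 1 :: real)"
    using l2inner_Cauchy_Schwarz[OF n c] by linarith
  moreover have "l2norm L (\<lambda>x. norm (f x)) = l2norm L f"
    by (simp add: l2norm_def l2inner_eq power2_norm_eq_inner flip: power2_eq_square)
  moreover have "l2norm L (\<lambda>x. 1 :: real) = L"
    using integral_cell_cos[OF L, of 0] L by (simp add: l2norm_def l2inner_eq phase_0)
  ultimately show ?thesis by (simp add: l2inner_eq mult.commute)
qed

text \<open>The partial sums are Cauchy in the square norm, hence in the mean since the cell has
  finite measure, so a subsequence converges almost everywhere; Fatou's lemma turns this into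
  convergence of the whole sequence in the square norm.\<close>

lemma riesz_fischer:
  assumes L: "0 < L" and B: "\<And>n. (\<Sum>k\<in>modes n. (c k)\<^sup>2) \<le> B"
  obtains w where "w \<in> H L" "\<And>k. k \<noteq> 0 \<Longrightarrow> coef L w k = c k"
proof -
  define f where "f n = mode_sum L (modes n) c" for n
  have sqf: "sq_int L (f n)" for n by (simp add: f_def sq_int_mode_sum)
  have dist: "(l2norm L (\<lambda>x. f n x - f m x))\<^sup>2 = (\<Sum>k\<in>modes n. (c k)\<^sup>2) - (\<Sum>k\<in>modes m. (c k)\<^sup>2)" if "m \<le> n" for m n
  proof -
    have sub: "modes m \<subseteq> modes n" using incseq_modes that by (auto dest: monoD)
    have "(l2norm L (\<lambda>x. f n x - f m x))\<^sup>2 =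
      (l2norm L (f n))\<^sup>2 - (\<Sum>k\<in>modes m. (coef L (f n) k)\<^sup>2) + (\<Sum>k\<in>modes m. (coef L (f n) k - c k)\<^sup>2)"
      unfolding f_def by (rule l2norm_diff_mode_sum[OF L finite_modes zero_notin_modes sq_int_mode_sum])
    moreover have "coef L (f n) k = c k" if "k \<in> modes m" for k
      using that sub coef_mode_sum[OF L finite_modes zero_notin_modes] by (auto simp: f_def)
    ultimately show ?thesis
      by (simp add: f_def l2norm_mode_sum[OF L finite_modes zero_notin_modes])
  qed
  have cs: "Cauchy (\<lambda>n. \<Sum>k\<in>modes n. (c k)\<^sup>2)"
    using B incseq_sum_nonneg[OF incseq_modes finite_modes, of "\<lambda>k. (c k)\<^sup>2"]
    by (intro convergent_Cauchy Bseq_mono_convergent incseq_bounded)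
      (auto simp: monoD intro: sum_nonneg dest: monoD)
  have cauchy: "\<exists>N. \<forall>i\<ge>N. \<forall>j\<ge>N. l2norm L (\<lambda>x. f i x - f j x) \<le> \<epsilon>" if "0 < \<epsilon>" for \<epsilon>
  proof -
    have "0 < \<epsilon>\<^sup>2" using that by simp
    from metric_CauchyD[OF cs this] obtain N where
      N: "\<forall>i\<ge>N. \<forall>j\<ge>N. dist (\<Sum>k\<in>modes i. (c k)\<^sup>2) (\<Sum>k\<in>modes j. (c k)\<^sup>2) < \<epsilon>\<^sup>2" ..
    have le: "l2norm L (\<lambda>x. f i x - f j x) \<le> \<epsilon>" if "N \<le> j" "j \<le> i" for i j
    proof -
      have "(l2norm L (\<lambda>x. f i x - f j x))\<^sup>2 \<le> \<epsilon>\<^sup>2"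
        using N[rule_format, of i j] that unfolding dist[OF that(2)] dist_real_def by simp
      then show ?thesis using \<open>0 < \<epsilon>\<close> by (auto intro: power2_le_imp_le)
    qed
    show ?thesis
    proof (intro exI[of _ N] allI impI)
      fix i j assume "N \<le> i" "N \<le> j"
      then show "l2norm L (\<lambda>x. f i x - f j x) \<le> \<epsilon>"
        using le[of j i] le[of i j] l2norm_minus_commute[of L "f i" "f j"] by (cases "j \<le> i") auto
    qed
  qed
  obtain r where r: "strict_mono r" "AE x in lebesgue_on (cell L). Cauchy (\<lambda>i. f (r i) x)"
  proof (rule cauchy_L1_AE_cauchy_subseq[of "lebesgue_on (cell L)" f])
    show "integrable (lebesgue_on (cell L)) (f n)" for n by (rule sq_int_integrable[OF sqf])
    fix \<epsilon> :: real assume \<epsilon>: "0 < \<epsilon>"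
    then obtain N where N: "\<forall>i\<ge>N. \<forall>j\<ge>N. l2norm L (\<lambda>x. f i x - f j x) \<le> \<epsilon> / (2 * L)"
      using cauchy[of "\<epsilon> / (2 * L)"] L by auto
    have "integral\<^sup>L (lebesgue_on (cell L)) (\<lambda>x. norm (f i x - f j x)) < \<epsilon>" if "i \<ge> N" "j \<ge> N" for i j
    proof -
      have "integral\<^sup>L (lebesgue_on (cell L)) (\<lambda>x. norm (f i x - f j x)) \<le> L * l2norm L (\<lambda>x. f i x - f j x)"
        by (intro integral_norm_le_l2norm L sq_int_diff sqf)
      also have "\<dots> \<le> L * (\<epsilon> / (2 * L))" using N that L by (intro mult_left_mono) auto
      also have "\<dots> < \<epsilon>" using L \<epsilon> by simp
      finally show ?thesis .
    qed
    then show "\<exists>N. \<forall>i\<ge>N. \<forall>j\<ge>N. integral\<^sup>L (lebesgue_on (cell L)) (\<lambda>x. norm (f i x - f j x)) < \<epsilon>" by blast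
  qed blast
  \<comment> \<open>\<open>lim\<close> is taken at every point, also where the sequence diverges.
    Since the mode sums are periodic, \<open>w\<close> is periodic without exception and measurable
    on the plane, as \<open>L2per\<close> demands.\<close>
  define w where "w x = lim (\<lambda>i. f (r i) x)" for x
  have meas: "f n \<in> borel_measurable lebesgue" for n
    using L2per_trig[OF L, of "modes n" "\<lambda>k. c k *\<^sub>R perp k"] by (simp add: f_def mode_sum_trig L2per_def)
  have wm: "w \<in> borel_measurable lebesgue"
    unfolding w_def[abs_def] by (rule borel_measurable_lim_metric) (rule meas)
  then have wmc: "w \<in> borel_measurable (lebesgue_on (cell L))" by (rule measurable_restrict_space1)
  have lim: "AE x in lebesgue_on (cell L). (\<lambda>i. f (r i) x) \<longlonglongrightarrow> w x"
    using r(2) by eventually_elim (simp add: w_def Cauchy_convergent_iff convergent_LIMSEQ_iff)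
  have wf: "sq_int L (\<lambda>x. w x - f j x) \<and> l2norm L (\<lambda>x. w x - f j x) \<le> \<epsilon>"
    if "\<forall>i\<ge>N. \<forall>j\<ge>N. l2norm L (\<lambda>x. f i x - f j x) \<le> \<epsilon>" "j \<ge> N" for \<epsilon> N j
  proof -
    have "AE x in lebesgue_on (cell L). (\<lambda>i. f (r i) x - f j x) \<longlonglongrightarrow> w x - f j x"
      using lim by eventually_elim (intro tendsto_intros)
    moreover have "(\<lambda>x. w x - f j x) \<in> borel_measurable (lebesgue_on (cell L))"
      using wmc sqf[of j] by measurable
    moreover have "\<forall>\<^sub>F i in sequentially. l2norm L (\<lambda>x. f (r i) x - f j x) \<le> \<epsilon>"
      using that seq_suble[OF r(1)] by (intro eventually_sequentiallyI[of N]) (meson order_trans)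
    ultimately show ?thesis
      using l2norm_le_liminf[of L "\<lambda>i x. f (r i) x - f j x" "\<lambda>x. w x - f j x" \<epsilon>] sqf
      by (auto intro: sq_int_diff)
  qed
  obtain N1 where "\<forall>i\<ge>N1. \<forall>j\<ge>N1. l2norm L (\<lambda>x. f i x - f j x) \<le> 1" using cauchy[of 1] by auto
  then have "sq_int L (\<lambda>x. (w x - f N1 x) + f N1 x)" using wf sqf by (intro sq_int_add) auto
  then have wsq: "sq_int L w" by simp
  have "w (x + L *\<^sub>R axis i 1) = w x" for x i
    unfolding w_def f_def mode_sum_def mode_def by (simp add: cas_periodic[OF L])
  then have "w \<in> L2per L" using wm wsq by (simp add: L2per_def integrable_cell_eq sq_int_def)
  moreover have "\<exists>\<phi>\<in>sol_trig_poly L. l2norm L (\<lambda>x. w x - \<phi> x) < \<epsilon>" if \<epsilon>: "0 < \<epsilon>" for \<epsilon>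
  proof -
    obtain N where "\<forall>i\<ge>N. \<forall>j\<ge>N. l2norm L (\<lambda>x. f i x - f j x) \<le> \<epsilon> / 2" using cauchy[of "\<epsilon> / 2"] \<epsilon> by auto
    then have "l2norm L (\<lambda>x. w x - f N x) \<le> \<epsilon> / 2" using wf by blast
    then show ?thesis using \<epsilon> mode_sum_sol_trig_poly[OF L finite_modes zero_notin_modes]
      by (intro bexI[of _ "f N"]) (auto simp: f_def)
  qed
  ultimately have wH: "w \<in> H L" by (simp add: H_def)
  have "coef L w k = c k" if k: "k \<noteq> 0" for k
  proof -
    obtain n0 where n0: "k \<in> modes n0" using finite_subset_modes[of "{k}"] k by auto
    have small: "\<bar>coef L w k - c k\<bar> \<le> \<epsilon>" if \<epsilon>: "0 < \<epsilon>" for \<epsilon>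
    proof -
      obtain N where N: "\<forall>i\<ge>N. \<forall>j\<ge>N. l2norm L (\<lambda>x. f i x - f j x) \<le> \<epsilon>" using cauchy[OF \<epsilon>] by auto
      define j where "j = max N n0"
      have kj: "k \<in> modes j" using n0 incseq_modes by (auto simp: j_def dest!: monoD[of modes n0 "max N n0"])
      have "coef L (f j) k = c k"
        using kj coef_mode_sum[OF L finite_modes zero_notin_modes] by (simp add: f_def)
      then have "coef L w k - c k = l2inner L (\<lambda>x. w x - f j x) (mode L k)"
        using wsq sqf sq_int_mode by (simp add: coef_def l2inner_diff_left)
      moreover have "l2norm L (mode L k) = 1"
        using l2inner_mode_mode[OF L k, of k] by (simp add: l2norm_def)
      ultimately have "\<bar>coef L w k - c k\<bar> \<le> l2norm L (\<lambda>x. w x - f j x)"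
        using l2inner_Cauchy_Schwarz[OF sq_int_diff[OF wsq sqf[of j]] sq_int_mode[of L k]] by simp
      also have "\<dots> \<le> \<epsilon>" using wf[OF N, of j] by (simp add: j_def)
      finally show ?thesis .
    qed
    have "\<bar>coef L w k - c k\<bar> \<le> 0" by (rule field_le_epsilon) (simp add: small)
    then show ?thesis by simp
  qed
  then show thesis using wH that by blast
qed

section \<open>The Stokes operator\<close>

text \<open>The projection is the field of \<open>H L\<close> with the same mode coefficients as
  \<open>v\<close>; Bessel's inequality makes them admissible for \<open>riesz_fischer\<close>. This
  justifies the choice in \<open>proj\<close>.\<close>

lemma exists_proj:
  assumes L: "0 < L" and v: "sq_int L v"
  shows "\<exists>w. w \<in> H L \<and> (\<forall>h\<in>H L. l2inner L (\<lambda>x. v x - w x) h = 0)"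
proof -
  have "(\<Sum>k\<in>modes n. (coef L v k)\<^sup>2) \<le> (l2norm L v)\<^sup>2" for n
    by (rule bessel[OF L finite_modes zero_notin_modes v])
  then obtain w where w: "w \<in> H L" "\<And>k. k \<noteq> 0 \<Longrightarrow> coef L w k = coef L v k"
    by (rule riesz_fischer[OF L]) blast
  note wq = H_sq_int[OF w(1)]
  have "l2inner L (\<lambda>x. v x - w x) h = 0" if h: "h \<in> H L" for h
  proof -
    have "coef L (\<lambda>x. v x - w x) k = 0" if "k \<noteq> 0" for k
      using w(2)[OF that] v wq sq_int_mode by (simp add: coef_def l2inner_diff_left)
    then have "(\<Sum>k\<in>modes n. coef L h k * coef L (\<lambda>x. v x - w x) k) = 0" for n
      by (intro sum.neutral) (auto dest: modes_nonzero)
    then show ?thesis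
      using parseval_inner[OF L h sq_int_diff[OF v wq]] by (simp add: LIMSEQ_const_iff)
  qed
  then show ?thesis using w(1) by blast
qed

lemma coef_proj:
  assumes L: "0 < L" and v: "sq_int L v"
  shows "proj L v \<in> H L" "k \<noteq> 0 \<Longrightarrow> coef L (proj L v) k = coef L v k"
proof -
  have p: "proj L v \<in> H L \<and> (\<forall>h\<in>H L. l2inner L (\<lambda>x. v x - proj L v x) h = 0)"
    unfolding proj_def by (rule someI_ex[OF exists_proj[OF L v]])
  then show "proj L v \<in> H L" by blast
  assume "k \<noteq> 0"
  then have "l2inner L (\<lambda>x. v x - proj L v x) (mode L k) = 0"
    using p mode_in_H[OF L] by blast
  then show "coef L (proj L v) k = coef L v k"
    using v H_sq_int[of "proj L v"] p sq_int_mode by (simp add: coef_def l2inner_diff_left)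
qed

lemma coef_weak_laplacian:
  assumes L: "0 < L" and u: "sq_int L u" and g: "has_weak_laplacian L u g"
  shows "coef L g k = - lam L k * coef L u k"
proof -
  have "mode L k \<in> trig_poly L"
    unfolding trig_poly_iff[OF L] mode_trig by blast
  then have "l2inner L u (laplacian (mode L k)) = l2inner L g (mode L k)"
    using g by (simp add: has_weak_laplacian_def)
  then show ?thesis by (simp only: laplacian_mode l2inner_scaleR_right coef_def)
qed

text \<open>Pairing with a mode determines the coefficients of every weak Laplacian and of every
  projection, so the two choices inside \<open>stokes\<close> do not affect them.\<close>

lemma coef_stokes:
  assumes L: "0 < L" and u: "u \<in> dom_stokes L"
  shows "stokes L u \<in> H L" "k \<noteq> 0 \<Longrightarrow> coef L (stokes L u) k = lam L k * coef L u k"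
proof -
  define g where "g = (SOME g. has_weak_laplacian L u g)"
  have uH: "u \<in> H L" and ex: "\<exists>g. has_weak_laplacian L u g" using u by (auto simp: dom_stokes_def)
  have g: "has_weak_laplacian L u g" unfolding g_def by (rule someI_ex[OF ex])
  then have gq: "sq_int L g" by (simp add: has_weak_laplacian_def L2per_sq_int)
  have mq: "sq_int L (\<lambda>x. - g x)" using sq_int_scaleR[OF gq, of "-1"] by simp
  have st: "stokes L u = proj L (\<lambda>x. - g x)" by (simp add: stokes_def g_def)
  show "stokes L u \<in> H L" unfolding st by (rule coef_proj(1)[OF L mq])
  assume k: "k \<noteq> 0"
  have "coef L (stokes L u) k = coef L (\<lambda>x. - g x) k" unfolding st by (rule coef_proj(2)[OF L mq k])
  also have "\<dots> = - coef L g k"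
    using l2inner_scaleR_left[of L "-1" g "mode L k"] by (simp add: coef_def)
  finally show "coef L (stokes L u) k = lam L k * coef L u k"
    using coef_weak_laplacian[OF L H_sq_int[OF uH] g, of k] by simp
qed

lemma stokes_norm:
  assumes L: "0 < L" and u: "u \<in> dom_stokes L"
  shows "(\<lambda>n. \<Sum>k\<in>modes n. (lam L k)\<^sup>2 * (coef L u k)\<^sup>2) \<longlonglongrightarrow> (l2norm L (stokes L u))\<^sup>2"
proof -
  have "(\<Sum>k\<in>modes n. (coef L (stokes L u) k)\<^sup>2) = (\<Sum>k\<in>modes n. (lam L k)\<^sup>2 * (coef L u k)\<^sup>2)" for n
    by (intro sum.cong refl) (simp add: coef_stokes(2)[OF L u modes_nonzero] power_mult_distrib)
  then show ?thesis using parseval[OF L coef_stokes(1)[OF L u]] by simp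
qed

text \<open>The weak Laplacian is synthesised from its coefficients. It has to be tested against all
  trigonometric polynomials, gradients included; as both fields lie in \<open>H L\<close>,
  \<open>l2inner_cas_H\<close> makes those components vanish on both sides.\<close>

lemma dom_stokesI:
  assumes L: "0 < L" and u: "u \<in> H L"
    and B: "\<And>n. (\<Sum>k\<in>modes n. (lam L k)\<^sup>2 * (coef L u k)\<^sup>2) \<le> B"
  shows "u \<in> dom_stokes L"
proof -
  have "(\<Sum>k\<in>modes n. (- lam L k * coef L u k)\<^sup>2) \<le> B" for n
    using B[of n] by (simp add: power_mult_distrib)
  then obtain g where g: "g \<in> H L" "\<And>k. k \<noteq> 0 \<Longrightarrow> coef L g k = - lam L k * coef L u k"
    by (rule riesz_fischer[OF L]) blast
  have "l2inner L u (laplacian \<phi>) = l2inner L g \<phi>" if \<phi>: "\<phi> \<in> trig_poly L" for \<phi>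
  proof -
    obtain F c where F: "finite F" "\<phi> = trig L F c" using \<phi> trig_poly_iff[OF L, of \<phi>] by blast
    have trig_inner: "l2inner L w (trig L F d) = (\<Sum>k\<in>F. if k = 0 then 0 else (perp k \<bullet> d k) * coef L w k)"
      if "w \<in> H L" for w and d :: "int^2 \<Rightarrow> real^2"
      unfolding trig_def[abs_def]
      by (subst l2inner_sum_right) (auto intro: sq_int_cas_scaleR H_sq_int[OF that] simp: l2inner_cas_H[OF L that])
    show ?thesis
      unfolding F(2) laplacian_trig trig_inner[OF u] trig_inner[OF g(1)]
      by (intro sum.cong refl) (simp add: g(2))
  qed
  then have "has_weak_laplacian L u g"
    using g(1) by (simp add: has_weak_laplacian_def H_def)
  then show ?thesis using u by (auto simp: dom_stokes_def)
qed

lemma H_eq_zero: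
  assumes L: "0 < L" and u: "u \<in> H L" and c: "\<And>k. k \<noteq> 0 \<Longrightarrow> coef L u k = 0"
  shows "l2norm L u = 0"
proof -
  have "(\<Sum>k\<in>modes n. (coef L u k)\<^sup>2) = 0" for n
    using c by (intro sum.neutral) (auto dest: modes_nonzero)
  then show ?thesis using parseval[OF L u] by (simp add: LIMSEQ_const_iff)
qed

text \<open>The mode of frequency (1, 0) is an eigenfield with this value. Conversely an eigenfield
  has a nonzero coefficient at some \<open>k\<close>, and pairing its equation with that mode forces
  the eigenvalue to be \<open>lam L k\<close>.\<close>

lemma lambda1_eq:
  assumes L: "0 < L"
  shows "lambda1 L = (2 * pi / L)\<^sup>2"
  unfolding lambda1_def
proof (rule Least_equality)
  define e :: "int^2" where "e = axis 1 1"
  have e0: "e \<noteq> 0" by (simp add: e_def)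
  have lam: "lam L e = (2 * pi / L)\<^sup>2" by (simp add: lam_def ksq_def e_def axis_def)
  let ?v = "mode L e"
  have ce: "coef L ?v k = (if e = k then 1 else 0)" for k
    using l2inner_mode_mode[OF L e0, of k] by (simp add: coef_def)
  have v: "?v \<in> H L" by (rule mode_in_H[OF L e0])
  have S: "(\<Sum>k\<in>modes n. (lam L k)\<^sup>2 * (coef L ?v k)\<^sup>2) = (if e \<in> modes n then (lam L e)\<^sup>2 else 0)" for n
  proof -
    have "(\<Sum>k\<in>modes n. (lam L k)\<^sup>2 * (coef L ?v k)\<^sup>2) = (\<Sum>k\<in>modes n. if e = k then (lam L k)\<^sup>2 else 0)"
      by (intro sum.cong refl) (simp add: ce)
    then show ?thesis using finite_modes by simp
  qed
  have dom: "?v \<in> dom_stokes L"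
    by (rule dom_stokesI[OF L v, of "(lam L e)\<^sup>2"]) (simp add: S)
  have nv: "l2norm L ?v = 1" using ce[of e] by (simp add: l2norm_def coef_def)
  have stq: "sq_int L (stokes L ?v)" by (rule H_sq_int[OF coef_stokes(1)[OF L dom]])
  have "l2norm L (\<lambda>x. stokes L ?v x - (2 * pi / L)\<^sup>2 *\<^sub>R ?v x) = 0"
  proof -
    have inner: "l2inner L (stokes L ?v) ?v = (2 * pi / L)\<^sup>2"
      using coef_stokes(2)[OF L dom e0] ce[of e] by (simp add: coef_def lam)
    have sn: "(l2norm L (stokes L ?v))\<^sup>2 = ((2 * pi / L)\<^sup>2)\<^sup>2"
    proof -
      obtain n0 where "e \<in> modes n0" using finite_subset_modes[of "{e}"] e0 by auto
      then have "eventually (\<lambda>n. (\<Sum>k\<in>modes n. (lam L k)\<^sup>2 * (coef L ?v k)\<^sup>2) = ((2 * pi / L)\<^sup>2)\<^sup>2) sequentially"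
        unfolding S lam using incseq_modes by (intro eventually_sequentiallyI[of n0]) (auto dest: monoD)
      then show ?thesis by (intro LIMSEQ_unique[OF stokes_norm[OF L dom]] tendsto_eventually)
    qed
    \<comment> \<open>With the eigenvalue called M, the expanded square is M^2 - 2 M M +
      M^2.\<close>
    have "(l2norm L (\<lambda>x. stokes L ?v x - (2 * pi / L)\<^sup>2 *\<^sub>R ?v x))\<^sup>2 = 0"
      unfolding l2norm_diff_power2[OF stq sq_int_scaleR[OF sq_int_mode]] l2inner_scaleR_right
        l2norm_scaleR inner nv sn by (simp add: power2_eq_square)
    then show ?thesis by simp
  qed
  then show "stokes_eigenvalue L ((2 * pi / L)\<^sup>2)"
    unfolding stokes_eigenvalue_def using dom nv by (intro bexI[of _ ?v]) auto
next
  fix \<mu> assume "stokes_eigenvalue L \<mu>"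
  then obtain v where v: "v \<in> dom_stokes L" "l2norm L v \<noteq> 0"
    "l2norm L (\<lambda>x. stokes L v x - \<mu> *\<^sub>R v x) = 0"
    by (auto simp: stokes_eigenvalue_def)
  have vH: "v \<in> H L" using v by (simp add: dom_stokes_def)
  note vq = H_sq_int[OF vH] and sq = H_sq_int[OF coef_stokes(1)[OF L v(1)]]
  obtain k where k: "k \<noteq> 0" "coef L v k \<noteq> 0" using H_eq_zero[OF L vH] v(2) by blast
  have "\<bar>l2inner L (\<lambda>x. stokes L v x - \<mu> *\<^sub>R v x) (mode L k)\<bar> \<le> 0"
    using l2inner_Cauchy_Schwarz[OF sq_int_diff[OF sq sq_int_scaleR[OF vq]] sq_int_mode[of L k], of \<mu>] v(3) by simp
  then have "coef L (stokes L v) k - \<mu> * coef L v k = 0"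
    using sq sq_int_scaleR[OF vq] sq_int_mode by (simp add: coef_def l2inner_diff_left l2inner_scaleR_left)
  then have "\<mu> = lam L k" using coef_stokes(2)[OF L v(1) k(1)] k(2) by simp
  then show "(2 * pi / L)\<^sup>2 \<le> \<mu>" using lam_ge[OF k(1)] by simp
qed

section \<open>The advection term\<close>

lemma l2norm_le_pointwise:
  fixes f :: "real^2 \<Rightarrow> 'b::euclidean_space" and h :: "real^2 \<Rightarrow> real"
  assumes f: "f \<in> borel_measurable (lebesgue_on (cell L))" and h: "integrable (lebesgue_on (cell L)) h"
    and le: "\<And>x. (norm (f x))\<^sup>2 \<le> h x"
  shows "sq_int L f" "(l2norm L f)\<^sup>2 \<le> integral\<^sup>L (lebesgue_on (cell L)) h"
proof -
  have int: "integrable (lebesgue_on (cell L)) (\<lambda>x. (norm (f x))\<^sup>2)"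
    using f le by (intro Bochner_Integration.integrable_bound[OF h]) (auto intro!: AE_I2 order_trans[OF le])
  then show "sq_int L f" using f by (simp add: sq_int_def)
  show "(l2norm L f)\<^sup>2 \<le> integral\<^sup>L (lebesgue_on (cell L)) h"
    unfolding l2norm_power2 l2inner_eq power2_norm_eq_inner[symmetric]
    by (rule integral_mono[OF int h le])
qed

text \<open>For smooth solenoidal \<open>u\<close> this is minus the pairing of (u . grad) u with
  the mode. With the derivative on the mode it is a quadratic form that is continuous in the square
  norm alone.\<close>

definition nonlin :: "real \<Rightarrow> (real^2 \<Rightarrow> real^2) \<Rightarrow> int^2 \<Rightarrow> real" where
  "nonlin L u k = l2inner L u (advect u (mode L k))"

text \<open>A bound for the gradient of one mode. It grows with \<open>k\<close> and serves
  continuity at fixed \<open>k\<close>; the estimate uniform in the frequencies is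
  \<open>advect_self_bound\<close>.\<close>

definition advect_bound :: "real \<Rightarrow> int^2 \<Rightarrow> real" where
  "advect_bound L k = 2 * pi / L * (norm (rvec k) * (sqrt 2 / L)) * norm (perp k)"

lemma advect_mode_bound:
  assumes L: "0 < L" and u: "sq_int L u"
  shows "sq_int L (advect u (mode L k))" "l2norm L (advect u (mode L k)) \<le> advect_bound L k * l2norm L u"
proof -
  let ?K = "advect_bound L k"
  have K: "0 \<le> ?K" using L by (simp add: advect_bound_def)
  have eq: "advect u (mode L k) = (\<lambda>x. (2 * pi / L * (rvec k \<bullet> u x) * cas L (- k) x) *\<^sub>R perp k)"
    by (simp add: fun_eq_iff advect_mode)
  have m: "advect u (mode L k) \<in> borel_measurable (lebesgue_on (cell L))"
    unfolding eq using u cas_measurable[of L "- k"] by measurable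
  have le: "(norm (advect u (mode L k) x))\<^sup>2 \<le> ?K\<^sup>2 * (norm (u x))\<^sup>2" for x
  proof -
    have "norm (advect u (mode L k) x) = 2 * pi / L * (\<bar>rvec k \<bullet> u x\<bar> * \<bar>cas L (- k) x\<bar>) * norm (perp k)"
      using L by (simp add: advect_mode abs_mult)
    also have "\<dots> \<le> 2 * pi / L * ((norm (rvec k) * norm (u x)) * (sqrt 2 / L)) * norm (perp k)"
      using L by (intro mult_right_mono mult_left_mono mult_mono Cauchy_Schwarz_ineq2 cas_bound) auto
    also have "\<dots> = ?K * norm (u x)" by (simp add: advect_bound_def mult_ac)
    finally have "norm (advect u (mode L k) x) \<le> ?K * norm (u x)" .
    then have "(norm (advect u (mode L k) x))\<^sup>2 \<le> (?K * norm (u x))\<^sup>2" by (intro power_mono) auto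
    then show ?thesis by (simp add: power_mult_distrib)
  qed
  have h: "integrable (lebesgue_on (cell L)) (\<lambda>x. ?K\<^sup>2 * (norm (u x))\<^sup>2)"
    using u by (simp add: sq_int_def)
  show "sq_int L (advect u (mode L k))" by (rule l2norm_le_pointwise(1)[OF m h le])
  have "(l2norm L (advect u (mode L k)))\<^sup>2 \<le> (?K * l2norm L u)\<^sup>2"
    using l2norm_le_pointwise(2)[OF m h le] u
    by (simp add: sq_int_def power_mult_distrib l2norm_power2 l2inner_eq power2_norm_eq_inner)
  then show "l2norm L (advect u (mode L k)) \<le> ?K * l2norm L u"
    by (rule power2_le_imp_le) (intro mult_nonneg_nonneg K l2norm_nonneg)
qed

lemma advect_mode_diff:
  "advect (\<lambda>x. u x - v x) (mode L k) = (\<lambda>x. advect u (mode L k) x - advect v (mode L k) x)"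
proof
  fix x
  let ?a = "2 * pi / L * (rvec k \<bullet> u x) * cas L (- k) x" and ?b = "2 * pi / L * (rvec k \<bullet> v x) * cas L (- k) x"
  have "2 * pi / L * (rvec k \<bullet> (u x - v x)) * cas L (- k) x = ?a - ?b"
    by (simp only: inner_diff_right right_diff_distrib left_diff_distrib)
  then show "advect (\<lambda>x. u x - v x) (mode L k) x = advect u (mode L k) x - advect v (mode L k) x"
    unfolding advect_mode by (simp only: scaleR_left_diff_distrib)
qed

text \<open>Polarisation of a quadratic form B: B(u, u) - B(v, v) = B(u - v, u) + B(v, u -
  v).\<close>

lemma nonlin_diff_le:
  assumes L: "0 < L" and u: "sq_int L u" and v: "sq_int L v"
  shows "\<bar>nonlin L u k - nonlin L v k\<bar> \<le>
    advect_bound L k * (l2norm L u + l2norm L v) * l2norm L (\<lambda>x. u x - v x)"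
proof -
  define d where "d = (\<lambda>x. u x - v x)"
  have d: "sq_int L d" unfolding d_def by (rule sq_int_diff[OF u v])
  let ?A = "\<lambda>w. advect w (mode L k)"
  note A = advect_mode_bound(1)[OF L] and B = advect_mode_bound(2)[OF L]
  have Ad: "?A d = (\<lambda>x. ?A u x - ?A v x)" unfolding d_def by (rule advect_mode_diff)
  have 1: "l2inner L d (?A u) = l2inner L u (?A u) - l2inner L v (?A u)"
    unfolding d_def by (rule l2inner_diff_left[OF u v A[OF u]])
  have 2: "l2inner L v (?A d) = l2inner L v (?A u) - l2inner L v (?A v)"
    unfolding Ad by (rule l2inner_diff_right[OF A[OF u] A[OF v] v])
  have "nonlin L u k - nonlin L v k = l2inner L d (?A u) + l2inner L v (?A d)"
    unfolding 1 2 nonlin_def by simp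
  then have "\<bar>nonlin L u k - nonlin L v k\<bar> \<le> \<bar>l2inner L d (?A u)\<bar> + \<bar>l2inner L v (?A d)\<bar>"
    by (simp only: abs_triangle_ineq)
  also have "\<dots> \<le> l2norm L d * l2norm L (?A u) + l2norm L v * l2norm L (?A d)"
    by (rule add_mono[OF l2inner_Cauchy_Schwarz[OF d A[OF u]] l2inner_Cauchy_Schwarz[OF v A[OF d]]])
  also have "\<dots> \<le> l2norm L d * (advect_bound L k * l2norm L u) + l2norm L v * (advect_bound L k * l2norm L d)"
    by (rule add_mono[OF mult_left_mono[OF B[OF u] l2norm_nonneg] mult_left_mono[OF B[OF d] l2norm_nonneg]])
  also have "\<dots> = advect_bound L k * (l2norm L u + l2norm L v) * l2norm L d" by (simp only: ring_distribs mult_ac)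
  finally show ?thesis by (simp only: d_def)
qed

text \<open>Stated for a general filter, because it serves both continuity in time along the
  solution and the convergence of mode sums to a field.\<close>

lemma tendsto_nonlin:
  assumes L: "0 < L" and u: "sq_int L u" and v: "\<forall>\<^sub>F n in F. sq_int L (v n)"
    and lim: "((\<lambda>n. l2norm L (\<lambda>x. v n x - u x)) \<longlongrightarrow> 0) F"
  shows "((\<lambda>n. nonlin L (v n) k) \<longlongrightarrow> nonlin L u k) F"
proof (rule LIM_zero_cancel, rule Lim_null_comparison)
  let ?d = "\<lambda>n. l2norm L (\<lambda>x. v n x - u x)"
  show "\<forall>\<^sub>F n in F. norm (nonlin L (v n) k - nonlin L u k) \<le> advect_bound L k * (2 * l2norm L u + ?d n) * ?d n"
    using v
  proof eventually_elim
    case (elim n)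
    have "0 \<le> advect_bound L k" using L by (simp add: advect_bound_def)
    moreover have "l2norm L (v n) \<le> l2norm L u + ?d n"
      using l2norm_diff_abs_le[OF elim u] by linarith
    ultimately have "advect_bound L k * (l2norm L (v n) + l2norm L u) * ?d n \<le> advect_bound L k * (2 * l2norm L u + ?d n) * ?d n"
      by (intro mult_right_mono mult_left_mono l2norm_nonneg) auto
    then show ?case using nonlin_diff_le[OF L elim u, of k] by simp
  qed
  have "((\<lambda>n. advect_bound L k * (2 * l2norm L u + ?d n) * ?d n) \<longlongrightarrow> advect_bound L k * (2 * l2norm L u + 0) * 0) F"
    by (intro tendsto_intros lim)
  then show "((\<lambda>n. advect_bound L k * (2 * l2norm L u + ?d n) * ?d n) \<longlongrightarrow> 0) F" by simp
qed

text \<open>The sum of the two sides is the pairing of \<open>u\<close> with the gradient of \<open>cas j * cas k\<close>,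
  whose two frequencies \<open>j + k\<close> and \<open>j - k\<close> are parallel to their coefficient vectors.\<close>
lemma advect_antisym:
  assumes L: "0 < L" and u: "u \<in> H L"
  shows "l2inner L (mode L j) (advect u (mode L k)) = - l2inner L (mode L k) (advect u (mode L j))"
proof -
  note uq = H_sq_int[OF u]
  define p q where "p = j + k" and "q = j - k"
  define c where "c = 2 * pi / L * (perp j \<bullet> perp k) / (2 * L)"
  define G where "G x = cas L p x *\<^sub>R (c *\<^sub>R rvec p) + cas L (- p) x *\<^sub>R (c *\<^sub>R rvec p)
      - (cas L q x *\<^sub>R (c *\<^sub>R rvec q) - cas L (- q) x *\<^sub>R (c *\<^sub>R rvec q))" for x
  have z: "l2inner L u (\<lambda>x. cas L m x *\<^sub>R (c *\<^sub>R rvec n)) = 0" if "n = m \<or> n = - m" for m n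
  proof -
    have "perp m \<bullet> (c *\<^sub>R rvec n) = 0" using that perp_rvec[of m] by (auto simp: rvec_minus)
    then show ?thesis unfolding l2inner_cas_H[OF L u] by simp
  qed
  have z1: "l2inner L u (\<lambda>x. cas L m x *\<^sub>R (c *\<^sub>R rvec m)) = 0" for m by (rule z) simp
  have z2: "l2inner L u (\<lambda>x. cas L (- m) x *\<^sub>R (c *\<^sub>R rvec m)) = 0" for m by (rule z) simp
  have G0: "l2inner L u G = 0"
    unfolding G_def[abs_def]
    by (simp only: l2inner_diff_right l2inner_add_right sq_int_cas_scaleR sq_int_add sq_int_diff uq z1 z2 add_0_left diff_self)
  have prod: "cas L (- k) x * cas L j x = (cas L p x + cas L (- p) x + (cas L q x - cas L (- q) x)) / (2 * L)"
    "cas L (- j) x * cas L k x = (cas L p x + cas L (- p) x - (cas L q x - cas L (- q) x)) / (2 * L)" for x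
  proof -
    let ?a = "phase L j x" and ?b = "phase L k x"
    have P: "cas L p x + cas L (- p) x = 2 * cos (?a + ?b) / L"
      unfolding cas_def phase_minus p_def phase_add cos_minus sin_minus
      by (simp add: add_divide_distrib diff_divide_distrib)
    have Q: "cas L q x - cas L (- q) x = 2 * sin (?a - ?b) / L"
      unfolding cas_def phase_minus q_def phase_diff cos_minus sin_minus
      by (simp add: add_divide_distrib diff_divide_distrib)
    have 1: "(cos ?b - sin ?b) * (cos ?a + sin ?a) = cos (?a + ?b) + sin (?a - ?b)"
      "(cos ?a - sin ?a) * (cos ?b + sin ?b) = cos (?a + ?b) - sin (?a - ?b)"
      by (simp_all add: cos_add sin_diff algebra_simps)
    have 2: "cas L (- k) x * cas L j x = ((cos ?b - sin ?b) * (cos ?a + sin ?a)) / (L * L)"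
      "cas L (- j) x * cas L k x = ((cos ?a - sin ?a) * (cos ?b + sin ?b)) / (L * L)"
      by (simp_all add: cas_def phase_minus)
    show "cas L (- k) x * cas L j x = (cas L p x + cas L (- p) x + (cas L q x - cas L (- q) x)) / (2 * L)"
      "cas L (- j) x * cas L k x = (cas L p x + cas L (- p) x - (cas L q x - cas L (- q) x)) / (2 * L)"
      unfolding P Q 2 1 using L by (simp_all add: field_simps)
  qed
  have pw: "mode L j x \<bullet> advect u (mode L k) x + mode L k x \<bullet> advect u (mode L j) x = u x \<bullet> G x" for x
  proof -
    define a b where "a = rvec j \<bullet> u x" and "b = rvec k \<bullet> u x"
    define P Q where "P = cas L p x + cas L (- p) x" and "Q = cas L q x - cas L (- q) x"
    have "mode L j x \<bullet> advect u (mode L k) x + mode L k x \<bullet> advect u (mode L j) x =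
        2 * pi / L * (perp j \<bullet> perp k) * (b * (cas L (- k) x * cas L j x) + a * (cas L (- j) x * cas L k x))"
      by (simp add: advect_mode mode_def a_def b_def inner_commute[of "perp k" "perp j"] algebra_simps)
    \<comment> \<open>The bracket equals (a + b) P - (a - b) Q, and a + b and a - b are the pairings
      of \<open>u x\<close> with \<open>rvec p\<close> and \<open>rvec q\<close>: each kernel meets
      its own frequency vector, as in a gradient.\<close>
    also have "\<dots> = c * (b * (P + Q) + a * (P - Q))"
      unfolding prod P_def[symmetric] Q_def[symmetric] using L by (simp add: c_def field_simps)
    also have "\<dots> = u x \<bullet> G x"
      by (simp add: G_def inner_add_right inner_diff_right p_def q_def rvec_add rvec_diff
          inner_commute[of "u x"] a_def[symmetric] b_def[symmetric] P_def Q_def algebra_simps)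
    finally show ?thesis .
  qed
  have "l2inner L (mode L j) (advect u (mode L k)) + l2inner L (mode L k) (advect u (mode L j)) = l2inner L u G"
    unfolding l2inner_eq pw[symmetric]
    using advect_mode_bound(1)[OF L uq] sq_int_mode
    by (intro Bochner_Integration.integral_add[symmetric] sq_int_inner) auto
  then show ?thesis using G0 by linarith
qed

section \<open>A finite mode sum advected by itself\<close>

lemma l2norm_trig:
  fixes c :: "int^2 \<Rightarrow> real^2"
  assumes "0 < L" "finite F"
  shows "l2inner L (trig L F c) (trig L F c) = (\<Sum>k\<in>F. c k \<bullet> c k)"
proof -
  have "l2inner L (trig L F c) (trig L F c) = (\<Sum>k\<in>F. l2inner L (trig L F c) (\<lambda>x. cas L k x *\<^sub>R c k))"
    by (subst (2) trig_def[abs_def], rule l2inner_sum_right[OF sq_int_cas_scaleR sq_int_trig])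
  then show ?thesis using assms by (simp add: l2inner_trig_cas)
qed

lemma norm_inner_combination_le:
  fixes v :: "real^2" and d :: "2 \<Rightarrow> real^2"
  shows "(norm (\<Sum>i\<in>UNIV. v $ i *\<^sub>R d i))\<^sup>2 \<le> (norm v)\<^sup>2 * (\<Sum>i\<in>UNIV. (norm (d i))\<^sup>2)"
proof -
  have "norm (\<Sum>i\<in>UNIV. v $ i *\<^sub>R d i) \<le> (\<Sum>i\<in>UNIV. \<bar>v $ i\<bar> * norm (d i))"
    by (rule order_trans[OF norm_sum]) simp
  then have "(norm (\<Sum>i\<in>UNIV. v $ i *\<^sub>R d i))\<^sup>2 \<le> (\<Sum>i\<in>UNIV. \<bar>v $ i\<bar> * norm (d i))\<^sup>2"
    by (intro power_mono) auto
  also have "\<dots> \<le> (\<Sum>i\<in>UNIV. \<bar>v $ i\<bar>\<^sup>2) * (\<Sum>i\<in>UNIV. (norm (d i))\<^sup>2)"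
    by (rule Cauchy_Schwarz_ineq_sum)
  also have "(\<Sum>i\<in>UNIV. \<bar>v $ i\<bar>\<^sup>2) = (norm v)\<^sup>2"
    by (simp only: power2_abs power2_norm_eq_inner inner_vec_def inner_real_def power2_eq_square[symmetric])
  finally show ?thesis .
qed

lemma advect_self_mode_sum:
  assumes F: "finite F"
  shows "advect v (mode_sum L F g) x = (\<Sum>j\<in>F. g j *\<^sub>R advect v (mode L j) x)"
proof -
  have "advect v (mode_sum L F g) x = (\<Sum>i\<in>UNIV. \<Sum>j\<in>F. g j *\<^sub>R (v x $ i *\<^sub>R pd i (mode L j) x))"
    unfolding advect_def mode_sum_trig mode_trig pd_trig
    by (simp add: scaleR_sum_right mult_ac)
  also have "\<dots> = (\<Sum>j\<in>F. \<Sum>i\<in>UNIV. g j *\<^sub>R (v x $ i *\<^sub>R pd i (mode L j) x))" by (rule sum.swap)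
  also have "\<dots> = (\<Sum>j\<in>F. g j *\<^sub>R advect v (mode L j) x)"
    by (simp add: advect_def scaleR_sum_right)
  finally show ?thesis .
qed

text \<open>For finite sums \<open>advect_antisym\<close> does the work of integration by parts: it
  moves the derivative from the mode onto \<open>v\<close>, and it makes the double sum of the
  energy pairing its own negative.\<close>

lemma nonlin_mode_sum:
  fixes g :: "int^2 \<Rightarrow> real"
  assumes L: "0 < L" and F: "finite F" "0 \<notin> F"
  defines "v \<equiv> mode_sum L F g"
  shows "nonlin L v k = - l2inner L (advect v v) (mode L k)" "(\<Sum>k\<in>F. nonlin L v k * g k) = 0"
proof -
  have v: "v \<in> H L" unfolding v_def by (rule mode_sum_in_H[OF L F])
  note vq = H_sq_int[OF v]
  note A = advect_mode_bound(1)[OF L vq]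
  have N: "nonlin L v k = (\<Sum>j\<in>F. g j * l2inner L (mode L j) (advect v (mode L k)))" for k
  proof -
    have "nonlin L v k = l2inner L (advect v (mode L k)) v"
      unfolding nonlin_def by (rule l2inner_commute)
    also have "\<dots> = (\<Sum>j\<in>F. g j * coef L (advect v (mode L k)) j)"
      using l2inner_mode_sum[OF A, where F = F and c = g] unfolding v_def[symmetric] .
    finally show ?thesis by (simp only: coef_def l2inner_commute[of L "advect v (mode L k)"])
  qed
  have "nonlin L v k = (\<Sum>j\<in>F. - (g j * l2inner L (mode L k) (advect v (mode L j))))"
    unfolding N by (intro sum.cong refl) (subst advect_antisym[OF L v], simp)
  also have "\<dots> = - l2inner L (mode L k) (\<lambda>x. \<Sum>j\<in>F. g j *\<^sub>R advect v (mode L j) x)"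
    by (subst l2inner_sum_right[OF sq_int_scaleR[OF A] sq_int_mode]) (simp add: l2inner_scaleR_right sum_negf)
  also have "(\<lambda>x. \<Sum>j\<in>F. g j *\<^sub>R advect v (mode L j) x) = advect v v"
    unfolding v_def by (rule ext) (rule advect_self_mode_sum[OF F(1), symmetric])
  finally show "nonlin L v k = - l2inner L (advect v v) (mode L k)"
    by (simp only: l2inner_commute[of L "mode L k"])
  let ?b = "\<lambda>j k. g k * (g j * l2inner L (mode L j) (advect v (mode L k)))"
  have S: "(\<Sum>k\<in>F. nonlin L v k * g k) = (\<Sum>k\<in>F. \<Sum>j\<in>F. ?b j k)"
    by (simp add: N sum_distrib_right sum_distrib_left mult_ac)
  have "(\<Sum>k\<in>F. \<Sum>j\<in>F. ?b j k) = (\<Sum>k\<in>F. \<Sum>j\<in>F. - ?b k j)"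
    by (intro sum.cong refl) (subst advect_antisym[OF L v], simp add: mult_ac)
  also have "\<dots> = - (\<Sum>j\<in>F. \<Sum>k\<in>F. ?b k j)" by (subst sum.swap) (simp add: sum_negf)
  finally show "(\<Sum>k\<in>F. nonlin L v k * g k) = 0" unfolding S by linarith
qed

text \<open>Sup norm of \<open>v\<close> times square norm of its gradient. Agmon gives the first
  factor, where 75 * 2 / L^2 divided by (2 pi / L)^2 is the constant 75 / (2 pi^2), free of L;
  interpolation gives the second.\<close>

lemma advect_self_bound:
  fixes g :: "int^2 \<Rightarrow> real"
  assumes L: "0 < L" and F: "finite F" "0 \<notin> F"
  defines "v \<equiv> mode_sum L F g"
  shows "sq_int L (advect v v)"
    and "(l2norm L (advect v v))\<^sup>2 \<le> 75 / (2 * pi\<^sup>2) * (\<Sum>k\<in>F. (g k)\<^sup>2) * (\<Sum>k\<in>F. (lam L k)\<^sup>2 * (g k)\<^sup>2)"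
proof -
  define c where "c k = g k *\<^sub>R perp k" for k
  have vt: "v = trig L F c" by (simp add: v_def mode_sum_trig c_def[abs_def])
  define S where "S = sqrt 2 / L * (\<Sum>k\<in>F. \<bar>g k\<bar>)"
  have S: "norm (v x) \<le> S" for x
  proof -
    have "norm (v x) \<le> (\<Sum>k\<in>F. norm (g k *\<^sub>R mode L k x))"
      unfolding v_def mode_sum_def by (rule norm_sum)
    also have "\<dots> \<le> (\<Sum>k\<in>F. \<bar>g k\<bar> * (sqrt 2 / L))"
    proof (rule sum_mono)
      fix k assume "k \<in> F"
      then have "k \<noteq> 0" using F by auto
      then have "norm (mode L k x) \<le> sqrt 2 / L" using cas_bound[OF L, of k x] by (simp add: mode_def norm_perp)
      from mult_left_mono[OF this, of "\<bar>g k\<bar>"]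
      show "norm (g k *\<^sub>R mode L k x) \<le> \<bar>g k\<bar> * (sqrt 2 / L)" by simp
    qed
    also have "\<dots> = S" by (simp only: S_def sum_distrib_right mult.commute)
    finally show ?thesis .
  qed
  have m: "advect v v \<in> borel_measurable (lebesgue_on (cell L))"
  proof -
    have "continuous_on UNIV (advect v v)"
      unfolding advect_def[abs_def] vt pd_trig_trig by (intro continuous_intros continuous_trig)
    then show ?thesis by (intro sq_int_measurable sq_int_continuous)
  qed
  let ?D = "\<lambda>x. \<Sum>i\<in>UNIV. (norm (pd i v x))\<^sup>2"
  have pdq: "sq_int L (pd i v)" for i unfolding vt pd_trig_trig by (rule sq_int_trig)
  have hi: "integrable (lebesgue_on (cell L)) (\<lambda>x. S\<^sup>2 * ?D x)"
    using pdq by (intro integrable_mult_right Bochner_Integration.integrable_sum) (simp add: sq_int_def)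
  have le: "(norm (advect v v x))\<^sup>2 \<le> S\<^sup>2 * ?D x" for x
  proof -
    have "(norm (advect v v x))\<^sup>2 \<le> (norm (v x))\<^sup>2 * ?D x"
      unfolding advect_def by (rule norm_inner_combination_le)
    also have "\<dots> \<le> S\<^sup>2 * ?D x" using S by (intro mult_right_mono power_mono sum_nonneg) auto
    finally show ?thesis .
  qed
  show "sq_int L (advect v v)" by (rule l2norm_le_pointwise(1)[OF m hi le])
  have pd2: "integral\<^sup>L (lebesgue_on (cell L)) (\<lambda>x. (norm (pd i v x))\<^sup>2) =
      (\<Sum>k\<in>F. (2 * pi / L * of_int (k $ i))\<^sup>2 * (g k)\<^sup>2)" for i
  proof -
    have "integral\<^sup>L (lebesgue_on (cell L)) (\<lambda>x. (norm (pd i v x))\<^sup>2) = l2inner L (pd i v) (pd i v)"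
      by (simp add: l2inner_eq power2_norm_eq_inner)
    also have "\<dots> = (\<Sum>k\<in>F. (2 * pi / L * of_int (k $ i))\<^sup>2 * (c k \<bullet> c k))"
      unfolding vt pd_trig_trig using F
      by (subst l2norm_trig[OF L]) (simp_all add: sum.reindex inj_on_def power2_eq_square mult_ac)
    also have "\<dots> = (\<Sum>k\<in>F. (2 * pi / L * of_int (k $ i))\<^sup>2 * (g k)\<^sup>2)"
    proof (rule sum.cong[OF refl])
      fix k assume "k \<in> F"
      then have "perp k \<bullet> perp k = 1" using F by (intro perp_inner_self) auto
      then show "(2 * pi / L * of_int (k $ i))\<^sup>2 * (c k \<bullet> c k) = (2 * pi / L * of_int (k $ i))\<^sup>2 * (g k)\<^sup>2"
        by (simp add: c_def power2_eq_square)
    qed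
    finally show ?thesis .
  qed
  have "integral\<^sup>L (lebesgue_on (cell L)) ?D = (\<Sum>k\<in>F. lam L k * (g k)\<^sup>2)"
  proof -
    have "integral\<^sup>L (lebesgue_on (cell L)) ?D = (\<Sum>i\<in>UNIV. \<Sum>k\<in>F. (2 * pi / L * of_int (k $ i))\<^sup>2 * (g k)\<^sup>2)"
      using pdq by (subst Bochner_Integration.integral_sum) (simp_all add: sq_int_def pd2)
    also have "\<dots> = (\<Sum>k\<in>F. \<Sum>i\<in>UNIV. (2 * pi / L * of_int (k $ i))\<^sup>2 * (g k)\<^sup>2)" by (rule sum.swap)
    also have "\<dots> = (\<Sum>k\<in>F. lam L k * (g k)\<^sup>2)"
      by (intro sum.cong refl) (simp add: sum_2 lam_def ksq_def power_mult_distrib power_divide algebra_simps add_divide_distrib)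
    finally show ?thesis .
  qed
  then have main: "(l2norm L (advect v v))\<^sup>2 \<le> S\<^sup>2 * (\<Sum>k\<in>F. lam L k * (g k)\<^sup>2)"
    using l2norm_le_pointwise(2)[OF m hi le] by simp
  define E where "E = (\<Sum>k\<in>F. (g k)\<^sup>2)"
  define A where "A = (\<Sum>k\<in>F. (lam L k)\<^sup>2 * (g k)\<^sup>2)"
  define \<mu> where "\<mu> = (2 * pi / L)\<^sup>2"
  have \<mu>: "0 < \<mu>" using L by (simp add: \<mu>_def)
  have EA: "0 \<le> E" "0 \<le> A" by (auto simp: E_def A_def sum_nonneg)
  have A: "A = \<mu>\<^sup>2 * (\<Sum>k\<in>F. (ksq k)\<^sup>2 * (g k)\<^sup>2)"
  proof -
    have "lam L k = \<mu> * ksq k" for k by (simp only: lam_def \<mu>_def)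
    then show ?thesis by (simp only: A_def power_mult_distrib sum_distrib_left mult.assoc)
  qed
  have "(\<Sum>k\<in>F. \<bar>g k\<bar>)\<^sup>2 \<le> 75 * (sqrt E * sqrt (\<Sum>k\<in>F. (ksq k)\<^sup>2 * (g k)\<^sup>2))"
    unfolding E_def by (rule discrete_agmon[OF F])
  also have "sqrt (\<Sum>k\<in>F. (ksq k)\<^sup>2 * (g k)\<^sup>2) = sqrt A / \<mu>"
    using \<mu> by (simp add: A real_sqrt_mult)
  finally have agmon: "(\<Sum>k\<in>F. \<bar>g k\<bar>)\<^sup>2 \<le> 75 * (sqrt E * (sqrt A / \<mu>))" .
  have S2: "S\<^sup>2 \<le> 75 / (2 * pi\<^sup>2) * (sqrt E * sqrt A)"
  proof -
    have "S\<^sup>2 = 2 / L\<^sup>2 * (\<Sum>k\<in>F. \<bar>g k\<bar>)\<^sup>2" by (simp add: S_def power_mult_distrib power_divide)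
    also have "\<dots> \<le> 2 / L\<^sup>2 * (75 * (sqrt E * (sqrt A / \<mu>)))" using agmon by (intro mult_left_mono) auto
    also have "\<dots> = 75 / (2 * pi\<^sup>2) * (sqrt E * sqrt A)"
      using L by (simp add: \<mu>_def power_divide power_mult_distrib)
    finally show ?thesis .
  qed
  \<comment> \<open>The gradient norm lies between |v| and |Av|, by Cauchy-Schwarz on the
    coefficients.\<close>
  have grad: "(\<Sum>k\<in>F. lam L k * (g k)\<^sup>2) \<le> sqrt E * sqrt A"
  proof -
    have "(\<Sum>k\<in>F. g k * (lam L k * g k))\<^sup>2 \<le> E * (\<Sum>k\<in>F. (lam L k * g k)\<^sup>2)"
      unfolding E_def by (rule Cauchy_Schwarz_ineq_sum)
    also have "(\<Sum>k\<in>F. (lam L k * g k)\<^sup>2) = A" by (simp add: A_def power_mult_distrib)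
    finally have "sqrt ((\<Sum>k\<in>F. g k * (lam L k * g k))\<^sup>2) \<le> sqrt (E * A)" by (rule real_sqrt_le_mono)
    then have "(\<Sum>k\<in>F. g k * (lam L k * g k)) \<le> sqrt E * sqrt A" by (simp add: real_sqrt_mult)
    then show ?thesis by (simp add: power2_eq_square mult_ac)
  qed
  have "S\<^sup>2 * (\<Sum>k\<in>F. lam L k * (g k)\<^sup>2) \<le> 75 / (2 * pi\<^sup>2) * (sqrt E * sqrt A) * (sqrt E * sqrt A)"
    using S2 grad EA by (intro mult_mono) (auto intro!: sum_nonneg simp: lam_def ksq_nonneg)
  also have "\<dots> = 75 / (2 * pi\<^sup>2) * ((sqrt E * sqrt E) * (sqrt A * sqrt A))" by (simp only: mult_ac)
  also have "\<dots> = 75 / (2 * pi\<^sup>2) * E * A" using EA by simp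
  finally show "(l2norm L (advect v v))\<^sup>2 \<le> 75 / (2 * pi\<^sup>2) * E * A" using main by linarith
qed

lemma nonlin_mode_sum_bound:
  assumes L: "0 < L" and F: "finite F" "0 \<notin> F" and G: "finite G" "0 \<notin> G"
  shows "(\<Sum>k\<in>G. (nonlin L (mode_sum L F g) k)\<^sup>2) \<le>
    75 / (2 * pi\<^sup>2) * (\<Sum>k\<in>F. (g k)\<^sup>2) * (\<Sum>k\<in>F. (lam L k)\<^sup>2 * (g k)\<^sup>2)"
proof -
  have "(\<Sum>k\<in>G. (nonlin L (mode_sum L F g) k)\<^sup>2) =
      (\<Sum>k\<in>G. (coef L (advect (mode_sum L F g) (mode_sum L F g)) k)\<^sup>2)"
    by (simp add: nonlin_mode_sum(1)[OF L F] coef_def)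
  also have "\<dots> \<le> (l2norm L (advect (mode_sum L F g) (mode_sum L F g)))\<^sup>2"
    by (rule bessel[OF L G advect_self_bound(1)[OF L F]])
  finally show ?thesis using advect_self_bound(2)[OF L F, of g] by linarith
qed

text \<open>Both facts are proved for the mode sums of \<open>u\<close>, with the tested set
  \<open>modes m\<close> fixed while the approximation is refined; the bound survives because it
  does not depend on \<open>m\<close>.\<close>

lemma nonlin_dom_stokes:
  assumes L: "0 < L" and u: "u \<in> dom_stokes L"
  shows "(\<Sum>k\<in>modes m. (nonlin L u k)\<^sup>2) \<le> 75 / (2 * pi\<^sup>2) * (l2norm L u)\<^sup>2 * (l2norm L (stokes L u))\<^sup>2"
    and "(\<lambda>m. \<Sum>k\<in>modes m. nonlin L u k * coef L u k) \<longlonglongrightarrow> 0"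
proof -
  have uH: "u \<in> H L" using u by (simp add: dom_stokes_def)
  note uq = H_sq_int[OF uH]
  define e a where "e = (l2norm L u)\<^sup>2" and "a = (l2norm L (stokes L u))\<^sup>2"
  define v where "v n = mode_sum L (modes n) (coef L u)" for n
  define B where "B = 75 / (2 * pi\<^sup>2) * e * a"
  have ea: "0 \<le> e" "0 \<le> a" by (simp_all add: e_def a_def)
  have E: "(\<lambda>n. \<Sum>k\<in>modes n. (coef L u k)\<^sup>2) \<longlonglongrightarrow> e" unfolding e_def by (rule parseval[OF L uH])
  have A: "(\<lambda>n. \<Sum>k\<in>modes n. (lam L k)\<^sup>2 * (coef L u k)\<^sup>2) \<longlonglongrightarrow> a" unfolding a_def by (rule stokes_norm[OF L u])
  have E_le: "(\<Sum>k\<in>modes n. (coef L u k)\<^sup>2) \<le> e" for n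
    by (rule incseq_le[OF _ E]) (intro incseq_sum_nonneg incseq_modes finite_modes, simp)
  have A_le: "(\<Sum>k\<in>modes n. (lam L k)\<^sup>2 * (coef L u k)\<^sup>2) \<le> a" for n
    by (rule incseq_le[OF _ A]) (intro incseq_sum_nonneg incseq_modes finite_modes, simp)
  have bound: "(\<Sum>k\<in>modes m. (nonlin L (v n) k)\<^sup>2) \<le> B" for m n
  proof -
    have "(\<Sum>k\<in>modes m. (nonlin L (v n) k)\<^sup>2) \<le>
        75 / (2 * pi\<^sup>2) * (\<Sum>k\<in>modes n. (coef L u k)\<^sup>2) * (\<Sum>k\<in>modes n. (lam L k)\<^sup>2 * (coef L u k)\<^sup>2)"
      unfolding v_def by (rule nonlin_mode_sum_bound[OF L finite_modes zero_notin_modes finite_modes zero_notin_modes])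
    also have "\<dots> \<le> B" unfolding B_def using ea
      by (intro mult_mono mult_left_mono E_le A_le) (auto intro!: sum_nonneg)
    finally show ?thesis .
  qed
  have lim: "(\<lambda>n. nonlin L (v n) k) \<longlonglongrightarrow> nonlin L u k" for k
  proof (rule tendsto_nonlin[OF L uq])
    show "\<forall>\<^sub>F n in sequentially. sq_int L (v n)" by (simp add: v_def sq_int_mode_sum)
    show "(\<lambda>n. l2norm L (\<lambda>x. v n x - u x)) \<longlonglongrightarrow> 0"
      using H_approx[OF L uH] by (simp only: v_def l2norm_minus_commute[of L u])
  qed
  show "(\<Sum>k\<in>modes m. (nonlin L u k)\<^sup>2) \<le> 75 / (2 * pi\<^sup>2) * (l2norm L u)\<^sup>2 * (l2norm L (stokes L u))\<^sup>2" for m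
  proof -
    have "(\<lambda>n. \<Sum>k\<in>modes m. (nonlin L (v n) k)\<^sup>2) \<longlonglongrightarrow> (\<Sum>k\<in>modes m. (nonlin L u k)\<^sup>2)"
      by (intro tendsto_intros lim)
    then have "(\<Sum>k\<in>modes m. (nonlin L u k)\<^sup>2) \<le> B"
      by (rule LIMSEQ_le_const2) (use bound in blast)
    then show ?thesis by (simp only: B_def e_def a_def)
  qed
  \<comment> \<open>For \<open>v n\<close> the full sum vanishes, so the part over
    \<open>modes m\<close> is minus the part over the modes beyond. There Cauchy-Schwarz leaves the
    square root of the energy tail, uniformly in \<open>n\<close>.\<close>
  have tail: "\<bar>\<Sum>k\<in>modes m. nonlin L u k * coef L u k\<bar> \<le> sqrt B * sqrt (e - (\<Sum>k\<in>modes m. (coef L u k)\<^sup>2))" for m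
  proof -
    have "\<bar>\<Sum>k\<in>modes m. nonlin L (v n) k * coef L u k\<bar> \<le> sqrt B * sqrt (e - (\<Sum>k\<in>modes m. (coef L u k)\<^sup>2))"
      if "m \<le> n" for n
    proof -
      have sub: "modes m \<subseteq> modes n" using incseq_modes that by (auto dest: monoD)
      have split: "(\<Sum>k\<in>modes n. f k) = (\<Sum>k\<in>modes n - modes m. f k) + (\<Sum>k\<in>modes m. f k)" for f :: "int^2 \<Rightarrow> real"
        by (rule sum.subset_diff[OF sub finite_modes])
      have "(\<Sum>k\<in>modes n. nonlin L (v n) k * coef L u k) = 0"
        unfolding v_def by (rule nonlin_mode_sum(2)[OF L finite_modes zero_notin_modes])
      then have "\<bar>\<Sum>k\<in>modes m. nonlin L (v n) k * coef L u k\<bar> = \<bar>\<Sum>k\<in>modes n - modes m. nonlin L (v n) k * coef L u k\<bar>"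
        unfolding split[of "\<lambda>k. nonlin L (v n) k * coef L u k"] by linarith
      also have "\<dots> = sqrt ((\<Sum>k\<in>modes n - modes m. nonlin L (v n) k * coef L u k)\<^sup>2)" by simp
      also have "\<dots> \<le> sqrt ((\<Sum>k\<in>modes n - modes m. (nonlin L (v n) k)\<^sup>2) * (\<Sum>k\<in>modes n - modes m. (coef L u k)\<^sup>2))"
        by (intro real_sqrt_le_mono Cauchy_Schwarz_ineq_sum)
      also have "\<dots> \<le> sqrt (B * (e - (\<Sum>k\<in>modes m. (coef L u k)\<^sup>2)))"
      proof (intro real_sqrt_le_mono mult_mono)
        have "(\<Sum>k\<in>modes n - modes m. (nonlin L (v n) k)\<^sup>2) \<le> (\<Sum>k\<in>modes n. (nonlin L (v n) k)\<^sup>2)"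
          by (intro sum_mono2 finite_modes) auto
        then show "(\<Sum>k\<in>modes n - modes m. (nonlin L (v n) k)\<^sup>2) \<le> B" using bound[of n n] by linarith
        show "(\<Sum>k\<in>modes n - modes m. (coef L u k)\<^sup>2) \<le> e - (\<Sum>k\<in>modes m. (coef L u k)\<^sup>2)"
          using E_le[of n] split[of "\<lambda>k. (coef L u k)\<^sup>2"] by linarith
        show "0 \<le> B" using ea by (simp add: B_def)
      qed (auto intro!: sum_nonneg)
      finally show ?thesis by (simp only: real_sqrt_mult)
    qed
    moreover have "(\<lambda>n. \<bar>\<Sum>k\<in>modes m. nonlin L (v n) k * coef L u k\<bar>) \<longlonglongrightarrow> \<bar>\<Sum>k\<in>modes m. nonlin L u k * coef L u k\<bar>"
      by (intro tendsto_intros lim)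
    ultimately show ?thesis by (intro LIMSEQ_le_const2[of _ _ "sqrt B * sqrt (e - (\<Sum>k\<in>modes m. (coef L u k)\<^sup>2))"]) blast+
  qed
  have "(\<lambda>m. sqrt B * sqrt (e - (\<Sum>k\<in>modes m. (coef L u k)\<^sup>2))) \<longlonglongrightarrow> sqrt B * sqrt (e - e)"
    by (intro tendsto_intros E)
  then have z: "(\<lambda>m. sqrt B * sqrt (e - (\<Sum>k\<in>modes m. (coef L u k)\<^sup>2))) \<longlonglongrightarrow> 0" by simp
  show "(\<lambda>m. \<Sum>k\<in>modes m. nonlin L u k * coef L u k) \<longlonglongrightarrow> 0"
    by (rule Lim_null_comparison[OF _ z]) (use tail in \<open>auto intro!: always_eventually\<close>)
qed

section \<open>The solution\<close>

lemma tendsto_coef: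
  assumes L: "0 < L" and k: "k \<noteq> 0" and u: "sq_int L u" and v: "\<forall>\<^sub>F n in F. sq_int L (v n)"
    and lim: "((\<lambda>n. l2norm L (\<lambda>x. v n x - u x)) \<longlongrightarrow> 0) F"
  shows "((\<lambda>n. coef L (v n) k) \<longlongrightarrow> coef L u k) F"
proof (rule LIM_zero_cancel, rule Lim_null_comparison[OF _ lim])
  have n: "l2norm L (mode L k) = 1"
    using l2inner_mode_mode[OF L k, of k] by (simp add: l2norm_def)
  show "\<forall>\<^sub>F n in F. norm (coef L (v n) k - coef L u k) \<le> l2norm L (\<lambda>x. v n x - u x)"
    using v
  proof eventually_elim
    case (elim n)
    have "coef L (v n) k - coef L u k = l2inner L (\<lambda>x. v n x - u x) (mode L k)"
      unfolding coef_def by (rule l2inner_diff_left[OF elim u sq_int_mode, symmetric])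
    then show ?case
      using l2inner_Cauchy_Schwarz[OF sq_int_diff[OF elim u] sq_int_mode[of L k]] by (simp add: n)
  qed
qed

lemma tendsto_l2norm:
  assumes u: "sq_int L u" and v: "\<forall>\<^sub>F n in F. sq_int L (v n)"
    and lim: "((\<lambda>n. l2norm L (\<lambda>x. v n x - u x)) \<longlongrightarrow> 0) F"
  shows "((\<lambda>n. l2norm L (v n)) \<longlongrightarrow> l2norm L u) F"
proof (rule LIM_zero_cancel, rule Lim_null_comparison[OF _ lim])
  show "\<forall>\<^sub>F n in F. norm (l2norm L (v n) - l2norm L u) \<le> l2norm L (\<lambda>x. v n x - u x)"
    using v by eventually_elim (simp add: l2norm_diff_abs_le[OF _ u])
qed

lemma l2inner_zero_right: "l2inner L u (\<lambda>x. 0) = 0"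
  by (simp add: l2inner_eq)

lemma l2inner_zero_left: "l2inner L (\<lambda>x. 0) u = 0"
  by (simp add: l2inner_eq)

text \<open>Tested with a single mode, the integrated weak equation has a continuous integrand, so
  it can be differentiated at every positive time and not merely almost everywhere.\<close>

lemma DERIV_from_lebesgue_integral:
  fixes y h :: "real \<Rightarrow> real"
  assumes h: "continuous_on {0..} h" and t: "0 < t"
    and y: "\<And>r. 0 \<le> r \<Longrightarrow> y r - y 0 = set_lebesgue_integral lebesgue {0..r} h"
  shows "(y has_real_derivative h t) (at t)"
proof -
  have eq: "y 0 + integral {0..r} h = y r" if "0 \<le> r" for r
  proof -
    have "continuous_on {0..r} h" using h by (rule continuous_on_subset) auto
    then have "set_lebesgue_integral lebesgue {0..r} h = integral {0..r} h"
      by (intro set_lebesgue_integral_eq_integral absolutely_integrable_continuous_real)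
    then show ?thesis using y[OF that] by simp
  qed
  \<comment> \<open>Integrating up to t + 1 makes \<open>t\<close> an interior point, so the
    derivative within the interval is two-sided.\<close>
  have c: "continuous_on {0..t + 1} h" using h by (rule continuous_on_subset) auto
  have "((\<lambda>r. integral {0..r} h) has_real_derivative h t) (at t within {0..t + 1})"
    by (rule integral_has_real_derivative[OF c]) (use t in auto)
  moreover have "at t within {0..t + 1} = at t"
    by (rule at_within_Icc_at) (use t in auto)
  ultimately have "((\<lambda>r. y 0 + integral {0..r} h) has_real_derivative 0 + h t) (at t)"
    by (intro DERIV_add DERIV_const) simp
  then have "((\<lambda>r. y 0 + integral {0..r} h) has_real_derivative h t) (at t)" by simp
  then show ?thesis
    by (rule has_field_derivative_transform_within_open[of _ _ _ "{0<..}"]) (use t eq in auto)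
qed

text \<open>Modes are admissible test fields: they remove the pressure and diagonalise the squared
  Laplacian. Continuity of the solution in the square norm makes both terms of each scalar equation
  continuous in time.\<close>

lemma hns_solution_galerkin:
  assumes L: "0 < L" and \<nu>: "0 < \<nu>" and sol: "hns_solution \<nu> L (\<lambda>s x. 0) u0 u p"
  shows "galerkin_system modes (\<lambda>k. (lam L k)\<^sup>2) \<nu> (75 / (2 * pi\<^sup>2)) (((2 * pi / L)\<^sup>2)\<^sup>2)
    (\<lambda>k t. coef L (u t) k) (\<lambda>k t. nonlin L (u t) k)
    (\<lambda>t. (l2norm L (u t))\<^sup>2) (\<lambda>t. (l2norm L (stokes L (u t)))\<^sup>2)"
proof -
  have uH: "u t \<in> H L" if "0 \<le> t" for t
    using sol that unfolding hns_solution_def by blast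
  have cu: "((\<lambda>s. l2norm L (\<lambda>x. u s x - u t x)) \<longlongrightarrow> 0) (at t within {0..})" if "0 \<le> t" for t
    using sol that unfolding hns_solution_def by blast
  have dom: "AE s in lebesgue. 0 \<le> s \<longrightarrow> u s \<in> dom_stokes L"
    using sol unfolding hns_solution_def by blast
  have int: "set_integrable lebesgue {0..t} (\<lambda>s. (l2norm L (stokes L (u s)))\<^sup>2)" if "0 \<le> t" for t
    using sol that unfolding hns_solution_def by blast
  have weak: "l2inner L (u t) \<phi> - l2inner L (u 0) \<phi> =
      set_lebesgue_integral lebesgue {0..t} (\<lambda>s. - \<nu> * l2inner L (u s) (laplacian (laplacian \<phi>))
        + l2inner L (u s) (advect (u s) \<phi>) + l2inner L (p s) (divergence \<phi>) + l2inner L (\<lambda>x. 0) \<phi>)"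
    if "0 \<le> t" "\<phi> \<in> trig_poly L" for t \<phi>
    using sol that unfolding hns_solution_def by blast
  have uq: "sq_int L (u t)" if "0 \<le> t" for t by (rule H_sq_int[OF uH[OF that]])
  have ev: "\<forall>\<^sub>F s in at t within {0..}. sq_int L (u s)" for t
    unfolding eventually_at_filter by (rule always_eventually) (simp add: uq)
  have c_coef: "continuous_on {0..} (\<lambda>t. coef L (u t) k)" if "k \<noteq> 0" for k
    unfolding continuous_on_def by (intro ballI tendsto_coef[OF L that uq ev cu]) auto
  have c_non: "continuous_on {0..} (\<lambda>t. nonlin L (u t) k)" for k
    unfolding continuous_on_def by (intro ballI tendsto_nonlin[OF L uq ev cu]) auto
  have c_norm: "continuous_on {0..} (\<lambda>t. l2norm L (u t))"
    unfolding continuous_on_def by (intro ballI tendsto_l2norm[OF uq ev cu]) auto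
  have deriv: "((\<lambda>t. coef L (u t) k) has_real_derivative
      - \<nu> * (lam L k)\<^sup>2 * coef L (u t) k + nonlin L (u t) k) (at t)" if k: "k \<noteq> 0" and t: "0 < t" for k t
  proof (rule DERIV_from_lebesgue_integral[OF _ t])
    show "continuous_on {0..} (\<lambda>t. - \<nu> * (lam L k)\<^sup>2 * coef L (u t) k + nonlin L (u t) k)"
      by (intro continuous_intros c_coef[OF k] c_non)
    fix r :: real assume r: "0 \<le> r"
    have tp: "mode L k \<in> trig_poly L" unfolding trig_poly_iff[OF L] mode_trig by blast
    show "coef L (u r) k - coef L (u 0) k =
        set_lebesgue_integral lebesgue {0..r} (\<lambda>t. - \<nu> * (lam L k)\<^sup>2 * coef L (u t) k + nonlin L (u t) k)"
      \<comment> \<open>The pressure drops out because a mode has zero divergence.\<close>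
      using weak[OF r tp]
      by (simp only: coef_def nonlin_def bilaplacian_mode divergence_mode l2inner_scaleR_right
          l2inner_zero_left l2inner_zero_right add_0_right mult.assoc)
  qed
  have sub: "{0<..} \<subseteq> {0 :: real..}" by auto
  show ?thesis
  proof
    show "finite (modes n)" for n by (rule finite_modes)
    show "incseq modes" by (rule incseq_modes)
    show "0 < \<nu>" by (rule \<nu>)
    show "0 \<le> 75 / (2 * pi\<^sup>2)" by simp
    show "0 < ((2 * pi / L)\<^sup>2)\<^sup>2" using L by simp
    show "((2 * pi / L)\<^sup>2)\<^sup>2 \<le> (lam L k)\<^sup>2" if "k \<in> modes n" for k n
      using lam_ge[OF modes_nonzero[OF that]] by (intro power_mono) auto
    show "((\<lambda>t. coef L (u t) k) has_real_derivative
        - \<nu> * (lam L k)\<^sup>2 * coef L (u t) k + nonlin L (u t) k) (at t)" if "k \<in> modes n" "0 < t" for k n t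
      using deriv[OF modes_nonzero[OF that(1)] that(2)] .
    show "continuous_on {0<..} (\<lambda>t. nonlin L (u t) k)" for k
      using c_non sub by (rule continuous_on_subset)
    show "(\<lambda>n. \<Sum>k\<in>modes n. (coef L (u t) k)\<^sup>2) \<longlonglongrightarrow> (l2norm L (u t))\<^sup>2" if "0 < t" for t
      using that by (intro parseval[OF L uH]) simp
    show "continuous_on {0<..} (\<lambda>t. (l2norm L (u t))\<^sup>2)"
      by (intro continuous_intros continuous_on_subset[OF c_norm sub])
    show "set_integrable lebesgue {s..t} (\<lambda>t. (l2norm L (stokes L (u t)))\<^sup>2)" if "0 < s" "s \<le> t" for s t
      by (rule set_integrable_subset[OF int[of t]]) (use that in auto)
    show "AE s in lebesgue. 0 < s \<longrightarrow>
        (\<lambda>n. \<Sum>k\<in>modes n. (lam L k)\<^sup>2 * (coef L (u s) k)\<^sup>2) \<longlonglongrightarrow> (l2norm L (stokes L (u s)))\<^sup>2"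
      using dom by eventually_elim (simp add: stokes_norm[OF L])
    show "AE s in lebesgue. 0 < s \<longrightarrow> (\<forall>n. (\<Sum>k\<in>modes n. (nonlin L (u s) k)\<^sup>2) \<le>
        75 / (2 * pi\<^sup>2) * (l2norm L (u s))\<^sup>2 * (l2norm L (stokes L (u s)))\<^sup>2)"
      using dom by eventually_elim (use nonlin_dom_stokes(1)[OF L] in auto)
    show "AE s in lebesgue. 0 < s \<longrightarrow> (\<lambda>n. \<Sum>k\<in>modes n. nonlin L (u s) k * coef L (u s) k) \<longlonglongrightarrow> 0"
      using dom by eventually_elim (use nonlin_dom_stokes(2)[OF L] in auto)
  qed
qed

section \<open>From the energy to the norm, and the choice of constants\<close>

lemma sqrt_exp_bound:
  fixes x y :: real
  assumes "exp (- (2 * K) * h) * x\<^sup>2 \<le> y\<^sup>2" "0 \<le> y"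
  shows "exp (- K * h) * x \<le> y"
proof (rule power2_le_imp_le)
  have "(exp (- K * h) * x)\<^sup>2 = exp (- (2 * K) * h) * x\<^sup>2"
    by (simp add: power_mult_distrib flip: exp_of_nat_mult)
  then show "(exp (- K * h) * x)\<^sup>2 \<le> y\<^sup>2" using assms by simp
qed (rule assms)

theorem theorem3p3:
  fixes \<nu> :: real
  assumes "\<nu> > 0"
  shows "\<exists>c>0. \<forall>L>0.
    lambda1 L = (2 * pi / L)\<^sup>2 \<and>
    (\<forall>u0\<in>H L. \<forall>u p t0 t.
       hns_solution \<nu> L (\<lambda>s x. 0) u0 u p \<and> 0 < t0 \<and> t0 \<le> t \<and> l2norm L (u t0) \<noteq> 0 \<longrightarrow>
       u t0 \<in> dom_stokes L \<and>
       (let b = \<nu> * ((l2norm L (stokes L (u t0)))\<^sup>2 / (l2norm L (u t0))\<^sup>2)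
                  * exp (c * \<nu> powr (- 3 / 2) / (lambda1 L)\<^sup>2 * (l2norm L (u t0))\<^sup>2)
        in exp (- b * (t - t0)) * l2norm L (u t0) \<le> l2norm L (u t) \<and>
           l2norm L (u t) \<le> exp (- \<nu> * (lambda1 L)\<^sup>2 * (t - t0)) * l2norm L (u t0)))"
proof -
  define C where "C = 75 / (2 * pi\<^sup>2)"
  \<comment> \<open>The power of \<nu> turns the exponent into C e / (2 \<nu>^2
    \<open>lambda1\<close>^2), the one delivered by \<open>energy_lower_bound\<close>. The choice
    precedes L and the solution.\<close>
  define c where "c = C / 2 * \<nu> powr (- 1 / 2)"
  have c: "0 < c" using assms by (simp add: c_def C_def)
  have powr: "c * \<nu> powr (- 3 / 2) = C / (2 * \<nu>\<^sup>2)"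
  proof -
    have "\<nu> powr (- 1 / 2) * \<nu> powr (- 3 / 2) = \<nu> powr (- 2)"
      by (simp flip: powr_add)
    also have "\<dots> = 1 / \<nu>\<^sup>2" using assms by (simp add: powr_minus_divide)
    finally have "C / 2 * (\<nu> powr (- 1 / 2) * \<nu> powr (- 3 / 2)) = C / 2 * (1 / \<nu>\<^sup>2)" by (simp only:)
    then show ?thesis by (simp add: c_def mult.assoc)
  qed
  have main: "u t0 \<in> dom_stokes L \<and>
       (let b = \<nu> * ((l2norm L (stokes L (u t0)))\<^sup>2 / (l2norm L (u t0))\<^sup>2)
                  * exp (c * \<nu> powr (- 3 / 2) / (lambda1 L)\<^sup>2 * (l2norm L (u t0))\<^sup>2)
        in exp (- b * (t - t0)) * l2norm L (u t0) \<le> l2norm L (u t) \<and>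
           l2norm L (u t) \<le> exp (- \<nu> * (lambda1 L)\<^sup>2 * (t - t0)) * l2norm L (u t0))"
    if L: "0 < L" and sol: "hns_solution \<nu> L (\<lambda>s x. 0) u0 u p" and t: "0 < t0" "t0 \<le> t"
      and nz: "l2norm L (u t0) \<noteq> 0" for L u0 u p t0 t
  proof -
    interpret galerkin_system modes "\<lambda>k. (lam L k)\<^sup>2" \<nu> "75 / (2 * pi\<^sup>2)" "((2 * pi / L)\<^sup>2)\<^sup>2"
        "\<lambda>k t. coef L (u t) k" "\<lambda>k t. nonlin L (u t) k"
        "\<lambda>t. (l2norm L (u t))\<^sup>2" "\<lambda>t. (l2norm L (stokes L (u t)))\<^sup>2"
      by (rule hns_solution_galerkin[OF L assms sol])
    have uH: "u t0 \<in> H L" using sol t unfolding hns_solution_def by auto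
    \<comment> \<open>The solution class gives membership in D(A) only at almost every time. The
      bound on all truncated sums gives it at \<open>t0\<close> itself, so the Stokes norm in b is
      the limit of \<open>An\<close>.\<close>
    obtain B where "\<And>n. An n t0 \<le> B" using An_bounded[OF t(1)] by blast
    then have dom: "u t0 \<in> dom_stokes L"
      unfolding An_def by (rule dom_stokesI[OF L uH])
    have A: "(\<lambda>n. An n t0) \<longlonglongrightarrow> (l2norm L (stokes L (u t0)))\<^sup>2"
      unfolding An_def by (rule stokes_norm[OF L dom])
    have e: "0 < (l2norm L (u t0))\<^sup>2" using nz by simp
    \<comment> \<open>The energy decays at most at the rate 2 \<nu> \<open>\<Lambda>\<close>; the
      square root halves it, so b is \<nu> \<open>\<Lambda>\<close>.\<close>
    define \<Lambda> where "\<Lambda> = (l2norm L (stokes L (u t0)))\<^sup>2 / (l2norm L (u t0))\<^sup>2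
        * exp (C / (2 * \<nu>\<^sup>2 * ((2 * pi / L)\<^sup>2)\<^sup>2) * (l2norm L (u t0))\<^sup>2)"
    have "exp (- (2 * \<nu> * \<Lambda>) * (t - t0)) * (l2norm L (u t0))\<^sup>2 \<le> (l2norm L (u t))\<^sup>2"
      by (rule energy_lower_bound[OF t e A]) (simp only: \<Lambda>_def C_def)
    then have "exp (- (\<nu> * \<Lambda>) * (t - t0)) * l2norm L (u t0) \<le> l2norm L (u t)"
      unfolding mult.assoc[of 2 \<nu>] by (rule sqrt_exp_bound) (rule l2norm_nonneg)
    moreover have "\<nu> * \<Lambda> = \<nu> * ((l2norm L (stokes L (u t0)))\<^sup>2 / (l2norm L (u t0))\<^sup>2)
        * exp (c * \<nu> powr (- 3 / 2) / (lambda1 L)\<^sup>2 * (l2norm L (u t0))\<^sup>2)"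
      by (simp only: \<Lambda>_def powr lambda1_eq[OF L] divide_divide_eq_left mult.assoc)
    ultimately have lower: "exp (- (\<nu> * ((l2norm L (stokes L (u t0)))\<^sup>2 / (l2norm L (u t0))\<^sup>2)
        * exp (c * \<nu> powr (- 3 / 2) / (lambda1 L)\<^sup>2 * (l2norm L (u t0))\<^sup>2)) * (t - t0)) * l2norm L (u t0)
      \<le> l2norm L (u t)" by (simp only:)
    have "(l2norm L (u t))\<^sup>2 \<le> exp (- (2 * \<nu> * ((2 * pi / L)\<^sup>2)\<^sup>2) * (t - t0)) * (l2norm L (u t0))\<^sup>2"
      by (rule energy_upper_bound[OF t])
    also have "\<dots> = (exp (- \<nu> * (lambda1 L)\<^sup>2 * (t - t0)) * l2norm L (u t0))\<^sup>2"
      by (simp add: lambda1_eq[OF L] power_mult_distrib mult.assoc flip: exp_of_nat_mult)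
    finally have upper: "l2norm L (u t) \<le> exp (- \<nu> * (lambda1 L)\<^sup>2 * (t - t0)) * l2norm L (u t0)"
      by (rule power2_le_imp_le) (simp add: l2norm_nonneg)
    show ?thesis unfolding Let_def by (intro conjI dom lower upper)
  qed
  show ?thesis
    by (rule exI[of _ c], rule conjI[OF c], intro allI impI, rule conjI, erule lambda1_eq,
        intro ballI allI impI, elim conjE, rule main)
qed

end
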